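(* Let $\alpha\in\mathbb R$ with $\sin\alpha>0$, let $\phi\in L^2(\mathbb R)$ with fractional Fourier transform $\Theta_\alpha=\mathcal F_\alpha\phi$, and let $$V_0^\alpha=\Big\{\sum_{n\in\mathbb Z}c[n]\,\phi_{\alpha,0,n}: c\in\ell^2(\mathbb Z)\Big\}\subseteq L^2(\mathbb R).$$ Then $\{\phi_{\alpha,0,n}:n\in\mathbb Z\}$ is a Riesz basis of $V_0^\alpha$ if and only if there exist positive constants $A,B$ such that for a.e. $u\in[0,2\pi\sin\alpha]$ $$A\le \mathcal G^2(\alpha,\phi,u)\le B,\qquad\text{where}\quad \mathcal G(\alpha,\phi,u)=\sqrt{2\pi\sin\alpha\sum_{k\in\mathbb Z}\big|\Theta_\alpha(u+2k\pi\sin\alpha)\big|^2}.$$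
   Context: For $\sin\alpha\neq 0$, the fractional Fourier transform with parameter $\alpha$ is $\mathcal F_\alpha f(u)=\int_{\mathbb R} C_\alpha\exp\{\tfrac{i}{2}(t^2+u^2)\cot\alpha-itu\csc\alpha\}f(t)\,dt$ with $C_\alpha=\sqrt{(1-i\cot\alpha)/(2\pi)}$, extended from $L^1\cap L^2$ to a unitary operator on $L^2(\mathbb R)$. For $n\in\mathbb Z$, $\phi_{\alpha,0,n}(t)=\phi(t-n)\exp\{-\tfrac{i}{2}[t^2-n^2-(t-n)^2]\cot\alpha\}$. In the definition of $V_0^\alpha$ the sums are those of series converging in $L^2(\mathbb R)$. A collection $\{g_n\}_{n\in\mathbb Z}$ is linearly independent if, whenever $a\in\ell^2(\mathbb Z)$ and $\sum_{n\in\mathbb Z}a[n]g_n=0$ in $L^2(\mathbb R)$ (limit of the partial sums over $|n|\le N$), one has $a=0$. A collection $\{g_n\}$ is a Riesz basis of a Hilbert space $\mathcal H$ (here a closed subspace of $L^2(\mathbb R)$ containing the $g_n$; so being a Riesz basis of $V_0^\alpha$ includes that $V_0^\alpha$ is closed) if it is linearly independent and there are constants $A',B'>0$ with $A'\|f\|_2^2\le\sum_n|\langle f,g_n\rangle|^2\le B'\|f\|_2^2$ for all $f\in\mathcal H$. *)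

theory Defs
  imports "HOL-Analysis.Analysis"
begin

text \<open>\<open>L\<^sup>2(\<real>)\<close> is rendered by its Borel representatives: functions are not identified
  when they agree almost everywhere, so equality in \<open>L\<^sup>2(\<real>)\<close> is a.e. equality.\<close>

definition L1R :: "(real \<Rightarrow> complex) set" where
  "L1R = {f. integrable lborel f}"

definition L2R :: "(real \<Rightarrow> complex) set" where
  "L2R = {f \<in> borel_measurable lborel. integrable lborel (\<lambda>x. (cmod (f x))\<^sup>2)}"

definition L2_inner :: "(real \<Rightarrow> complex) \<Rightarrow> (real \<Rightarrow> complex) \<Rightarrow> complex" where
  "L2_inner f g = (LINT x|lborel. f x * cnj (g x))"

definition L2_norm :: "(real \<Rightarrow> complex) \<Rightarrow> real" where
  "L2_norm f = sqrt (LINT x|lborel. (cmod (f x))\<^sup>2)"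

text \<open>Membership in \<open>L\<^sup>2\<close> is part of the notion of convergence, because the Bochner integral of
  a non-integrable function is \<open>0\<close>.\<close>

definition L2_tendsto :: "(nat \<Rightarrow> real \<Rightarrow> complex) \<Rightarrow> (real \<Rightarrow> complex) \<Rightarrow> bool" where
  "L2_tendsto F f \<longleftrightarrow> (\<forall>N. F N \<in> L2R) \<and> f \<in> L2R \<and>
     (\<lambda>N. L2_norm (\<lambda>x. F N x - f x)) \<longlonglongrightarrow> 0"

definition ell2 :: "(int \<Rightarrow> complex) set" where
  "ell2 = {c. (\<lambda>n. (cmod (c n))\<^sup>2) summable_on UNIV}"

definition L2_series :: "(int \<Rightarrow> complex) \<Rightarrow> (int \<Rightarrow> real \<Rightarrow> complex) \<Rightarrow> (real \<Rightarrow> complex) \<Rightarrow> bool" where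
  "L2_series c g f \<longleftrightarrow> L2_tendsto (\<lambda>N t. \<Sum>n\<in>{- int N..int N}. c n * g n t) f"

definition L2_closed_subspace :: "(real \<Rightarrow> complex) set \<Rightarrow> bool" where
  "L2_closed_subspace H \<longleftrightarrow> H \<subseteq> L2R \<and> (\<lambda>_. 0) \<in> H \<and>
     (\<forall>f\<in>H. \<forall>g\<in>H. (\<lambda>x. f x + g x) \<in> H) \<and>
     (\<forall>c. \<forall>f\<in>H. (\<lambda>x. c * f x) \<in> H) \<and>
     (\<forall>F f. (\<forall>N. F N \<in> H) \<and> L2_tendsto F f \<longrightarrow> f \<in> H)"

definition L2_independent :: "(int \<Rightarrow> real \<Rightarrow> complex) \<Rightarrow> bool" where
  "L2_independent g \<longleftrightarrow> (\<forall>a\<in>ell2. L2_series a g (\<lambda>_. 0) \<longrightarrow> (\<forall>n. a n = 0))"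

definition riesz_basis :: "(int \<Rightarrow> real \<Rightarrow> complex) \<Rightarrow> (real \<Rightarrow> complex) set \<Rightarrow> bool" where
  "riesz_basis g H \<longleftrightarrow> L2_closed_subspace H \<and> (\<forall>n. g n \<in> H) \<and> L2_independent g \<and>
     (\<exists>A B. 0 < A \<and> 0 < B \<and>
        (\<forall>f\<in>H. (\<lambda>n. (cmod (L2_inner f (g n)))\<^sup>2) summable_on UNIV \<and>
               A * (L2_norm f)\<^sup>2 \<le> (\<Sum>\<^sub>\<infinity>n. (cmod (L2_inner f (g n)))\<^sup>2) \<and>
               (\<Sum>\<^sub>\<infinity>n. (cmod (L2_inner f (g n)))\<^sup>2) \<le> B * (L2_norm f)\<^sup>2))"

text \<open>The root below is the principal one; its argument has positive real part.\<close>

definition frft_const :: "real \<Rightarrow> complex" where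
  "frft_const \<alpha> = csqrt ((1 - \<i> * of_real (cot \<alpha>)) / of_real (2 * pi))"

definition frft_integral :: "real \<Rightarrow> (real \<Rightarrow> complex) \<Rightarrow> real \<Rightarrow> complex" where
  "frft_integral \<alpha> f u = (LINT t|lborel. frft_const \<alpha> *
     exp (\<i> / 2 * of_real ((t\<^sup>2 + u\<^sup>2) * cot \<alpha>) - \<i> * of_real (t * u * (1 / sin \<alpha>))) * f t)"

text \<open>Extension by continuity from \<open>L\<^sup>1 \<inter> L\<^sup>2\<close> to \<open>L\<^sup>2\<close>: the transform of \<open>f\<close> is the
  \<open>L\<^sup>2\<close>-limit of the integral transforms along every sequence in \<open>L\<^sup>1 \<inter> L\<^sup>2\<close> converging
  to \<open>f\<close>. Such sequences exist (truncate \<open>f\<close>), so the limit is determined up to a null set, and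
  \<open>frft\<close> picks one representative of it.\<close>

definition has_frft :: "real \<Rightarrow> (real \<Rightarrow> complex) \<Rightarrow> (real \<Rightarrow> complex) \<Rightarrow> bool" where
  "has_frft \<alpha> f \<Theta> \<longleftrightarrow> f \<in> L2R \<and> \<Theta> \<in> L2R \<and>
     (\<forall>F. (\<forall>N. F N \<in> L1R \<inter> L2R) \<and> L2_tendsto F f \<longrightarrow>
          L2_tendsto (\<lambda>N. frft_integral \<alpha> (F N)) \<Theta>)"

definition frft :: "real \<Rightarrow> (real \<Rightarrow> complex) \<Rightarrow> real \<Rightarrow> complex" where
  "frft \<alpha> f = (SOME \<Theta>. has_frft \<alpha> f \<Theta>)"

definition chirp_shift :: "real \<Rightarrow> (real \<Rightarrow> complex) \<Rightarrow> int \<Rightarrow> real \<Rightarrow> complex" where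
  "chirp_shift \<alpha> \<phi> n t = \<phi> (t - of_int n) *
     exp (- (\<i> / 2) * of_real ((t\<^sup>2 - (of_int n)\<^sup>2 - (t - of_int n)\<^sup>2) * cot \<alpha>))"

definition V0 :: "real \<Rightarrow> (real \<Rightarrow> complex) \<Rightarrow> (real \<Rightarrow> complex) set" where
  "V0 \<alpha> \<phi> = {f. \<exists>c\<in>ell2. L2_series c (chirp_shift \<alpha> \<phi>) f}"

text \<open>Where the series diverges \<open>infsum\<close> gives \<open>0\<close> instead of \<open>\<infinity>\<close>. A two-sided bound
  \<open>0 < A \<le> G\<^sup>2 \<le> B\<close> with real \<open>B\<close> fails at such a point under either convention.\<close>

definition grammian :: "real \<Rightarrow> (real \<Rightarrow> complex) \<Rightarrow> real \<Rightarrow> real" where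
  "grammian \<alpha> \<phi> u = sqrt (2 * pi * sin \<alpha> *
     (\<Sum>\<^sub>\<infinity>k::int. (cmod (frft \<alpha> \<phi> (u + 2 * of_int k * pi * sin \<alpha>)))\<^sup>2))"

end

theory Submission
  imports Defs "HOL-Probability.Probability"
begin

text \<open>Up to unimodular factors, the fractional Fourier transform turns the chirped shifts
  \<open>\<phi>\<^bsub>\<alpha>,0,n\<^esub>\<close> into \<open>E\<^sub>n \<Theta>\<^sub>\<alpha>\<close>, where \<open>E\<^sub>n\<close> is a multiple of a character of period
  \<open>T = 2 \<pi> sin \<alpha>\<close>. Plancherel's theorem and periodization give
  \<open>T \<parallel>\<Sum> c\<^sub>n \<phi>\<^bsub>\<alpha>,0,n\<^esub>\<parallel>\<^sup>2 = \<integral> \<bar>P\<bar>\<^sup>2 W\<close> over one period, for finite sums, with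
  \<open>P = \<Sum> c\<^sub>n E\<^sub>n\<close> and \<open>W\<close> the squared Grammian. Bounds \<open>A \<le> W \<le> B\<close> thus make the shifts a Riesz
  sequence. Conversely, the upper frame bound gives \<open>\<integral> \<bar>P\<bar>\<^sup>2 (B - W) \<ge> 0\<close> for all
  trigonometric sums \<open>P\<close>, hence \<open>W \<le> B\<close> almost everywhere; the lower frame bound and Bessel's
  inequality for \<open>P W\<close> give \<open>\<integral> \<bar>P\<bar>\<^sup>2 (W\<^sup>2 - A W) \<ge> 0\<close>, hence \<open>W = 0\<close> or \<open>W \<ge> A\<close>; and linear
  independence excludes \<open>W = 0\<close> on a set of positive measure.\<close>

text \<open>The order of the three conclusions about W matters. The bound W <= B comes first: it
  makes P W bounded, as the form of Bessel's inequality proved here requires, and it makes the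
  series in the independence argument converge. The lower estimate is quadratic in W because the
  inner product of f = sum c_n g_n with the n-th shift is the n-th Fourier coefficient of P W. Hence
  sum |<f, g_n>|^2 is at most (1/T) int |P|^2 W^2, while T ||f||^2 = int |P|^2 W. Frame inequalities
  cannot detect zeros of W, since the values of P there contribute nothing to f; this is the place
  of linear independence, tested on an infinite ell^2 sequence and not on finite combinations.
  Inequalities integrated against |P|^2 become pointwise ones because trigonometric sums converge
  boundedly, off the endpoints, to indicators of compact sets.\<close>

subsection \<open>Square integrable functions\<close>

lemma borel_measurable_cnj [measurable]: "cnj \<in> borel_measurable borel"
  by (intro borel_measurable_continuous_onI continuous_intros)

lemma L2R_measurable [measurable_dest]: "f \<in> L2R \<Longrightarrow> f \<in> borel_measurable borel"
  by (simp add: L2R_def)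

lemma L2R_integrable_sq: "f \<in> L2R \<Longrightarrow> integrable lborel (\<lambda>x. (cmod (f x))\<^sup>2)"
  by (simp add: L2R_def)

lemma L2R_I:
  "f \<in> borel_measurable borel \<Longrightarrow> integrable lborel (\<lambda>x. (cmod (f x))\<^sup>2) \<Longrightarrow> f \<in> L2R"
  by (simp add: L2R_def)

lemma L2_norm_nonneg [simp]: "0 \<le> L2_norm f"
  by (simp add: L2_norm_def)

lemma L2_norm_sq: "(L2_norm f)\<^sup>2 = (LINT x|lborel. (cmod (f x))\<^sup>2)"
  by (simp add: L2_norm_def)

lemma L2R_zero [simp]: "(\<lambda>_. 0) \<in> L2R"
  by (simp add: L2R_def)

lemma L2_norm_zero [simp]: "L2_norm (\<lambda>_. 0) = 0"
  by (simp add: L2_norm_def)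

lemma L2R_add:
  assumes f: "f \<in> L2R" and g: "g \<in> L2R"
  shows "(\<lambda>x. f x + g x) \<in> L2R"
proof (rule L2R_I)
  note [measurable] = L2R_measurable[OF f] L2R_measurable[OF g]
  show "(\<lambda>x. f x + g x) \<in> borel_measurable borel" by measurable
  show "integrable lborel (\<lambda>x. (cmod (f x + g x))\<^sup>2)"
  proof (rule Bochner_Integration.integrable_bound)
    show "integrable lborel (\<lambda>x. 2 * (cmod (f x))\<^sup>2 + 2 * (cmod (g x))\<^sup>2)"
      using L2R_integrable_sq[OF f] L2R_integrable_sq[OF g] by simp
    have "(cmod (a + b))\<^sup>2 \<le> 2 * (cmod a)\<^sup>2 + 2 * (cmod b)\<^sup>2" for a b :: complex
    proof -
      have "(cmod (a + b))\<^sup>2 \<le> (cmod a + cmod b)\<^sup>2"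
        by (intro power_mono norm_triangle_ineq) auto
      also have "\<dots> \<le> 2 * (cmod a)\<^sup>2 + 2 * (cmod b)\<^sup>2"
        using zero_le_power2[of "cmod a - cmod b"] by (simp add: power2_eq_square algebra_simps)
      finally show ?thesis .
    qed
    then show "AE x in lborel. norm ((cmod (f x + g x))\<^sup>2)
        \<le> norm (2 * (cmod (f x))\<^sup>2 + 2 * (cmod (g x))\<^sup>2)"
      by (intro AE_I2) simp
  qed measurable
qed

lemma L2R_mult_bounded:
  assumes f: "f \<in> L2R" and [measurable]: "g \<in> borel_measurable borel" and b: "\<And>x. cmod (g x) \<le> C"
  shows "(\<lambda>x. g x * f x) \<in> L2R"
proof (rule L2R_I)
  note [measurable] = L2R_measurable[OF f]
  show "(\<lambda>x. g x * f x) \<in> borel_measurable borel" by measurable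
  show "integrable lborel (\<lambda>x. (cmod (g x * f x))\<^sup>2)"
  proof (rule Bochner_Integration.integrable_bound)
    show "integrable lborel (\<lambda>x. C\<^sup>2 * (cmod (f x))\<^sup>2)"
      using L2R_integrable_sq[OF f] by simp
    have "(cmod (g x * f x))\<^sup>2 \<le> C\<^sup>2 * (cmod (f x))\<^sup>2" for x
      unfolding norm_mult power_mult_distrib
      by (intro mult_right_mono power_mono b) auto
    then show "AE x in lborel. norm ((cmod (g x * f x))\<^sup>2) \<le> norm (C\<^sup>2 * (cmod (f x))\<^sup>2)"
      by (intro AE_I2) simp
  qed measurable
qed

lemma L2R_cmult: "f \<in> L2R \<Longrightarrow> (\<lambda>x. c * f x) \<in> L2R"
  by (rule L2R_mult_bounded[where C="cmod c"]) auto

lemma L2R_diff: "f \<in> L2R \<Longrightarrow> g \<in> L2R \<Longrightarrow> (\<lambda>x. f x - g x) \<in> L2R"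
  using L2R_add[of f "\<lambda>x. (-1) * g x"] L2R_cmult[of g "-1"] by simp

lemma L2R_sum: "(\<And>i. i \<in> S \<Longrightarrow> f i \<in> L2R) \<Longrightarrow> (\<lambda>x. \<Sum>i\<in>S. f i x) \<in> L2R"
  by (induction S rule: infinite_finite_induct) (auto intro: L2R_add)

lemma L2_norm_cmult: "L2_norm (\<lambda>x. c * f x) = cmod c * L2_norm f"
  by (simp add: L2_norm_def norm_mult power_mult_distrib real_sqrt_mult)

lemma L2_norm_minus_commute: "L2_norm (\<lambda>x. f x - g x) = L2_norm (\<lambda>x. g x - f x)"
  by (simp add: L2_norm_def norm_minus_commute)

lemma L2R_prod_integrable:
  assumes f: "f \<in> L2R" and g: "g \<in> L2R"
  shows "integrable lborel (\<lambda>x. cmod (f x) * cmod (g x))"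
proof (rule Bochner_Integration.integrable_bound)
  note [measurable] = L2R_measurable[OF f] L2R_measurable[OF g]
  show "integrable lborel (\<lambda>x. (cmod (f x))\<^sup>2 + (cmod (g x))\<^sup>2)"
    using L2R_integrable_sq[OF f] L2R_integrable_sq[OF g] by simp
  have "a * b \<le> a\<^sup>2 + b\<^sup>2" for a b :: real
    using sum_squares_bound[of a b] zero_le_power2[of a] zero_le_power2[of b] by linarith
  then show "AE x in lborel. norm (cmod (f x) * cmod (g x))
      \<le> norm ((cmod (f x))\<^sup>2 + (cmod (g x))\<^sup>2)"
    by (intro AE_I2) (simp add: abs_mult)
  show "(\<lambda>x. cmod (f x) * cmod (g x)) \<in> borel_measurable lborel" by measurable
qed

lemma L2R_inner_integrable:
  assumes f: "f \<in> L2R" and g: "g \<in> L2R"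
  shows "integrable lborel (\<lambda>x. f x * cnj (g x))"
proof (rule Bochner_Integration.integrable_bound[OF L2R_prod_integrable[OF f g]])
  note [measurable] = L2R_measurable[OF f] L2R_measurable[OF g]
  show "(\<lambda>x. f x * cnj (g x)) \<in> borel_measurable lborel" by measurable
qed (simp add: norm_mult)

text \<open>Integrating 2 (t|f|)|g| <= t^2 |f|^2 + |g|^2 gives a quadratic inequality in the real
  parameter t, and a good choice of t gives the product bound.\<close>

lemma L2_Cauchy_Schwarz_prod:
  assumes f: "f \<in> L2R" and g: "g \<in> L2R"
  shows "(LINT x|lborel. cmod (f x) * cmod (g x)) \<le> L2_norm f * L2_norm g"
proof -
  define A B c where "A = (L2_norm f)\<^sup>2" and "B = (L2_norm g)\<^sup>2"
    and "c = (LINT x|lborel. cmod (f x) * cmod (g x))"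
  note [simp] = L2R_integrable_sq[OF f] L2R_integrable_sq[OF g] L2R_prod_integrable[OF f g]
  have c0: "0 \<le> c" unfolding c_def by (rule integral_nonneg_AE) simp
  have quad: "2 * t * c \<le> t\<^sup>2 * A + B" for t :: real
  proof -
    have "2 * t * c = (LINT x|lborel. 2 * t * (cmod (f x) * cmod (g x)))"
      unfolding c_def by (rule integral_mult_right_zero[symmetric])
    also have "\<dots> \<le> (LINT x|lborel. t\<^sup>2 * (cmod (f x))\<^sup>2 + (cmod (g x))\<^sup>2)"
    proof (rule integral_mono)
      show "2 * t * (cmod (f x) * cmod (g x)) \<le> t\<^sup>2 * (cmod (f x))\<^sup>2 + (cmod (g x))\<^sup>2" for x
        using sum_squares_bound[of "t * cmod (f x)" "cmod (g x)"] by (simp add: power_mult_distrib mult_ac)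
    qed auto
    also have "\<dots> = t\<^sup>2 * A + B"
      by (simp add: A_def B_def L2_norm_sq)
    finally show ?thesis .
  qed
  have "c\<^sup>2 \<le> A * B"
  proof (cases "A = 0")
    case True
    have "c = 0"
    proof (rule ccontr)
      assume "c \<noteq> 0"
      \<comment> \<open>For \<open>A = 0\<close> the right side of \<open>quad\<close> is
        \<open>B\<close>, and this t makes the left side \<open>B + 1\<close>.\<close>
      with quad[of "(B + 1) / (2 * c)"] True show False by simp
    qed
    with True show ?thesis by simp
  next
    case False
    then have "A > 0" by (simp add: A_def)
    \<comment> \<open>The value c / A maximizes \<open>2 * t * c - t\<^sup>2 * A\<close>.\<close>
    with quad[of "c / A"] show ?thesis
      by (simp add: power2_eq_square field_simps)
  qed
  then have "c\<^sup>2 \<le> (L2_norm f * L2_norm g)\<^sup>2"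
    by (simp add: A_def B_def power_mult_distrib)
  then have "c \<le> L2_norm f * L2_norm g"
    by (rule power2_le_imp_le) simp
  then show ?thesis by (simp add: c_def)
qed

lemma L2_inner_le:
  assumes f: "f \<in> L2R" and g: "g \<in> L2R"
  shows "cmod (L2_inner f g) \<le> L2_norm f * L2_norm g"
proof -
  have "cmod (L2_inner f g) \<le> (LINT x|lborel. cmod (f x * cnj (g x)))"
    unfolding L2_inner_def by (rule integral_norm_bound)
  also have "\<dots> \<le> L2_norm f * L2_norm g"
    using L2_Cauchy_Schwarz_prod[OF f g] by (simp add: norm_mult)
  finally show ?thesis .
qed

lemma L2_norm_triangle:
  assumes f: "f \<in> L2R" and g: "g \<in> L2R"
  shows "L2_norm (\<lambda>x. f x + g x) \<le> L2_norm f + L2_norm g"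
proof (rule power2_le_imp_le)
  note [simp] = L2R_integrable_sq[OF f] L2R_integrable_sq[OF g] L2R_prod_integrable[OF f g]
  have "(L2_norm (\<lambda>x. f x + g x))\<^sup>2 \<le>
      (LINT x|lborel. (cmod (f x))\<^sup>2 + (cmod (g x))\<^sup>2 + 2 * (cmod (f x) * cmod (g x)))"
    unfolding L2_norm_sq
  proof (rule integral_mono)
    fix x
    have "(cmod (f x + g x))\<^sup>2 \<le> (cmod (f x) + cmod (g x))\<^sup>2"
      by (intro power_mono norm_triangle_ineq) auto
    then show "(cmod (f x + g x))\<^sup>2 \<le> (cmod (f x))\<^sup>2 + (cmod (g x))\<^sup>2 + 2 * (cmod (f x) * cmod (g x))"
      by (simp add: power2_sum mult.assoc)
  qed (use L2R_integrable_sq[OF L2R_add[OF f g]] in auto)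
  also have "\<dots> = (L2_norm f)\<^sup>2 + (L2_norm g)\<^sup>2 + 2 * (LINT x|lborel. cmod (f x) * cmod (g x))"
    by (simp add: L2_norm_sq)
  also have "\<dots> \<le> (L2_norm f + L2_norm g)\<^sup>2"
    using L2_Cauchy_Schwarz_prod[OF f g] by (simp add: power2_sum)
  finally show "(L2_norm (\<lambda>x. f x + g x))\<^sup>2 \<le> (L2_norm f + L2_norm g)\<^sup>2" .
qed simp

lemma L2_norm_triangle_sub:
  assumes f: "f \<in> L2R" and g: "g \<in> L2R" and h: "h \<in> L2R"
  shows "L2_norm (\<lambda>x. f x - h x) \<le> L2_norm (\<lambda>x. f x - g x) + L2_norm (\<lambda>x. g x - h x)"
  using L2_norm_triangle[OF L2R_diff[OF f g] L2R_diff[OF g h]] by simp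

lemma L2_norm_diff_le:
  assumes f: "f \<in> L2R" and g: "g \<in> L2R"
  shows "\<bar>L2_norm f - L2_norm g\<bar> \<le> L2_norm (\<lambda>x. f x - g x)"
  using L2_norm_triangle[OF g L2R_diff[OF f g]] L2_norm_triangle[OF f L2R_diff[OF g f]]
  by (simp add: L2_norm_minus_commute[of g f])

lemma L2_norm_mult_bounded:
  assumes f: "f \<in> L2R" and g: "g \<in> borel_measurable borel" and b: "\<And>x. cmod (g x) \<le> C"
  shows "L2_norm (\<lambda>x. g x * f x) \<le> C * L2_norm f"
proof -
  have C: "0 \<le> C" using b[of 0] norm_ge_zero order_trans by blast
  have "(L2_norm (\<lambda>x. g x * f x))\<^sup>2 \<le> (LINT x|lborel. C\<^sup>2 * (cmod (f x))\<^sup>2)"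
    unfolding L2_norm_sq
  proof (rule integral_mono)
    show "(cmod (g x * f x))\<^sup>2 \<le> C\<^sup>2 * (cmod (f x))\<^sup>2" for x
      unfolding norm_mult power_mult_distrib
      by (intro mult_right_mono power_mono b) auto
  qed (use L2R_integrable_sq[OF L2R_mult_bounded[OF f g b]] L2R_integrable_sq[OF f] in auto)
  also have "\<dots> = (C * L2_norm f)\<^sup>2" by (simp add: L2_norm_sq power_mult_distrib)
  finally show ?thesis by (rule power2_le_imp_le) (use C in auto)
qed

lemma L2_tendstoD:
  assumes "L2_tendsto F f"
  shows "F N \<in> L2R" "f \<in> L2R" "(\<lambda>N. L2_norm (\<lambda>x. F N x - f x)) \<longlonglongrightarrow> 0"
  using assms by (auto simp: L2_tendsto_def)

lemma L2_tendsto_norm: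
  assumes "L2_tendsto F f"
  shows "(\<lambda>N. L2_norm (F N)) \<longlonglongrightarrow> L2_norm f"
proof -
  note D = L2_tendstoD[OF assms]
  have "(\<lambda>N. L2_norm (F N) - L2_norm f) \<longlonglongrightarrow> 0"
    by (rule Lim_null_comparison[OF _ D(3)]) (use L2_norm_diff_le[OF D(1) D(2)] in simp)
  then show ?thesis by (simp add: LIM_zero_iff)
qed

lemma L2_tendsto_add:
  assumes "L2_tendsto F f" "L2_tendsto G g"
  shows "L2_tendsto (\<lambda>N x. F N x + G N x) (\<lambda>x. f x + g x)"
proof -
  note D = L2_tendstoD[OF assms(1)] L2_tendstoD[OF assms(2)]
  have "(\<lambda>N. L2_norm (\<lambda>x. (F N x + G N x) - (f x + g x))) \<longlonglongrightarrow> 0"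
  proof (rule Lim_null_comparison)
    show "(\<lambda>N. L2_norm (\<lambda>x. F N x - f x) + L2_norm (\<lambda>x. G N x - g x)) \<longlonglongrightarrow> 0"
      using tendsto_add[OF D(3) D(6)] by simp
    show "\<forall>\<^sub>F N in sequentially. norm (L2_norm (\<lambda>x. (F N x + G N x) - (f x + g x)))
        \<le> L2_norm (\<lambda>x. F N x - f x) + L2_norm (\<lambda>x. G N x - g x)"
      using L2_norm_triangle[OF L2R_diff[OF D(1) D(2)] L2R_diff[OF D(4) D(5)]]
      by (simp add: add_diff_add)
  qed
  then show ?thesis using D by (simp add: L2_tendsto_def L2R_add)
qed

lemma L2_tendsto_mult_bounded:
  assumes "L2_tendsto F f" and g: "g \<in> borel_measurable borel" and b: "\<And>x. cmod (g x) \<le> C"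
  shows "L2_tendsto (\<lambda>N x. g x * F N x) (\<lambda>x. g x * f x)"
proof -
  note D = L2_tendstoD[OF assms(1)]
  have "(\<lambda>N. L2_norm (\<lambda>x. g x * F N x - g x * f x)) \<longlonglongrightarrow> 0"
  proof (rule Lim_null_comparison)
    show "(\<lambda>N. C * L2_norm (\<lambda>x. F N x - f x)) \<longlonglongrightarrow> 0"
      using tendsto_mult_left[OF D(3), of C] by simp
    show "\<forall>\<^sub>F N in sequentially. norm (L2_norm (\<lambda>x. g x * F N x - g x * f x))
        \<le> C * L2_norm (\<lambda>x. F N x - f x)"
      using L2_norm_mult_bounded[OF L2R_diff[OF D(1) D(2)] g b]
      by (simp add: right_diff_distrib)
  qed
  then show ?thesis using D L2R_mult_bounded[OF _ g b] by (simp add: L2_tendsto_def)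
qed

lemma L2_tendsto_cmult: "L2_tendsto F f \<Longrightarrow> L2_tendsto (\<lambda>N x. c * F N x) (\<lambda>x. c * f x)"
  by (rule L2_tendsto_mult_bounded[where C="cmod c"]) auto

lemma L2_tendsto_const: "f \<in> L2R \<Longrightarrow> L2_tendsto (\<lambda>_. f) f"
  by (simp add: L2_tendsto_def)

lemma L2_tendsto_sum:
  "(\<And>i. i \<in> S \<Longrightarrow> L2_tendsto (F i) (f i)) \<Longrightarrow>
    L2_tendsto (\<lambda>N x. \<Sum>i\<in>S. F i N x) (\<lambda>x. \<Sum>i\<in>S. f i x)"
  by (induction S rule: infinite_finite_induct)
    (auto intro: L2_tendsto_add simp: L2_tendsto_const)

lemma L2_inner_self: "f \<in> L2R \<Longrightarrow> L2_inner f f = of_real ((L2_norm f)\<^sup>2)"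
  by (simp add: L2_inner_def L2_norm_sq complex_norm_square[symmetric] flip: integral_complex_of_real)

lemma L2_inner_sum_right:
  assumes "finite S" "f \<in> L2R" "\<And>n. n \<in> S \<Longrightarrow> g n \<in> L2R"
  shows "L2_inner f (\<lambda>x. \<Sum>n\<in>S. c n * g n x) = (\<Sum>n\<in>S. cnj (c n) * L2_inner f (g n))"
proof -
  have *: "f x * cnj (\<Sum>n\<in>S. c n * g n x) = (\<Sum>n\<in>S. cnj (c n) * (f x * cnj (g n x)))" for x
    by (simp add: sum_distrib_left mult_ac)
  show ?thesis unfolding L2_inner_def *
    using L2R_inner_integrable assms by (subst Bochner_Integration.integral_sum) auto
qed

lemma L2_inner_diff_right:
  assumes "f \<in> L2R" "g \<in> L2R" "h \<in> L2R"
  shows "L2_inner f (\<lambda>x. g x - h x) = L2_inner f g - L2_inner f h"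
  using L2R_inner_integrable assms by (simp add: L2_inner_def right_diff_distrib)

lemma L2_inner_tendsto:
  assumes f: "f \<in> L2R" and G: "L2_tendsto G g"
  shows "(\<lambda>N. L2_inner f (G N)) \<longlonglongrightarrow> L2_inner f g"
proof -
  note D = L2_tendstoD[OF G]
  have "(\<lambda>N. L2_inner f (G N) - L2_inner f g) \<longlonglongrightarrow> 0"
  proof (rule Lim_null_comparison)
    show "(\<lambda>N. L2_norm f * L2_norm (\<lambda>x. G N x - g x)) \<longlonglongrightarrow> 0"
      using tendsto_mult_left[OF D(3), of "L2_norm f"] by simp
    show "\<forall>\<^sub>F N in sequentially. norm (L2_inner f (G N) - L2_inner f g)
        \<le> L2_norm f * L2_norm (\<lambda>x. G N x - g x)"
      using L2_inner_le[OF f L2R_diff[OF D(1) D(2)]] L2_inner_diff_right[OF f D(1) D(2)] by simp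
  qed
  then show ?thesis by (simp add: LIM_zero_iff)
qed

lemma complex_polarization:
  fixes f g :: complex
  shows "4 * (f * cnj g) = of_real ((cmod (f + g))\<^sup>2) - of_real ((cmod (f - g))\<^sup>2)
    + \<i> * (of_real ((cmod (f + \<i> * g))\<^sup>2) - of_real ((cmod (f - \<i> * g))\<^sup>2))"
  unfolding complex_norm_square by (simp add: algebra_simps)

subsection \<open>Translations and completeness\<close>

lemma integrable_shift:
  fixes f :: "real \<Rightarrow> 'a :: {banach, second_countable_topology}"
  shows "integrable lborel f \<Longrightarrow> integrable lborel (\<lambda>x. f (x + w))"
  using lborel_integrable_real_affine[of f 1 w] by (simp add: add.commute)

lemma integral_shift:
  fixes f :: "real \<Rightarrow> 'a :: {banach, second_countable_topology}"
  shows "(LINT x|lborel. f (x + w)) = (LINT x|lborel. f x)"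
  using lborel_integral_real_affine[of 1 f w] by (simp add: add.commute)

text \<open>Stated along sequences w, so that dominated convergence applies to it directly.\<close>

definition L1_shift_continuous :: "(real \<Rightarrow> 'a :: {banach, second_countable_topology}) \<Rightarrow> bool" where
  "L1_shift_continuous f \<longleftrightarrow>
    (\<forall>w. w \<longlonglongrightarrow> 0 \<longrightarrow> (\<lambda>n. LINT x|lborel. norm (f (x + w n) - f x)) \<longlonglongrightarrow> 0)"

text \<open>Translation is an isometry of L^1, so replacing f by g changes the L^1 distance to the
  translate by at most twice the L^1 distance of f and g. The property is therefore closed under L^1
  limits. This carries it from open sets to Borel sets, and then to all integrable
  functions.\<close>

lemma L1_shift_continuous_approx:
  fixes f :: "real \<Rightarrow> 'a :: {banach, second_countable_topology}"
  assumes f: "integrable lborel f"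
    and approx: "\<And>e. 0 < e \<Longrightarrow> \<exists>g. integrable lborel g \<and> L1_shift_continuous g \<and>
      (LINT x|lborel. norm (f x - g x)) \<le> e"
  shows "L1_shift_continuous f"
  unfolding L1_shift_continuous_def
proof (intro allI impI)
  fix w :: "nat \<Rightarrow> real" assume w: "w \<longlonglongrightarrow> 0"
  show "(\<lambda>n. LINT x|lborel. norm (f (x + w n) - f x)) \<longlonglongrightarrow> 0"
  proof (rule LIMSEQ_I)
    fix r :: real assume r: "0 < r"
    obtain g where g: "integrable lborel g" "L1_shift_continuous g"
      and fg: "(LINT x|lborel. norm (f x - g x)) \<le> r / 4"
      using approx[of "r / 4"] r by auto
    have "(\<lambda>n. LINT x|lborel. norm (g (x + w n) - g x)) \<longlonglongrightarrow> 0"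
      using g(2) w by (simp add: L1_shift_continuous_def)
    then have "\<forall>\<^sub>F n in sequentially. (LINT x|lborel. norm (g (x + w n) - g x)) < r / 4"
      by (rule order_tendstoD) (use r in simp)
    then obtain N where N: "\<And>n. n \<ge> N \<Longrightarrow> (LINT x|lborel. norm (g (x + w n) - g x)) < r / 4"
      by (auto simp: eventually_sequentially)
    show "\<exists>no. \<forall>n\<ge>no. norm ((LINT x|lborel. norm (f (x + w n) - f x)) - 0) < r"
    proof (intro exI allI impI)
      fix n assume "N \<le> n"
      let ?d = "\<lambda>x. norm (f x - g x)"
      have i: "integrable lborel ?d" "integrable lborel (\<lambda>x. ?d (x + w n))"
        using f g(1) by (auto intro!: integrable_shift integrable_norm)
      have j: "integrable lborel (\<lambda>x. norm (g (x + w n) - g x))"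
        "integrable lborel (\<lambda>x. norm (f (x + w n) - f x))"
        using f g(1) by (auto intro!: integrable_shift integrable_norm)
      have "(LINT x|lborel. norm (f (x + w n) - f x)) \<le>
          (LINT x|lborel. ?d (x + w n) + (norm (g (x + w n) - g x) + ?d x))"
      proof (rule integral_mono)
        fix x
        have "f (x + w n) - f x = (f (x + w n) - g (x + w n)) + ((g (x + w n) - g x) + (g x - f x))"
          by simp
        then show "norm (f (x + w n) - f x) \<le> ?d (x + w n) + (norm (g (x + w n) - g x) + ?d x)"
          by (metis norm_triangle_mono norm_triangle_ineq norm_minus_commute order_refl)
      qed (use i j in auto)
      also have "\<dots> = (LINT x|lborel. ?d (x + w n)) + ((LINT x|lborel. norm (g (x + w n) - g x)) + (LINT x|lborel. ?d x))"
        using i j by simp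
      also have "(LINT x|lborel. ?d (x + w n)) = (LINT x|lborel. ?d x)"
        by (rule integral_shift)
      also have "(LINT x|lborel. ?d x) + ((LINT x|lborel. norm (g (x + w n) - g x)) + (LINT x|lborel. ?d x)) < r"
        using fg N[OF \<open>N \<le> n\<close>] r by linarith
      finally show "norm ((LINT x|lborel. norm (f (x + w n) - f x)) - 0) < r"
        by simp
    qed
  qed
qed

text \<open>For values 0 and 1 one has |a - b| = a + b - 2 a b, so only the integral of the product
  of U's indicator with its translate has to converge. The product is dominated by the fixed
  indicator of U and vanishes off U. At a point of U, openness makes it eventually 1. The translate
  alone need not converge at boundary points.\<close>

lemma L1_shift_continuous_open:
  assumes U: "open U" and fin: "emeasure lborel U < \<infinity>"
  shows "L1_shift_continuous (indicator U :: real \<Rightarrow> real)"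
  unfolding L1_shift_continuous_def
proof (intro allI impI)
  fix w :: "nat \<Rightarrow> real" assume w: "w \<longlonglongrightarrow> 0"
  let ?i = "indicator U :: real \<Rightarrow> real"
  have [measurable]: "U \<in> sets borel" using U by simp
  have int: "integrable lborel ?i" using fin by (simp add: integrable_indicator_iff)
  have ints: "integrable lborel (\<lambda>x. ?i (x + v))" for v by (rule integrable_shift[OF int])
  have intp: "integrable lborel (\<lambda>x. ?i (x + v) * ?i x)" for v
    by (rule Bochner_Integration.integrable_bound[OF int]) (auto simp: indicator_def)
  have lim: "(\<lambda>n. LINT x|lborel. ?i (x + w n) * ?i x) \<longlonglongrightarrow> (LINT x|lborel. ?i x)"
  proof (rule integral_dominated_convergence[where w="?i"])
    show "AE x in lborel. (\<lambda>n. ?i (x + w n) * ?i x) \<longlonglongrightarrow> ?i x"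
    proof (rule AE_I2)
      fix x :: real
      show "(\<lambda>n. ?i (x + w n) * ?i x) \<longlonglongrightarrow> ?i x"
      proof (cases "x \<in> U")
        case True
        have "(\<lambda>n. x + w n) \<longlonglongrightarrow> x" using tendsto_add[OF tendsto_const[of x] w] by simp
        then have "\<forall>\<^sub>F n in sequentially. x + w n \<in> U"
          using U True by (rule topological_tendstoD)
        then have "\<forall>\<^sub>F n in sequentially. ?i (x + w n) * ?i x = ?i x"
          by eventually_elim (use True in simp)
        then show ?thesis by (rule tendsto_eventually)
      qed simp
    qed
  qed (use int in \<open>auto simp: indicator_def\<close>)
  have "(LINT x|lborel. norm (?i (x + v) - ?i x)) =
      2 * (LINT x|lborel. ?i x) - 2 * (LINT x|lborel. ?i (x + v) * ?i x)" for v
  proof -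
    have "(LINT x|lborel. norm (?i (x + v) - ?i x)) =
        (LINT x|lborel. ?i (x + v) + ?i x - 2 * (?i (x + v) * ?i x))"
      by (rule Bochner_Integration.integral_cong) (auto simp: indicator_def)
    also have "\<dots> = (LINT x|lborel. ?i (x + v)) + (LINT x|lborel. ?i x) - 2 * (LINT x|lborel. ?i (x + v) * ?i x)"
      by (simp add: int ints intp del: Bochner_Integration.integral_indicator)
    finally show ?thesis by (simp only: integral_shift[of ?i])
  qed
  then show "(\<lambda>n. LINT x|lborel. norm (?i (x + w n) - ?i x)) \<longlonglongrightarrow> 0"
    using tendsto_diff[OF tendsto_const[of "2 * (LINT x|lborel. ?i x)"] tendsto_mult_left[OF lim, of 2]]
    by simp
qed

text \<open>Outer regularity encloses A in an open U, and the L^1 distance of the two indicators is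
  the measure of \<open>U - A\<close>.\<close>

lemma L1_shift_continuous_indicator:
  assumes A: "A \<in> sets borel" and fin: "emeasure lborel A < \<infinity>"
  shows "L1_shift_continuous (indicator A :: real \<Rightarrow> real)"
proof (rule L1_shift_continuous_approx)
  show "integrable lborel (indicator A :: real \<Rightarrow> real)"
    using A fin by (simp add: integrable_indicator_iff)
  fix e :: real assume e: "0 < e"
  obtain U where U: "open U" "A \<subseteq> U" "emeasure lborel (U - A) < ennreal e"
    using outer_regular_lborel[OF A e] by blast
  have [measurable]: "U \<in> sets borel" "A \<in> sets borel" using U A by auto
  have "emeasure lborel U \<le> emeasure lborel A + emeasure lborel (U - A)"
    using emeasure_subadditive[of A lborel "U - A"] U(2) by (simp add: Un_absorb1)
  also have "\<dots> < \<infinity>"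
    using fin U(3) by (metis ennreal_add_less_top infinity_ennreal_def order_less_trans ennreal_less_top)
  finally have finU: "emeasure lborel U < \<infinity>" .
  have "(LINT x|lborel. norm (indicator A x - indicator U x :: real)) = (LINT x|lborel. indicator (U - A) x)"
    by (rule Bochner_Integration.integral_cong) (use U(2) in \<open>auto simp: indicator_def\<close>)
  also have "\<dots> = measure lborel (U - A)" by simp
  also have "\<dots> \<le> e"
    using U(3) e by (simp add: measure_def enn2real_leI)
  finally show "\<exists>g. integrable lborel g \<and> L1_shift_continuous g \<and>
      (LINT x|lborel. norm (indicator A x - g x :: real)) \<le> e"
    using finU L1_shift_continuous_open[OF U(1) finU]
    by (intro exI[of _ "indicator U"]) (auto simp: integrable_indicator_iff)
qed

lemma L1_shift_continuous_integrable:
  fixes f :: "real \<Rightarrow> 'a :: {banach, second_countable_topology}"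
  assumes "integrable lborel f"
  shows "L1_shift_continuous f"
  using assms
proof (induction rule: integrable_induct)
  case (base A c)
  have "L1_shift_continuous (indicator A :: real \<Rightarrow> real)"
    using L1_shift_continuous_indicator base by simp
  then show ?case
    unfolding L1_shift_continuous_def
    by (auto simp flip: scaleR_left_diff_distrib intro: tendsto_mult_left_zero)
next
  case (add f g)
  show ?case unfolding L1_shift_continuous_def
  proof (intro allI impI)
    fix w :: "nat \<Rightarrow> real" assume w: "w \<longlonglongrightarrow> 0"
    have i: "integrable lborel (\<lambda>x. norm (f (x + v) - f x))" "integrable lborel (\<lambda>x. norm (g (x + v) - g x))" for v
      using add.hyps by (auto intro!: integrable_shift)
    have lim0: "(\<lambda>n. (LINT x|lborel. norm (f (x + w n) - f x)) + (LINT x|lborel. norm (g (x + w n) - g x))) \<longlonglongrightarrow> 0 + 0"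
      using add.IH w by (intro tendsto_add) (auto simp: L1_shift_continuous_def)
    have le: "(LINT x|lborel. norm (f (x + v) + g (x + v) - (f x + g x)))
        \<le> (LINT x|lborel. norm (f (x + v) - f x)) + (LINT x|lborel. norm (g (x + v) - g x))" for v
    proof -
      have "(LINT x|lborel. norm (f (x + v) + g (x + v) - (f x + g x)))
          \<le> (LINT x|lborel. norm (f (x + v) - f x) + norm (g (x + v) - g x))"
        by (rule integral_mono)
          (use add.hyps i in \<open>auto intro!: integrable_shift integrable_norm
            Bochner_Integration.integrable_diff Bochner_Integration.integrable_add
            norm_diff_triangle_ineq\<close>)
      then show ?thesis using i by simp
    qed
    show "(\<lambda>n. LINT x|lborel. norm (f (x + w n) + g (x + w n) - (f x + g x))) \<longlonglongrightarrow> 0"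
    proof (rule tendsto_sandwich[OF _ _ tendsto_const lim0[unfolded add_0_left]])
      show "\<forall>\<^sub>F n in sequentially. 0 \<le> (LINT x|lborel. norm (f (x + w n) + g (x + w n) - (f x + g x)))"
        by (intro always_eventually allI integral_nonneg_AE AE_I2 norm_ge_zero)
    qed (intro always_eventually allI le)
  qed
next
  case (lim f s)
  note [measurable] = borel_measurable_integrable[OF lim.hyps(1)] borel_measurable_integrable[OF lim.hyps(4)]
  \<comment> \<open>The simple functions of the induction satisfy |s_i| <= 2|f|, whence the
    dominating function 3|f|.\<close>
  have "(\<lambda>i. LINT x|lborel. norm (f x - s i x)) \<longlonglongrightarrow> (LINT x|(lborel :: real measure). 0)"
  proof (rule integral_dominated_convergence[where w="\<lambda>x. 3 * norm (f x)"])
    show "integrable lborel (\<lambda>x. 3 * norm (f x))" using lim.hyps by auto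
    show "AE x in lborel. (\<lambda>i. norm (f x - s i x)) \<longlonglongrightarrow> 0"
      using tendsto_norm_zero[OF LIM_zero[OF lim.hyps(2)]]
      by (intro AE_I2) (simp add: norm_minus_commute)
    show "AE x in lborel. norm (norm (f x - s i x)) \<le> 3 * norm (f x)" for i
    proof (rule AE_I2)
      fix x :: real
      show "norm (norm (f x - s i x)) \<le> 3 * norm (f x)"
        using norm_triangle_ineq4[of "f x" "s i x"] lim.hyps(3)[of x i] by simp
    qed
  qed auto
  then have *: "(\<lambda>i. LINT x|lborel. norm (f x - s i x)) \<longlonglongrightarrow> 0" by simp
  show ?case
  proof (rule L1_shift_continuous_approx)
    fix e :: real assume "0 < e"
    with * have "\<forall>\<^sub>F i in sequentially. (LINT x|lborel. norm (f x - s i x)) < e"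
      by (rule order_tendstoD)
    then obtain i where "(LINT x|lborel. norm (f x - s i x)) < e"
      by (auto simp: eventually_sequentially)
    then show "\<exists>g. integrable lborel g \<and> L1_shift_continuous g \<and> (LINT x|lborel. norm (f x - g x)) \<le> e"
      using lim.hyps(1) lim.IH by (intro exI[of _ "s i"]) auto
  qed (use lim.hyps in auto)
qed

section \<open>Dominated convergence, truncation and completeness in L^2\<close>

lemma L2_tendsto_dominated:
  assumes [measurable]: "\<And>N. F N \<in> borel_measurable borel" "f \<in> borel_measurable borel"
    and g: "g \<in> L2R" and le: "\<And>N x. cmod (F N x) \<le> cmod (g x)" and lim: "\<And>x. (\<lambda>N. F N x) \<longlonglongrightarrow> f x"
  shows "L2_tendsto F f"
proof -
  note [measurable] = L2R_measurable[OF g]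
  have lef: "cmod (f x) \<le> cmod (g x)" for x
    by (rule LIMSEQ_le_const2[OF tendsto_norm[OF lim]]) (use le in auto)
  have memb: "h \<in> L2R" if [measurable]: "h \<in> borel_measurable borel" and "\<And>x. cmod (h x) \<le> cmod (g x)" for h
  proof (rule L2R_I)
    show "integrable lborel (\<lambda>x. (cmod (h x))\<^sup>2)"
      by (rule Bochner_Integration.integrable_bound[OF L2R_integrable_sq[OF g]])
        (use that in \<open>auto intro!: power_mono\<close>)
  qed fact
  have "(\<lambda>N. LINT x|lborel. (cmod (F N x - f x))\<^sup>2) \<longlonglongrightarrow> (LINT x|(lborel :: real measure). 0)"
  proof (rule integral_dominated_convergence[where w="\<lambda>x. 4 * (cmod (g x))\<^sup>2"])
    show "integrable lborel (\<lambda>x. 4 * (cmod (g x))\<^sup>2)" using L2R_integrable_sq[OF g] by simp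
    show "AE x in lborel. (\<lambda>N. (cmod (F N x - f x))\<^sup>2) \<longlonglongrightarrow> 0"
    proof (rule AE_I2)
      fix x
      show "(\<lambda>N. (cmod (F N x - f x))\<^sup>2) \<longlonglongrightarrow> 0"
        using tendsto_power[OF tendsto_norm_zero[OF LIM_zero[OF lim[of x]]], of 2] by simp
    qed
    have "(cmod (F N x - f x))\<^sup>2 \<le> 4 * (cmod (g x))\<^sup>2" for N x
    proof -
      have "cmod (F N x - f x) \<le> 2 * cmod (g x)"
        using norm_triangle_ineq4[of "F N x" "f x"] le[of N x] lef[of x] by linarith
      then have "(cmod (F N x - f x))\<^sup>2 \<le> (2 * cmod (g x))\<^sup>2" by (rule power_mono) simp
      then show ?thesis by (simp add: power_mult_distrib)
    qed
    then show "AE x in lborel. norm ((cmod (F N x - f x))\<^sup>2) \<le> 4 * (cmod (g x))\<^sup>2" for N by auto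
  qed auto
  then have "(\<lambda>N. L2_norm (\<lambda>x. F N x - f x)) \<longlonglongrightarrow> 0"
    unfolding L2_norm_def using tendsto_real_sqrt by fastforce
  then show ?thesis by (auto simp: L2_tendsto_def intro!: memb le lef)
qed

lemma L2_truncation:
  assumes f: "f \<in> L2R"
  obtains F where "\<And>N. F N \<in> L1R \<inter> L2R" "L2_tendsto F f"
proof
  note [measurable] = L2R_measurable[OF f]
  define F where "F = (\<lambda>(N::nat) x. indicator {-real N..real N} x * f x)"
  have [measurable]: "F N \<in> borel_measurable borel" for N by (simp add: F_def)
  show T: "L2_tendsto F f"
  proof (rule L2_tendsto_dominated[OF _ _ f])
    fix x :: real
    obtain M :: nat where M: "\<bar>x\<bar> \<le> real M" using real_arch_simple by blast
    have "F N x = f x" if "N \<ge> M" for N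
    proof -
      have "\<bar>x\<bar> \<le> real N" using M that by linarith
      then show ?thesis by (auto simp: F_def indicator_def abs_le_iff)
    qed
    then have "\<forall>\<^sub>F N in sequentially. F N x = f x" by (auto simp: eventually_sequentially)
    then show "(\<lambda>N. F N x) \<longlonglongrightarrow> f x" by (rule tendsto_eventually)
  qed (auto simp: F_def indicator_def)
  fix N
  \<comment> \<open>A truncation is a product of two square integrable functions, hence
    integrable.\<close>
  have "(\<lambda>x. indicator {-real N..real N} x :: complex) \<in> L2R"
  proof (rule L2R_I)
    have "integrable lborel (indicator {-real N..real N} :: real \<Rightarrow> real)"
      by (simp add: integrable_indicator_iff)
    then show "integrable lborel (\<lambda>x. (cmod (indicator {-real N..real N} x))\<^sup>2)"
      by (rule Bochner_Integration.integrable_cong[THEN iffD1, rotated -1]) (auto simp: indicator_def)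
  qed simp
  from L2R_prod_integrable[OF this f] have "integrable lborel (\<lambda>x. norm (F N x))"
    by (simp add: F_def norm_mult)
  then have "integrable lborel (F N)" by (simp add: integrable_norm_iff)
  then show "F N \<in> L1R \<inter> L2R" using L2_tendstoD[OF T] by (simp add: L1R_def)
qed

text \<open>Multiplication by a square integrable function w maps L^2 continuously into L^1. The
  products are Cauchy in L^1, so a subsequence converges almost everywhere. As w has no zeros,
  dividing by it gives the pointwise limit f, and Fatou's lemma turns pointwise into L^2
  convergence.\<close>

lemma L2_complete:
  assumes F: "\<And>n. F n \<in> L2R"
    and cauchy: "\<And>e. 0 < e \<Longrightarrow> \<exists>N. \<forall>i\<ge>N. \<forall>j\<ge>N. L2_norm (\<lambda>x. F i x - F j x) < e"
  obtains f where "L2_tendsto F f"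
proof -
  note [measurable] = L2R_measurable[OF F]
  \<comment> \<open>The square root of a probability density that is positive everywhere: its square
    is integrable and it never vanishes.\<close>
  define w where "w = (\<lambda>x. complex_of_real (sqrt (std_normal_density x)))"
  have [measurable]: "w \<in> borel_measurable borel" unfolding w_def by measurable
  have w: "w \<in> L2R" by (rule L2R_I) (simp_all add: w_def)
  have w0: "w x \<noteq> 0" for x using normal_density_pos[of 1 0 x] by (simp add: w_def)
  define s where "s = (\<lambda>n x. F n x * w x)"
  have int: "integrable lborel (s n)" for n
  proof -
    have "integrable lborel (\<lambda>x. norm (s n x))"
      using L2R_prod_integrable[OF F w] by (simp add: s_def norm_mult)
    then show ?thesis by (subst (asm) integrable_norm_iff) (auto simp: s_def)
  qed
  obtain r where r: "strict_mono r" and C: "AE x in lborel. Cauchy (\<lambda>i. s (r i) x)"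
  proof (rule cauchy_L1_AE_cauchy_subseq[of lborel s])
    fix e :: real assume e: "0 < e"
    have n0: "0 < L2_norm w + 1" using L2_norm_nonneg[of w] by linarith
    obtain N where N: "\<And>i j. i \<ge> N \<Longrightarrow> j \<ge> N \<Longrightarrow> L2_norm (\<lambda>x. F i x - F j x) < e / (L2_norm w + 1)"
      using cauchy[of "e / (L2_norm w + 1)"] e n0 by auto
    have "(LINT x|lborel. norm (s i x - s j x)) < e" if "i \<ge> N" "j \<ge> N" for i j
    proof -
      have "(LINT x|lborel. norm (s i x - s j x)) \<le> L2_norm (\<lambda>x. F i x - F j x) * L2_norm w"
        using L2_Cauchy_Schwarz_prod[OF L2R_diff[OF F F] w, of i j]
        by (simp add: s_def norm_mult flip: left_diff_distrib)
      also have "\<dots> \<le> L2_norm (\<lambda>x. F i x - F j x) * (L2_norm w + 1)"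
        by (intro mult_left_mono) auto
      also have "\<dots> < e" using N[OF that] n0 by (simp add: pos_less_divide_eq)
      finally show ?thesis .
    qed
    then show "\<exists>N. \<forall>i\<ge>N. \<forall>j\<ge>N. (LINT x|lborel. norm (s i x - s j x)) < e" by blast
  qed (use int in auto)
  define f where "f = (\<lambda>x. lim (\<lambda>i. F (r i) x))"
  have [measurable]: "f \<in> borel_measurable borel"
    unfolding f_def by (rule borel_measurable_lim_metric) simp
  have conv: "AE x in lborel. (\<lambda>i. F (r i) x) \<longlonglongrightarrow> f x"
    using C
  proof eventually_elim
    case (elim x)
    then obtain l where "(\<lambda>i. s (r i) x) \<longlonglongrightarrow> l" by (auto simp: Cauchy_convergent_iff convergent_def)
    then have "(\<lambda>i. s (r i) x / w x) \<longlonglongrightarrow> l / w x" by (intro tendsto_divide) (auto simp: w0)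
    then have "(\<lambda>i. F (r i) x) \<longlonglongrightarrow> l / w x" by (simp add: s_def w0)
    then have "convergent (\<lambda>i. F (r i) x)" by (auto simp: convergent_def)
    then show ?case by (simp add: f_def convergent_LIMSEQ_iff)
  qed
  \<comment> \<open>Only the second index runs through the subsequence; the first stays free, so the
    bound holds along the whole sequence.\<close>
  have fatou: "(\<integral>\<^sup>+x. ennreal ((cmod (F i x - f x))\<^sup>2) \<partial>lborel) \<le> ennreal (e\<^sup>2)"
    if e: "0 < e" and N: "\<forall>i\<ge>N. \<forall>j\<ge>N. L2_norm (\<lambda>x. F i x - F j x) < e" and i: "i \<ge> N" for e N i
  proof -
    have "(\<integral>\<^sup>+x. ennreal ((cmod (F i x - f x))\<^sup>2) \<partial>lborel)
        = (\<integral>\<^sup>+x. liminf (\<lambda>j. ennreal ((cmod (F i x - F (r j) x))\<^sup>2)) \<partial>lborel)"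
    proof (rule nn_integral_cong_AE, use conv in eventually_elim)
      fix x assume "(\<lambda>j. F (r j) x) \<longlonglongrightarrow> f x"
      then have "(\<lambda>j. ennreal ((cmod (F i x - F (r j) x))\<^sup>2)) \<longlonglongrightarrow> ennreal ((cmod (F i x - f x))\<^sup>2)"
        by (intro tendsto_ennrealI tendsto_power tendsto_norm tendsto_diff tendsto_const)
      then show "ennreal ((cmod (F i x - f x))\<^sup>2) = liminf (\<lambda>j. ennreal ((cmod (F i x - F (r j) x))\<^sup>2))"
        using lim_imp_Liminf[of sequentially] by (metis sequentially_bot)
    qed
    also have "\<dots> \<le> liminf (\<lambda>j. \<integral>\<^sup>+x. ennreal ((cmod (F i x - F (r j) x))\<^sup>2) \<partial>lborel)"
      by (rule nn_integral_liminf) simp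
    also have "\<dots> \<le> ennreal (e\<^sup>2)"
    proof (rule Liminf_le)
      show "sequentially \<noteq> bot" by simp
      have "(\<integral>\<^sup>+x. ennreal ((cmod (F i x - F (r j) x))\<^sup>2) \<partial>lborel) \<le> ennreal (e\<^sup>2)" if "j \<ge> N" for j
      proof -
        have "r j \<ge> N" using that strict_mono_imp_increasing[OF r, of j] by linarith
        then have "(L2_norm (\<lambda>x. F i x - F (r j) x))\<^sup>2 \<le> e\<^sup>2"
          using N i by (intro power_mono) (auto intro: less_imp_le)
        then show ?thesis
          using L2R_integrable_sq[OF L2R_diff[OF F F]] by (subst nn_integral_eq_integral) (auto simp: L2_norm_sq)
      qed
      then show "\<forall>\<^sub>F j in sequentially. (\<integral>\<^sup>+x. ennreal ((cmod (F i x - F (r j) x))\<^sup>2) \<partial>lborel) \<le> ennreal (e\<^sup>2)"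
        by (auto simp: eventually_sequentially)
    qed
    finally show ?thesis .
  qed
  have diff: "(\<lambda>x. F i x - f x) \<in> L2R"
    if e: "0 < e" and N: "\<forall>i\<ge>N. \<forall>j\<ge>N. L2_norm (\<lambda>x. F i x - F j x) < e" and i: "i \<ge> N" for e N i
  proof (rule L2R_I)
    show "integrable lborel (\<lambda>x. (cmod (F i x - f x))\<^sup>2)"
      using fatou[OF that] by (intro integrableI_bounded) (auto simp: le_less_trans)
  qed simp
  have fL: "f \<in> L2R"
  proof -
    obtain N where "\<forall>i\<ge>N. \<forall>j\<ge>N. L2_norm (\<lambda>x. F i x - F j x) < 1" using cauchy[of 1] by auto
    from L2R_diff[OF F diff[OF _ this order_refl], of N] show ?thesis by simp
  qed
  have "(\<lambda>i. L2_norm (\<lambda>x. F i x - f x)) \<longlonglongrightarrow> 0"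
  proof (rule LIMSEQ_I)
    fix e :: real assume e: "0 < e"
    then obtain N where N: "\<forall>i\<ge>N. \<forall>j\<ge>N. L2_norm (\<lambda>x. F i x - F j x) < e / 2"
      using cauchy[of "e / 2"] by auto
    have "L2_norm (\<lambda>x. F i x - f x) < e" if "i \<ge> N" for i
    proof -
      have "ennreal ((L2_norm (\<lambda>x. F i x - f x))\<^sup>2) \<le> ennreal ((e/2)\<^sup>2)"
        unfolding L2_norm_sq
        using fatou[OF _ N that] e L2R_integrable_sq[OF L2R_diff[OF F fL]]
        by (subst nn_integral_eq_integral[symmetric]) auto
      then have "(L2_norm (\<lambda>x. F i x - f x))\<^sup>2 \<le> (e/2)\<^sup>2" by (simp add: ennreal_le_iff)
      then have "L2_norm (\<lambda>x. F i x - f x) \<le> e / 2" by (rule power2_le_imp_le) (use e in simp)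
      then show ?thesis using e by simp
    qed
    then show "\<exists>no. \<forall>i\<ge>no. norm (L2_norm (\<lambda>x. F i x - f x) - 0) < e" by auto
  qed
  with F fL have "L2_tendsto F f" by (simp add: L2_tendsto_def)
  then show ?thesis by (rule that)
qed

section \<open>Translations in L^2 and the autocorrelation\<close>

lemma L2R_shift: "f \<in> L2R \<Longrightarrow> (\<lambda>x. f (x + w)) \<in> L2R"
proof (rule L2R_I)
  assume f: "f \<in> L2R"
  note [measurable] = L2R_measurable[OF f]
  show "(\<lambda>x. f (x + w)) \<in> borel_measurable borel" by measurable
  show "integrable lborel (\<lambda>x. (cmod (f (x + w)))\<^sup>2)"
    by (rule integrable_shift[OF L2R_integrable_sq[OF f]])
qed

lemma L2_norm_shift: "L2_norm (\<lambda>x. f (x + w)) = L2_norm f"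
  unfolding L2_norm_def by (rule arg_cong[OF integral_shift])

text \<open>Truncating only one of the two factors reduces the claim to continuity of translations in
  \<open>L\<^sup>1\<close>.\<close>

lemma L2_autocorrelation_tendsto:
  assumes f: "f \<in> L2R" and f1: "integrable lborel f" and w: "w \<longlonglongrightarrow> 0"
  shows "(\<lambda>n. LINT x|lborel. f (x + w n) * cnj (f x)) \<longlonglongrightarrow> of_real ((L2_norm f)\<^sup>2)"
proof -
  note [measurable] = L2R_measurable[OF f]
  \<comment> \<open>Truncation in height: an inner product with \<open>t M\<close> is at most M
    times an L^1 norm. The remainder \<open>t M - f\<close> is small in L^2 and is handled by
    Cauchy-Schwarz.\<close>
  define t where "t = (\<lambda>(M::nat) x. if cmod (f x) \<le> real M then f x else 0)"
  have [measurable]: "t M \<in> borel_measurable borel" for M unfolding t_def by measurable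
  have T: "L2_tendsto t f"
  proof (rule L2_tendsto_dominated[OF _ _ f])
    fix x
    obtain M :: nat where M: "cmod (f x) \<le> real M" using real_arch_simple by blast
    have "t N x = f x" if "N \<ge> M" for N
    proof -
      have "cmod (f x) \<le> real N" using M that by linarith
      then show ?thesis by (simp add: t_def)
    qed
    then have "\<forall>\<^sub>F N in sequentially. t N x = f x" by (auto simp: eventually_sequentially)
    then show "(\<lambda>N. t N x) \<longlonglongrightarrow> f x" by (rule tendsto_eventually)
  qed (auto simp: t_def)
  note D = L2_tendstoD[OF T]
  define d where "d = (\<lambda>n x. f (x + w n) - f x)"
  have d: "d n \<in> L2R" for n unfolding d_def by (intro L2R_diff L2R_shift f)
  have dn: "L2_norm (d n) \<le> 2 * L2_norm f" for n
    using L2_norm_triangle[OF L2R_shift[OF f, of "w n"] L2R_cmult[OF f, of "-1"]]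
    unfolding L2_norm_cmult by (simp add: d_def L2_norm_shift)
  have "(\<lambda>n. L2_inner (d n) f) \<longlonglongrightarrow> 0"
  proof (rule LIMSEQ_I)
    fix r :: real assume r: "0 < r"
    \<comment> \<open>The summand 1 keeps the divisor positive when f vanishes almost everywhere.
      With \<open>dn\<close>, this divisor leaves r / 2 for the remainder.\<close>
    have p: "0 < 4 * (L2_norm f + 1)" by (simp add: add_nonneg_pos)
    have "\<forall>\<^sub>F M in sequentially. L2_norm (\<lambda>x. t M x - f x) < r / (4 * (L2_norm f + 1))"
      by (rule order_tendstoD[OF D(3)]) (use r p in simp)
    then obtain M where M: "L2_norm (\<lambda>x. t M x - f x) < r / (4 * (L2_norm f + 1))"
      by (auto simp: eventually_sequentially)
    have "(\<lambda>n. LINT x|lborel. cmod (d n x)) \<longlonglongrightarrow> 0"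
      using L1_shift_continuous_integrable[OF f1] w by (simp add: L1_shift_continuous_def d_def)
    then have "\<forall>\<^sub>F n in sequentially. (LINT x|lborel. cmod (d n x)) < r / (2 * (real M + 1))"
      by (rule order_tendstoD) (use r in simp)
    then obtain N where N: "\<And>n. n \<ge> N \<Longrightarrow> (LINT x|lborel. cmod (d n x)) < r / (2 * (real M + 1))"
      by (auto simp: eventually_sequentially)
    have "cmod (L2_inner (d n) f) < r" if "n \<ge> N" for n
    proof -
      have d1: "integrable lborel (d n)" unfolding d_def using f1 integrable_shift[OF f1] by simp
      have tb: "cmod (t M x) \<le> real M" for x by (simp add: t_def)
      have "cmod (L2_inner (d n) (t M)) \<le> (LINT x|lborel. cmod (d n x * cnj (t M x)))"
        unfolding L2_inner_def by (rule integral_norm_bound)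
      also have "\<dots> \<le> (LINT x|lborel. real M * cmod (d n x))"
      proof (rule integral_mono)
        show "cmod (d n x * cnj (t M x)) \<le> real M * cmod (d n x)" for x
          unfolding norm_mult complex_mod_cnj by (subst mult.commute) (intro mult_right_mono tb, simp)
      qed (use d1 integrable_norm[OF L2R_inner_integrable[OF d D(1)]] in auto)
      also have "\<dots> \<le> (real M + 1) * (LINT x|lborel. cmod (d n x))"
        by (subst integral_mult_right_zero) (intro mult_right_mono integral_nonneg_AE, auto)
      also have "\<dots> < r / 2" using N[OF that] by (simp add: field_simps)
      finally have a: "cmod (L2_inner (d n) (t M)) < r / 2" .
      have "cmod (L2_inner (d n) (\<lambda>x. t M x - f x)) \<le> L2_norm (d n) * L2_norm (\<lambda>x. t M x - f x)"
        by (rule L2_inner_le[OF d L2R_diff[OF D(1) f]])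
      also have "\<dots> \<le> (2 * (L2_norm f + 1)) * L2_norm (\<lambda>x. t M x - f x)"
        using dn[of n] by (intro mult_right_mono) auto
      also have "\<dots> < r / 2" using M p by (simp add: field_simps)
      finally have b: "cmod (L2_inner (d n) (\<lambda>x. t M x - f x)) < r / 2" .
      have "L2_inner (d n) f = L2_inner (d n) (t M) - L2_inner (d n) (\<lambda>x. t M x - f x)"
        using L2_inner_diff_right[OF d D(1) f] by simp
      then show ?thesis
        using norm_triangle_ineq4[of "L2_inner (d n) (t M)" "L2_inner (d n) (\<lambda>x. t M x - f x)"] a b
        by simp
    qed
    then show "\<exists>no. \<forall>n\<ge>no. norm (L2_inner (d n) f - 0) < r" by auto
  qed
  moreover have "L2_inner (d n) f = (LINT x|lborel. f (x + w n) * cnj (f x)) - of_real ((L2_norm f)\<^sup>2)" for n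
    using L2R_inner_integrable[OF L2R_shift[OF f] f, of "w n"] L2R_inner_integrable[OF f f] L2_inner_self[OF f]
    by (simp add: d_def L2_inner_def left_diff_distrib)
  ultimately show ?thesis by (simp add: LIM_zero_iff)
qed

subsection \<open>Plancherel's theorem\<close>

text \<open>The tensor product of two integrable functions is integrable on the plane, and a kernel
  of modulus at most 1 preserves this.\<close>

lemma Fubini_bounded_kernel:
  fixes g h :: "real \<Rightarrow> complex"
  assumes g: "integrable lborel g" and h: "integrable lborel h"
    and k [measurable]: "case_prod k \<in> borel_measurable (lborel \<Otimes>\<^sub>M lborel)"
    and le: "\<And>x y. cmod (k x y) \<le> 1"
  shows "(LINT y|lborel. LINT x|lborel. g x * h y * k x y) = (LINT x|lborel. LINT y|lborel. g x * h y * k x y)"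
proof (rule lborel_pair.Fubini_integral)
  note [measurable] = borel_measurable_integrable[OF g] borel_measurable_integrable[OF h]
  have prod: "integrable (lborel \<Otimes>\<^sub>M lborel) (\<lambda>(x, y). g x * h y)"
  proof (rule lborel_pair.Fubini_integrable)
    show "integrable lborel (\<lambda>x. LINT y|lborel. norm (case (x, y) of (x, y) \<Rightarrow> g x * h y))"
      using g by (simp add: norm_mult integrable_norm)
    show "AE x in lborel. integrable lborel (\<lambda>y. case (x, y) of (x, y) \<Rightarrow> g x * h y)"
      using h by simp
  qed measurable
  have "(\<lambda>p. (case p of (x, y) \<Rightarrow> g x * h y) * case_prod k p) \<in> borel_measurable (lborel \<Otimes>\<^sub>M lborel)"
    by measurable
  then have "(\<lambda>(x, y). g x * h y * k x y) \<in> borel_measurable (lborel \<Otimes>\<^sub>M lborel)"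
    by (simp add: case_prod_beta')
  then show "integrable (lborel \<Otimes>\<^sub>M lborel) (\<lambda>(x, y). g x * h y * k x y)"
    by (rule Bochner_Integration.integrable_bound[OF prod])
      (auto simp: norm_mult intro!: AE_I2 mult_right_le_one_le le)
qed

lemma integral_std_normal_iexp:
  "(LINT z|lborel. of_real (std_normal_density z) * iexp (t * z)) = of_real (exp (- t\<^sup>2 / 2))"
proof -
  have "char std_normal_distribution t = (LINT z|lborel. std_normal_density z *\<^sub>R iexp (t * z))"
    unfolding char_def by (rule integral_density) auto
  then show ?thesis
    by (simp add: char_std_normal_distribution scaleR_conv_of_real)
qed

text \<open>Unnormalized, so a factor 2 pi appears in \<open>Plancherel\<close>;
  \<open>frft_const\<close> will absorb it.\<close>

definition fourier :: "(real \<Rightarrow> complex) \<Rightarrow> real \<Rightarrow> complex" where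
  "fourier f u = (LINT x|lborel. f x * iexp (- (x * u)))"

lemma fourier_measurable [measurable]:
  assumes [measurable]: "f \<in> borel_measurable borel"
  shows "fourier f \<in> borel_measurable borel"
  unfolding fourier_def by measurable

lemma cmod_fourier_le:
  assumes "integrable lborel f"
  shows "cmod (fourier f u) \<le> (LINT x|lborel. cmod (f x))"
proof -
  have "cmod (fourier f u) \<le> (LINT x|lborel. cmod (f x * iexp (- (x * u))))"
    unfolding fourier_def by (rule integral_norm_bound)
  then show ?thesis by (simp add: norm_mult)
qed

text \<open>The transform of an integrable f is bounded but not known to be integrable, so the
  Gaussian weight is what makes the interchange of integrals legitimate. Each of the two factors is
  unfolded with one use of Fubini. The remaining z-integral is the characteristic function of the
  normal distribution at \<open>\<sigma> * (y - x)\<close>.\<close>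

lemma fourier_gauss_integral:
  assumes f: "integrable lborel f"
  defines "\<nu> \<equiv> (\<lambda>z. complex_of_real (std_normal_density z))"
  shows "(LINT z|lborel. \<nu> z * (fourier f (\<sigma> * z) * cnj (fourier f (\<sigma> * z)))) =
    (LINT y|lborel. cnj (f y) * (LINT x|lborel. f x * of_real (exp (- (\<sigma> * (y - x))\<^sup>2 / 2))))"
proof -
  note [measurable] = borel_measurable_integrable[OF f]
  have n: "integrable lborel \<nu>" unfolding \<nu>_def by (intro integrable_of_real) simp
  have [measurable]: "\<nu> \<in> borel_measurable borel" unfolding \<nu>_def by measurable
  have fc: "integrable lborel (\<lambda>y. cnj (f y))" using f by simp
  have A1: "(LINT z|lborel. \<nu> z * fourier f (\<sigma> * z) * iexp (\<sigma> * y * z))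
      = (LINT x|lborel. f x * of_real (exp (- (\<sigma> * (y - x))\<^sup>2 / 2)))" for y
  proof -
    have "(LINT z|lborel. \<nu> z * fourier f (\<sigma> * z) * iexp (\<sigma> * y * z))
        = (LINT z|lborel. LINT x|lborel. \<nu> z * f x * iexp (\<sigma> * (y - x) * z))"
    proof (rule Bochner_Integration.integral_cong[OF refl])
      fix z
      have "\<nu> z * fourier f (\<sigma> * z) * iexp (\<sigma> * y * z)
          = (LINT x|lborel. (\<nu> z * iexp (\<sigma> * y * z)) * (f x * iexp (- (x * (\<sigma> * z)))))"
        unfolding fourier_def by (subst integral_mult_right_zero) (simp add: mult_ac)
      also have "\<dots> = (LINT x|lborel. \<nu> z * f x * iexp (\<sigma> * (y - x) * z))"
      proof (rule Bochner_Integration.integral_cong[OF refl])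
        fix x
        have "iexp (\<sigma> * y * z) * iexp (- (x * (\<sigma> * z))) = iexp (\<sigma> * (y - x) * z)"
          unfolding exp_add[symmetric] by (rule arg_cong[where f=exp]) (simp add: algebra_simps)
        then show "(\<nu> z * iexp (\<sigma> * y * z)) * (f x * iexp (- (x * (\<sigma> * z)))) = \<nu> z * f x * iexp (\<sigma> * (y - x) * z)"
          by (metis (no_types, opaque_lifting) mult.assoc mult.left_commute)
      qed
      finally show "\<nu> z * fourier f (\<sigma> * z) * iexp (\<sigma> * y * z) = (LINT x|lborel. \<nu> z * f x * iexp (\<sigma> * (y - x) * z))" .
    qed
    also have "\<dots> = (LINT x|lborel. LINT z|lborel. \<nu> z * f x * iexp (\<sigma> * (y - x) * z))"
      by (rule Fubini_bounded_kernel[symmetric, OF n f]) (simp_all, measurable)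
    also have "\<dots> = (LINT x|lborel. f x * of_real (exp (- (\<sigma> * (y - x))\<^sup>2 / 2)))"
    proof (rule Bochner_Integration.integral_cong[OF refl])
      fix x
      have "(LINT z|lborel. \<nu> z * f x * iexp (\<sigma> * (y - x) * z)) = (LINT z|lborel. f x * (\<nu> z * iexp (\<sigma> * (y - x) * z)))"
        by (simp add: mult_ac)
      also have "\<dots> = f x * of_real (exp (- (\<sigma> * (y - x))\<^sup>2 / 2))"
        unfolding \<nu>_def by (simp only: integral_mult_right_zero integral_std_normal_iexp)
      finally show "(LINT z|lborel. \<nu> z * f x * iexp (\<sigma> * (y - x) * z)) = f x * of_real (exp (- (\<sigma> * (y - x))\<^sup>2 / 2))" .
    qed
    finally show ?thesis .
  qed
  have nF: "integrable lborel (\<lambda>z. \<nu> z * fourier f (\<sigma> * z))"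
  proof (rule Bochner_Integration.integrable_bound)
    show "integrable lborel (\<lambda>z. (LINT x|lborel. cmod (f x)) * \<nu> z)" using n by simp
    show "AE z in lborel. norm (\<nu> z * fourier f (\<sigma> * z)) \<le> norm ((LINT x|lborel. cmod (f x)) * \<nu> z)"
      by (intro AE_I2, unfold norm_mult, subst mult.commute, intro mult_right_mono)
        (auto intro: order_trans[OF cmod_fourier_le[OF f]])
  qed measurable
  have "(LINT z|lborel. \<nu> z * (fourier f (\<sigma> * z) * cnj (fourier f (\<sigma> * z))))
      = (LINT z|lborel. LINT y|lborel. (\<nu> z * fourier f (\<sigma> * z)) * cnj (f y) * iexp (\<sigma> * y * z))"
  proof (rule Bochner_Integration.integral_cong[OF refl])
    fix z
    have "cnj (fourier f (\<sigma> * z)) = (LINT y|lborel. cnj (f y) * iexp (\<sigma> * y * z))"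
      unfolding fourier_def by (subst Bochner_Integration.integral_cnj[symmetric])
        (simp add: exp_cnj mult_ac)
    then show "\<nu> z * (fourier f (\<sigma> * z) * cnj (fourier f (\<sigma> * z))) =
        (LINT y|lborel. (\<nu> z * fourier f (\<sigma> * z)) * cnj (f y) * iexp (\<sigma> * y * z))"
      by (simp add: mult.assoc)
  qed
  also have "\<dots> = (LINT y|lborel. LINT z|lborel. (\<nu> z * fourier f (\<sigma> * z)) * cnj (f y) * iexp (\<sigma> * y * z))"
    by (rule Fubini_bounded_kernel[symmetric, OF nF fc]) (simp_all, measurable)
  also have "\<dots> = (LINT y|lborel. cnj (f y) * (LINT z|lborel. \<nu> z * fourier f (\<sigma> * z) * iexp (\<sigma> * y * z)))"
  proof (rule Bochner_Integration.integral_cong[OF refl])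
    fix y
    have "(LINT z|lborel. (\<nu> z * fourier f (\<sigma> * z)) * cnj (f y) * iexp (\<sigma> * y * z))
      = (LINT z|lborel. cnj (f y) * (\<nu> z * fourier f (\<sigma> * z) * iexp (\<sigma> * y * z)))"
      by (simp add: mult_ac)
    then show "(LINT z|lborel. (\<nu> z * fourier f (\<sigma> * z)) * cnj (f y) * iexp (\<sigma> * y * z))
      = cnj (f y) * (LINT z|lborel. \<nu> z * fourier f (\<sigma> * z) * iexp (\<sigma> * y * z))"
      by (simp only: integral_mult_right_zero)
  qed
  finally show ?thesis unfolding A1 .
qed

text \<open>Substitute x = y + z / \<open>\<sigma>\<close>: the Jacobian gives 1 /
  \<open>\<sigma>\<close>, and sqrt (2 pi) is the normalization of the normal density.\<close>

lemma gauss_kernel_rescale: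
  assumes \<sigma>: "\<sigma> > 0"
  shows "(LINT x|lborel. f x * complex_of_real (exp (- (\<sigma> * (y - x))\<^sup>2 / 2))) =
    of_real (sqrt (2 * pi) / \<sigma>) * (LINT z|lborel. f (y + z / \<sigma>) * of_real (std_normal_density z))"
proof -
  have "(LINT x|lborel. f x * complex_of_real (exp (- (\<sigma> * (y - x))\<^sup>2 / 2))) =
     \<bar>1 / \<sigma>\<bar> *\<^sub>R (LINT z|lborel. f (y + 1 / \<sigma> * z) * complex_of_real (exp (- (\<sigma> * (y - (y + 1 / \<sigma> * z)))\<^sup>2 / 2)))"
    using \<sigma> by (subst lborel_integral_real_affine[where c="1 / \<sigma>" and t=y]) simp_all
  also have "(LINT z|lborel. f (y + 1 / \<sigma> * z) * complex_of_real (exp (- (\<sigma> * (y - (y + 1 / \<sigma> * z)))\<^sup>2 / 2)))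
      = (LINT z|lborel. of_real (sqrt (2 * pi)) * (f (y + z / \<sigma>) * of_real (std_normal_density z)))"
    using \<sigma> by (intro Bochner_Integration.integral_cong[OF refl]) (simp add: std_normal_density_def)
  finally show ?thesis using \<sigma> by (simp add: scaleR_conv_of_real)
qed

text \<open>The left side is the integral of |fourier f u|^2 damped by exp (-(u /
  \<open>\<sigma>\<close>)^2 / 2), written in the variable z = u / \<open>\<sigma>\<close>. The
  right side averages the autocorrelation of f over lags z / \<open>\<sigma>\<close>, which shrink
  to 0 as \<open>\<sigma>\<close> grows.\<close>

lemma fourier_gauss_average:
  assumes f: "f \<in> L2R" and f1: "integrable lborel f" and \<sigma>: "\<sigma> > 0"
  shows "of_real (\<sigma> * sqrt (2 * pi)) *
      (LINT z|lborel. of_real (std_normal_density z) * (fourier f (\<sigma> * z) * cnj (fourier f (\<sigma> * z)))) =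
    of_real (2 * pi) *
      (LINT z|lborel. of_real (std_normal_density z) * (LINT y|lborel. f (y + z / \<sigma>) * cnj (f y)))"
proof -
  note [measurable] = L2R_measurable[OF f]
  let ?n = "\<lambda>z. complex_of_real (std_normal_density z)"
  let ?k = "\<lambda>z y. ?n z * (f (y + z / \<sigma>) * cnj (f y))"
  have int: "integrable (lborel \<Otimes>\<^sub>M lborel) (\<lambda>(z, y). ?k z y)"
  proof (rule lborel_pair.Fubini_integrable)
    \<comment> \<open>Cauchy-Schwarz bounds the autocorrelation uniformly in the lag, which leaves
      the normal density as integrable majorant.\<close>
    have le: "(LINT y|lborel. cmod (?k z y)) \<le> (L2_norm f)\<^sup>2 * std_normal_density z" for z
    proof -
      have "(LINT y|lborel. cmod (?k z y)) = std_normal_density z * (LINT y|lborel. cmod (f (y + z / \<sigma>)) * cmod (f y))"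
        by (simp add: norm_mult)
      also have "\<dots> \<le> std_normal_density z * (L2_norm (\<lambda>y. f (y + z / \<sigma>)) * L2_norm f)"
        by (intro mult_left_mono L2_Cauchy_Schwarz_prod L2R_shift f) auto
      finally show ?thesis by (simp add: L2_norm_shift power2_eq_square mult_ac)
    qed
    show "integrable lborel (\<lambda>z. LINT y|lborel. norm (case (z, y) of (z, y) \<Rightarrow> ?k z y))"
    proof (rule Bochner_Integration.integrable_bound)
      show "integrable lborel (\<lambda>z. (L2_norm f)\<^sup>2 * std_normal_density z)" by simp
      show "AE z in lborel. norm (LINT y|lborel. norm (case (z, y) of (z, y) \<Rightarrow> ?k z y))
          \<le> norm ((L2_norm f)\<^sup>2 * std_normal_density z)"
        using le by (intro AE_I2) (simp add: integral_nonneg_AE)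
    qed measurable
    show "AE z in lborel. integrable lborel (\<lambda>y. case (z, y) of (z, y) \<Rightarrow> ?k z y)"
      using L2R_inner_integrable[OF L2R_shift[OF f] f] by (intro AE_I2) simp
  qed measurable
  have "(LINT z|lborel. ?n z * (fourier f (\<sigma> * z) * cnj (fourier f (\<sigma> * z)))) =
      (LINT y|lborel. of_real (sqrt (2 * pi) / \<sigma>) * (LINT z|lborel. ?k z y))"
    unfolding fourier_gauss_integral[OF f1] gauss_kernel_rescale[OF \<sigma>]
  proof (rule Bochner_Integration.integral_cong[OF refl])
    fix y
    have "(LINT z|lborel. ?k z y) = (LINT z|lborel. cnj (f y) * (f (y + z / \<sigma>) * ?n z))"
      by (simp add: mult_ac)
    then show "cnj (f y) * (of_real (sqrt (2 * pi) / \<sigma>) * (LINT z|lborel. f (y + z / \<sigma>) * ?n z))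
        = of_real (sqrt (2 * pi) / \<sigma>) * (LINT z|lborel. ?k z y)"
      by (simp only: integral_mult_right_zero mult_ac)
  qed
  also have "\<dots> = of_real (sqrt (2 * pi) / \<sigma>) * (LINT y|lborel. LINT z|lborel. ?k z y)"
    by (rule integral_mult_right_zero)
  also have "(LINT y|lborel. LINT z|lborel. ?k z y) = (LINT z|lborel. LINT y|lborel. ?k z y)"
    by (rule lborel_pair.Fubini_integral[OF int])
  also have "\<dots> = (LINT z|lborel. ?n z * (LINT y|lborel. f (y + z / \<sigma>) * cnj (f y)))"
    by (simp only: integral_mult_right_zero)
  finally have eq: "(LINT z|lborel. ?n z * (fourier f (\<sigma> * z) * cnj (fourier f (\<sigma> * z)))) =
    of_real (sqrt (2 * pi) / \<sigma>) * (LINT z|lborel. ?n z * (LINT y|lborel. f (y + z / \<sigma>) * cnj (f y)))" .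
  have "complex_of_real (\<sigma> * sqrt (2 * pi)) * of_real (sqrt (2 * pi) / \<sigma>) = of_real (2 * pi)"
    unfolding of_real_mult[symmetric] using \<sigma> by simp
  then show ?thesis unfolding eq by (simp only: mult.assoc[symmetric])
qed

text \<open>Let \<open>\<sigma>\<close> tend to infinity in \<open>fourier_gauss_average\<close>. On
  the frequency side the damping factors increase to 1, so monotone convergence applies. On the
  other side the autocorrelation tends to its value at lag 0, under a normal majorant. With a
  nonnegative extended integral on the left, square integrability of the transform is part of the
  conclusion.\<close>

theorem Plancherel:
  assumes f: "f \<in> L2R" and f1: "integrable lborel f"
  shows "(\<integral>\<^sup>+u. ennreal ((cmod (fourier f u))\<^sup>2) \<partial>lborel) = ennreal (2 * pi * (L2_norm f)\<^sup>2)"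
proof -
  note [measurable] = L2R_measurable[OF f]
  let ?n = "\<lambda>z. complex_of_real (std_normal_density z)"
  define s where "s = (\<lambda>n::nat. real (Suc n))"
  have s: "s n > 0" for n by (simp add: s_def)
  define a where "a = (\<lambda>w. LINT y|lborel. f (y + w) * cnj (f y))"
  have [measurable]: "a \<in> borel_measurable borel" unfolding a_def by measurable
  have ale: "cmod (a w) \<le> (L2_norm f)\<^sup>2" for w
    using L2_inner_le[OF L2R_shift[OF f] f, of w] by (simp add: a_def L2_inner_def L2_norm_shift power2_eq_square)
  define J where "J = (\<lambda>n. LINT z|lborel. std_normal_density z * (cmod (fourier f (s n * z)))\<^sup>2)"
  have "(\<lambda>n. LINT z|lborel. ?n z * a (z / s n)) \<longlonglongrightarrow> (LINT z|lborel. ?n z * of_real ((L2_norm f)\<^sup>2))"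
  proof (rule integral_dominated_convergence[where w="\<lambda>z. (L2_norm f)\<^sup>2 * std_normal_density z"])
    show "AE z in lborel. (\<lambda>n. ?n z * a (z / s n)) \<longlonglongrightarrow> ?n z * of_real ((L2_norm f)\<^sup>2)"
    proof (rule AE_I2)
      fix z
      have "(\<lambda>n. z / s n) \<longlonglongrightarrow> 0"
        unfolding s_def by (rule LIMSEQ_Suc[OF lim_const_over_n])
      from L2_autocorrelation_tendsto[OF f f1 this]
      show "(\<lambda>n. ?n z * a (z / s n)) \<longlonglongrightarrow> ?n z * of_real ((L2_norm f)\<^sup>2)"
        unfolding a_def by (rule tendsto_mult_left)
    qed
    show "AE z in lborel. norm (?n z * a (z / s n)) \<le> (L2_norm f)\<^sup>2 * std_normal_density z" for n
      using ale by (intro AE_I2) (simp add: norm_mult mult.commute mult_left_mono)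
  qed (auto simp: s_def)
  moreover have "(LINT z|lborel. ?n z * of_real ((L2_norm f)\<^sup>2)) = of_real ((L2_norm f)\<^sup>2)"
    by (simp flip: of_real_mult of_real_power)
  moreover have "of_real (s n * sqrt (2 * pi) * J n) = of_real (2 * pi) * (LINT z|lborel. ?n z * a (z / s n))" for n
  proof -
    have "complex_of_real (J n) = (LINT z|lborel. ?n z * (fourier f (s n * z) * cnj (fourier f (s n * z))))"
      unfolding J_def by (subst integral_complex_of_real[symmetric])
        (simp add: complex_norm_square[symmetric])
    then show ?thesis using fourier_gauss_average[OF f f1 s, of n] by (simp add: a_def)
  qed
  ultimately have "(\<lambda>n. complex_of_real (s n * sqrt (2 * pi) * J n)) \<longlonglongrightarrow> of_real (2 * pi) * of_real ((L2_norm f)\<^sup>2)"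
    by (simp only: tendsto_mult_left)
  then have "(\<lambda>n. complex_of_real (s n * sqrt (2 * pi) * J n)) \<longlonglongrightarrow> of_real (2 * pi * (L2_norm f)\<^sup>2)"
    by simp
  then have lim: "(\<lambda>n. s n * sqrt (2 * pi) * J n) \<longlonglongrightarrow> 2 * pi * (L2_norm f)\<^sup>2"
    by (simp only: tendsto_of_real_iff)
  have J: "(\<integral>\<^sup>+u. ennreal ((cmod (fourier f u))\<^sup>2 * exp (- (u / s n)\<^sup>2 / 2)) \<partial>lborel) = ennreal (s n * sqrt (2 * pi) * J n)" for n
  proof -
    have int: "integrable lborel (\<lambda>z. std_normal_density z * (cmod (fourier f (s n * z)))\<^sup>2)"
    proof (rule Bochner_Integration.integrable_bound)
      show "integrable lborel (\<lambda>z. (LINT x|lborel. cmod (f x))\<^sup>2 * std_normal_density z)" by simp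
      show "AE z in lborel. norm (std_normal_density z * (cmod (fourier f (s n * z)))\<^sup>2)
          \<le> norm ((LINT x|lborel. cmod (f x))\<^sup>2 * std_normal_density z)"
        using cmod_fourier_le[OF f1]
        by (intro AE_I2) (simp add: abs_mult mult.commute mult_left_mono power_mono)
    qed measurable
    have "(\<integral>\<^sup>+u. ennreal ((cmod (fourier f u))\<^sup>2 * exp (- (u / s n)\<^sup>2 / 2)) \<partial>lborel)
        = s n * (\<integral>\<^sup>+z. ennreal ((cmod (fourier f (s n * z)))\<^sup>2 * exp (- z\<^sup>2 / 2)) \<partial>lborel)"
      using s[of n] by (subst nn_integral_real_affine[where c="s n" and t=0]) auto
    also have "\<dots> = s n * (\<integral>\<^sup>+z. ennreal (sqrt (2 * pi)) * ennreal (std_normal_density z * (cmod (fourier f (s n * z)))\<^sup>2) \<partial>lborel)"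
      by (simp add: std_normal_density_def mult.commute flip: ennreal_mult)
    also have "\<dots> = s n * (ennreal (sqrt (2 * pi)) * J n)"
      using int by (subst nn_integral_cmult) (auto simp: J_def nn_integral_eq_integral)
    finally show ?thesis
      using s[of n] by (simp add: ennreal_mult' mult.assoc J_def integral_nonneg_AE)
  qed
  have "(\<lambda>n. \<integral>\<^sup>+u. ennreal ((cmod (fourier f u))\<^sup>2 * exp (- (u / s n)\<^sup>2 / 2)) \<partial>lborel)
      \<longlonglongrightarrow> (\<integral>\<^sup>+u. ennreal ((cmod (fourier f u))\<^sup>2) \<partial>lborel)"
  proof (rule nn_integral_LIMSEQ)
    show "incseq (\<lambda>n u. ennreal ((cmod (fourier f u))\<^sup>2 * exp (- (u / s n)\<^sup>2 / 2)))"
    proof (rule incseq_SucI, rule le_funI)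
      fix n u
      have "(u / s (Suc n))\<^sup>2 \<le> (u / s n)\<^sup>2"
        unfolding power_divide by (intro divide_left_mono power_mono mult_pos_pos zero_less_power s) (auto simp: s_def)
      then show "ennreal ((cmod (fourier f u))\<^sup>2 * exp (- (u / s n)\<^sup>2 / 2))
          \<le> ennreal ((cmod (fourier f u))\<^sup>2 * exp (- (u / s (Suc n))\<^sup>2 / 2))"
        by (intro ennreal_leI mult_left_mono) auto
    qed
    fix u
    have "(\<lambda>n. u / s n) \<longlonglongrightarrow> 0"
      unfolding s_def by (rule LIMSEQ_Suc[OF lim_const_over_n])
    then have "(\<lambda>n. (cmod (fourier f u))\<^sup>2 * exp (- (u / s n)\<^sup>2 / 2)) \<longlonglongrightarrow> (cmod (fourier f u))\<^sup>2 * exp (- 0\<^sup>2 / 2)"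
      by (intro tendsto_intros) auto
    then show "(\<lambda>n. ennreal ((cmod (fourier f u))\<^sup>2 * exp (- (u / s n)\<^sup>2 / 2))) \<longlonglongrightarrow> ennreal ((cmod (fourier f u))\<^sup>2)"
      by (intro tendsto_ennrealI) simp
  qed measurable
  then show ?thesis
    unfolding J using tendsto_ennrealI[OF lim] by (rule LIMSEQ_unique)
qed

subsection \<open>The fractional Fourier transform on square integrable functions\<close>

definition chirp :: "real \<Rightarrow> real \<Rightarrow> complex" where
  "chirp \<alpha> t = exp (\<i> / 2 * of_real (t\<^sup>2 * cot \<alpha>))"

text \<open>This is E_n of the overview. Keeping the constant phase in it lets the same coefficients
  c_n serve on both sides of the transform; being unimodular, the phase preserves
  orthogonality.\<close>

definition frft_mod :: "real \<Rightarrow> int \<Rightarrow> real \<Rightarrow> complex" where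
  "frft_mod \<alpha> n u = iexp ((of_int n)\<^sup>2 * cot \<alpha> / 2 - of_int n * u / sin \<alpha>)"

lemma chirp_measurable [measurable]: "chirp \<alpha> \<in> borel_measurable borel"
  unfolding chirp_def by measurable

lemma frft_mod_measurable [measurable]: "frft_mod \<alpha> n \<in> borel_measurable borel"
  unfolding frft_mod_def by measurable

lemma cmod_exp_imaginary: "cmod (exp (\<i> / 2 * of_real x)) = 1"
  by (simp add: norm_exp_eq_Re)

lemma cmod_chirp [simp]: "cmod (chirp \<alpha> t) = 1"
  unfolding chirp_def by (rule cmod_exp_imaginary)

lemma cmod_frft_mod [simp]: "cmod (frft_mod \<alpha> n u) = 1"
  by (simp add: frft_mod_def)

text \<open>The exponent splits into a chirp in t, a chirp in u and a Fourier kernel at frequency u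
  / sin \<open>\<alpha>\<close>. Chirps have modulus 1, so Plancherel carries over up to the
  constant and a dilation.\<close>

lemma frft_integral_fourier:
  "frft_integral \<alpha> f u =
    frft_const \<alpha> * chirp \<alpha> u * fourier (\<lambda>t. chirp \<alpha> t * f t) (u / sin \<alpha>)"
proof -
  have "frft_integral \<alpha> f u =
     (LINT t|lborel. (frft_const \<alpha> * chirp \<alpha> u) * (chirp \<alpha> t * f t * iexp (- (t * (u / sin \<alpha>)))))"
    unfolding frft_integral_def
  proof (rule Bochner_Integration.integral_cong[OF refl])
    fix t
    have "exp (\<i> / 2 * of_real ((t\<^sup>2 + u\<^sup>2) * cot \<alpha>) - \<i> * of_real (t * u * (1 / sin \<alpha>))) =
        chirp \<alpha> u * chirp \<alpha> t * iexp (- (t * (u / sin \<alpha>)))"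
      unfolding chirp_def exp_add[symmetric] by (rule arg_cong[where f=exp]) (simp add: algebra_simps add_divide_distrib)
    then show "frft_const \<alpha> * exp (\<i> / 2 * of_real ((t\<^sup>2 + u\<^sup>2) * cot \<alpha>) - \<i> * of_real (t * u * (1 / sin \<alpha>))) * f t =
        (frft_const \<alpha> * chirp \<alpha> u) * (chirp \<alpha> t * f t * iexp (- (t * (u / sin \<alpha>))))"
      by (simp only: mult_ac)
  qed
  then show ?thesis by (simp only: integral_mult_right_zero fourier_def)
qed

text \<open>From 1 + cot^2 = 1 / sin^2. The value cancels both the 2 pi of \<open>Plancherel\<close>
  and the Jacobian sin \<open>\<alpha>\<close> of the dilation u / sin
  \<open>\<alpha>\<close>.\<close>

lemma cmod_frft_const_sq:
  assumes "sin \<alpha> > 0"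
  shows "(cmod (frft_const \<alpha>))\<^sup>2 = 1 / (2 * pi * sin \<alpha>)"
proof -
  have "cmod (1 - \<i> * of_real (cot \<alpha>)) = sqrt (1 + (cot \<alpha>)\<^sup>2)"
    by (simp add: cmod_def)
  also have "1 + (cot \<alpha>)\<^sup>2 = ((sin \<alpha>)\<^sup>2 + (cos \<alpha>)\<^sup>2) / (sin \<alpha>)\<^sup>2"
    using assms by (simp add: cot_def power_divide add_divide_distrib del: sin_cos_squared_add)
  also have "\<dots> = (1 / sin \<alpha>)\<^sup>2"
    by (simp add: power_divide)
  finally have *: "cmod (1 - \<i> * of_real (cot \<alpha>)) = 1 / sin \<alpha>"
    using assms by simp
  have "(cmod (frft_const \<alpha>))\<^sup>2 = cmod ((1 - \<i> * of_real (cot \<alpha>)) / of_real (2 * pi))"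
    unfolding frft_const_def norm_power[symmetric] power2_csqrt ..
  also have "\<dots> = 1 / (2 * pi * sin \<alpha>)"
    unfolding norm_divide * by simp
  finally show ?thesis .
qed

lemma frft_integral_measurable [measurable]:
  assumes [measurable]: "f \<in> borel_measurable borel"
  shows "frft_integral \<alpha> f \<in> borel_measurable borel"
  unfolding frft_integral_fourier[abs_def] by measurable

lemma frft_isometry:
  assumes s: "sin \<alpha> > 0" and f: "f \<in> L1R \<inter> L2R"
  shows "frft_integral \<alpha> f \<in> L2R" and "L2_norm (frft_integral \<alpha> f) = L2_norm f"
proof -
  note [measurable] = L2R_measurable[OF IntD2[OF f]]
  let ?h = "\<lambda>t. chirp \<alpha> t * f t"
  have h2: "?h \<in> L2R" using f by (intro L2R_mult_bounded[where C=1]) auto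
  have h1: "integrable lborel ?h"
    by (rule Bochner_Integration.integrable_bound[of _ f]) (use f in \<open>auto simp: L1R_def norm_mult\<close>)
  have nh: "L2_norm ?h = L2_norm f" by (simp add: L2_norm_def norm_mult)
  have "(\<integral>\<^sup>+u. ennreal ((cmod (frft_integral \<alpha> f u))\<^sup>2) \<partial>lborel)
      = (\<integral>\<^sup>+u. ennreal (1 / (2 * pi * sin \<alpha>)) * ennreal ((cmod (fourier ?h (u / sin \<alpha>)))\<^sup>2) \<partial>lborel)"
    using s by (intro nn_integral_cong, subst ennreal_mult[symmetric])
      (auto simp: frft_integral_fourier norm_mult power_mult_distrib cmod_frft_const_sq)
  also have "\<dots> = ennreal (1 / (2 * pi * sin \<alpha>)) * (\<integral>\<^sup>+u. ennreal ((cmod (fourier ?h (u / sin \<alpha>)))\<^sup>2) \<partial>lborel)"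
    by (rule nn_integral_cmult) measurable
  also have "(\<integral>\<^sup>+u. ennreal ((cmod (fourier ?h (u / sin \<alpha>)))\<^sup>2) \<partial>lborel)
      = ennreal (sin \<alpha>) * (\<integral>\<^sup>+u. ennreal ((cmod (fourier ?h u))\<^sup>2) \<partial>lborel)"
    using s by (subst nn_integral_real_affine[where c="sin \<alpha>" and t=0]) auto
  also have "\<dots> = ennreal (sin \<alpha>) * ennreal (2 * pi * (L2_norm f)\<^sup>2)"
    using Plancherel[OF h2 h1] by (simp add: nh)
  also have "ennreal (1 / (2 * pi * sin \<alpha>)) * (ennreal (sin \<alpha>) * ennreal (2 * pi * (L2_norm f)\<^sup>2))
      = ennreal ((L2_norm f)\<^sup>2)"
    using s by (simp flip: ennreal_mult)
  finally have eq: "(\<integral>\<^sup>+u. ennreal ((cmod (frft_integral \<alpha> f u))\<^sup>2) \<partial>lborel) = ennreal ((L2_norm f)\<^sup>2)" .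
  show L2: "frft_integral \<alpha> f \<in> L2R"
    by (rule L2R_I, measurable, rule integrableI_bounded, measurable) (simp add: eq)
  have "(L2_norm (frft_integral \<alpha> f))\<^sup>2 = (L2_norm f)\<^sup>2"
    unfolding L2_norm_sq[of "frft_integral \<alpha> f"] using eq
    by (subst integral_eq_nn_integral) auto
  then show "L2_norm (frft_integral \<alpha> f) = L2_norm f" by (simp add: power2_eq_iff_nonneg)
qed

lemma frft_kernel_integrable:
  assumes "integrable lborel f"
  shows "integrable lborel (\<lambda>t. frft_const \<alpha> *
     exp (\<i> / 2 * of_real ((t\<^sup>2 + u\<^sup>2) * cot \<alpha>) - \<i> * of_real (t * u * (1 / sin \<alpha>))) * f t)"
proof (rule Bochner_Integration.integrable_bound)
  have [measurable]: "f \<in> borel_measurable borel"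
    using borel_measurable_integrable[OF assms] by simp
  show "integrable lborel (\<lambda>t. frft_const \<alpha> * f t)" using assms by simp
  show "AE t in lborel. norm (frft_const \<alpha> *
     exp (\<i> / 2 * of_real ((t\<^sup>2 + u\<^sup>2) * cot \<alpha>) - \<i> * of_real (t * u * (1 / sin \<alpha>))) * f t)
     \<le> norm (frft_const \<alpha> * f t)"
    by (intro AE_I2) (simp add: norm_mult norm_exp_eq_Re)
  show "(\<lambda>t. frft_const \<alpha> *
     exp (\<i> / 2 * of_real ((t\<^sup>2 + u\<^sup>2) * cot \<alpha>) - \<i> * of_real (t * u * (1 / sin \<alpha>))) * f t)
     \<in> borel_measurable lborel"
    by measurable
qed

lemma frft_integral_diff:
  assumes "integrable lborel f" "integrable lborel g"
  shows "frft_integral \<alpha> (\<lambda>t. f t - g t) u = frft_integral \<alpha> f u - frft_integral \<alpha> g u"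
  unfolding frft_integral_def right_diff_distrib
  by (rule Bochner_Integration.integral_diff) (intro frft_kernel_integrable assms)+

lemma frft_integral_sum:
  assumes "\<And>i. i \<in> S \<Longrightarrow> integrable lborel (f i)"
  shows "frft_integral \<alpha> (\<lambda>t. \<Sum>i\<in>S. c i * f i t) u = (\<Sum>i\<in>S. c i * frft_integral \<alpha> (f i) u)"
proof -
  have "frft_integral \<alpha> (\<lambda>t. \<Sum>i\<in>S. c i * f i t) u =
    (LINT t|lborel. (\<Sum>i\<in>S. c i * (frft_const \<alpha> *
     exp (\<i> / 2 * of_real ((t\<^sup>2 + u\<^sup>2) * cot \<alpha>) - \<i> * of_real (t * u * (1 / sin \<alpha>))) * f i t)))"
    unfolding frft_integral_def sum_distrib_left
    by (intro Bochner_Integration.integral_cong[OF refl] sum.cong refl mult.left_commute)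
  also have "\<dots> = (\<Sum>i\<in>S. LINT t|lborel. c i * (frft_const \<alpha> *
     exp (\<i> / 2 * of_real ((t\<^sup>2 + u\<^sup>2) * cot \<alpha>) - \<i> * of_real (t * u * (1 / sin \<alpha>))) * f i t))"
    by (rule Bochner_Integration.integral_sum)
      (intro integrable_mult_right frft_kernel_integrable assms)
  finally show ?thesis by (simp only: integral_mult_right_zero frft_integral_def)
qed

lemma L1R_L2R_diff: "f \<in> L1R \<inter> L2R \<Longrightarrow> g \<in> L1R \<inter> L2R \<Longrightarrow> (\<lambda>x. f x - g x) \<in> L1R \<inter> L2R"
  by (auto simp: L1R_def intro: L2R_diff)

lemma L2_norm_frft_integral_diff:
  assumes "sin \<alpha> > 0" "f \<in> L1R \<inter> L2R" "g \<in> L1R \<inter> L2R"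
  shows "L2_norm (\<lambda>x. frft_integral \<alpha> f x - frft_integral \<alpha> g x) = L2_norm (\<lambda>x. f x - g x)"
proof -
  have "frft_integral \<alpha> (\<lambda>x. f x - g x) = (\<lambda>x. frft_integral \<alpha> f x - frft_integral \<alpha> g x)"
    using assms by (auto simp: L1R_def frft_integral_diff)
  with frft_isometry(2)[OF assms(1) L1R_L2R_diff[OF assms(2,3)]] show ?thesis by simp
qed

text \<open>Since \<open>frft\<close> is a choice, nothing is known about it before some limit is
  shown to exist. By isometry the transforms of a truncating sequence F are Cauchy, so they have a
  limit. Any other sequence G has the same limit, because transforms of G and F are exactly as far
  apart as G and F.\<close>

lemma has_frft_frft:
  assumes s: "sin \<alpha> > 0" and f: "f \<in> L2R"
  shows "has_frft \<alpha> f (frft \<alpha> f)"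
proof -
  obtain F where F: "\<And>N. F N \<in> L1R \<inter> L2R" "L2_tendsto F f"
    using L2_truncation[OF f] by blast
  obtain \<Theta> where \<Theta>: "L2_tendsto (\<lambda>N. frft_integral \<alpha> (F N)) \<Theta>"
  proof (rule L2_complete)
    fix e :: real assume "0 < e"
    then have "\<forall>\<^sub>F N in sequentially. L2_norm (\<lambda>x. F N x - f x) < e / 2"
      using order_tendstoD(2)[OF L2_tendstoD(3)[OF F(2)], of "e / 2"] by simp
    then obtain N where N: "\<And>i. i \<ge> N \<Longrightarrow> L2_norm (\<lambda>x. F i x - f x) < e / 2"
      by (auto simp: eventually_sequentially)
    have "L2_norm (\<lambda>x. F i x - F j x) < e" if "i \<ge> N" "j \<ge> N" for i j
      using L2_norm_triangle_sub[OF IntD2[OF F(1)] f IntD2[OF F(1)], of i j] N[OF that(1)] N[OF that(2)]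
      by (simp add: L2_norm_minus_commute[of f])
    then show "\<exists>N. \<forall>i\<ge>N. \<forall>j\<ge>N. L2_norm (\<lambda>x. frft_integral \<alpha> (F i) x - frft_integral \<alpha> (F j) x) < e"
      using L2_norm_frft_integral_diff[OF s F(1) F(1)] by auto
  qed (use frft_isometry[OF s F(1)] in auto)
  have "has_frft \<alpha> f \<Theta>"
    unfolding has_frft_def
  proof (intro conjI allI impI f L2_tendstoD(2)[OF \<Theta>])
    fix G assume "(\<forall>N. G N \<in> L1R \<inter> L2R) \<and> L2_tendsto G f"
    then have G: "\<And>N. G N \<in> L1R \<inter> L2R" "L2_tendsto G f" by auto
    have "(\<lambda>N. L2_norm (\<lambda>x. frft_integral \<alpha> (G N) x - \<Theta> x)) \<longlonglongrightarrow> 0"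
    proof (rule Lim_null_comparison)
      show "(\<lambda>N. (L2_norm (\<lambda>x. G N x - f x) + L2_norm (\<lambda>x. F N x - f x)) +
          L2_norm (\<lambda>x. frft_integral \<alpha> (F N) x - \<Theta> x)) \<longlonglongrightarrow> 0"
        using tendsto_add[OF tendsto_add[OF L2_tendstoD(3)[OF G(2)] L2_tendstoD(3)[OF F(2)]] L2_tendstoD(3)[OF \<Theta>]]
        by simp
      have "L2_norm (\<lambda>x. frft_integral \<alpha> (G N) x - \<Theta> x) \<le>
          (L2_norm (\<lambda>x. G N x - f x) + L2_norm (\<lambda>x. F N x - f x)) +
          L2_norm (\<lambda>x. frft_integral \<alpha> (F N) x - \<Theta> x)" for N
        using L2_norm_triangle_sub[OF frft_isometry(1)[OF s G(1)[of N]] frft_isometry(1)[OF s F(1)[of N]] L2_tendstoD(2)[OF \<Theta>]]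
          L2_norm_triangle_sub[OF IntD2[OF G(1)] f IntD2[OF F(1)], of N N]
        by (simp add: L2_norm_frft_integral_diff[OF s G(1) F(1)] L2_norm_minus_commute[of f])
      then show "\<forall>\<^sub>F N in sequentially. norm (L2_norm (\<lambda>x. frft_integral \<alpha> (G N) x - \<Theta> x)) \<le>
          (L2_norm (\<lambda>x. G N x - f x) + L2_norm (\<lambda>x. F N x - f x)) +
          L2_norm (\<lambda>x. frft_integral \<alpha> (F N) x - \<Theta> x)" by simp
    qed
    then show "L2_tendsto (\<lambda>N. frft_integral \<alpha> (G N)) \<Theta>"
      using frft_isometry(1)[OF s G(1)] L2_tendstoD(2)[OF \<Theta>] by (simp add: L2_tendsto_def)
  qed
  then show ?thesis unfolding frft_def by (rule someI[of "has_frft \<alpha> f"])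
qed

lemma frft_L2R: "sin \<alpha> > 0 \<Longrightarrow> f \<in> L2R \<Longrightarrow> frft \<alpha> f \<in> L2R"
  using has_frft_frft by (auto simp: has_frft_def)

section \<open>Transforms of the chirped shifts\<close>

definition shift_phase :: "real \<Rightarrow> int \<Rightarrow> real \<Rightarrow> complex" where
  "shift_phase \<alpha> n t = exp (- (\<i> / 2) * of_real ((t\<^sup>2 - (of_int n)\<^sup>2 - (t - of_int n)\<^sup>2) * cot \<alpha>))"

lemma shift_phase_measurable [measurable]: "shift_phase \<alpha> n \<in> borel_measurable borel"
  unfolding shift_phase_def by measurable

lemma cmod_shift_phase [simp]: "cmod (shift_phase \<alpha> n t) = 1"
  by (simp add: shift_phase_def norm_exp_eq_Re)

lemma chirp_shift_eq: "chirp_shift \<alpha> f n = (\<lambda>t. shift_phase \<alpha> n t * f (t + of_int (- n)))"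
  by (auto simp: chirp_shift_def shift_phase_def)

lemma chirp_shift_L2R: "f \<in> L2R \<Longrightarrow> chirp_shift \<alpha> f n \<in> L2R"
  unfolding chirp_shift_eq by (intro L2R_mult_bounded[where C=1] L2R_shift) auto

lemma chirp_shift_L1R:
  assumes "f \<in> L1R" shows "chirp_shift \<alpha> f n \<in> L1R"
proof -
  have i: "integrable lborel (\<lambda>t. f (t + of_int (- n)))"
    using assms by (intro integrable_shift) (simp add: L1R_def)
  have [measurable]: "f \<in> borel_measurable borel"
    using assms borel_measurable_integrable[of lborel f] by (simp add: L1R_def)
  have "integrable lborel (chirp_shift \<alpha> f n)"
    unfolding chirp_shift_eq by (rule Bochner_Integration.integrable_bound[OF i]) (auto simp: norm_mult)
  then show ?thesis by (simp add: L1R_def)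
qed

lemma chirp_shift_tendsto:
  assumes "L2_tendsto F f"
  shows "L2_tendsto (\<lambda>N. chirp_shift \<alpha> (F N) n) (chirp_shift \<alpha> f n)"
proof -
  note D = L2_tendstoD[OF assms]
  have "L2_tendsto (\<lambda>N t. F N (t + of_int (- n))) (\<lambda>t. f (t + of_int (- n)))"
    unfolding L2_tendsto_def
  proof (intro conjI allI)
    show "(\<lambda>t. F N (t + of_int (- n))) \<in> L2R" for N by (rule L2R_shift[OF D(1)])
    show "(\<lambda>t. f (t + of_int (- n))) \<in> L2R" by (rule L2R_shift[OF D(2)])
    show "(\<lambda>N. L2_norm (\<lambda>t. F N (t + of_int (- n)) - f (t + of_int (- n)))) \<longlonglongrightarrow> 0"
    proof (rule Lim_transform_eventually[OF D(3)], intro always_eventually allI)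
      show "L2_norm (\<lambda>x. F N x - f x) = L2_norm (\<lambda>t. F N (t + of_int (- n)) - f (t + of_int (- n)))" for N
        by (rule L2_norm_shift[where f="\<lambda>x. F N x - f x", symmetric])
    qed
  qed
  then show ?thesis
    unfolding chirp_shift_eq by (rule L2_tendsto_mult_bounded[where C=1]) auto
qed

text \<open>After t -> t + n the phase of the shift removes the cross term of (t + n)^2 cot
  \<open>\<alpha>\<close> / 2 and leaves (t^2 + n^2) cot \<open>\<alpha>\<close> / 2. The linear
  term of the kernel contributes -n u / sin \<open>\<alpha>\<close>.\<close>

lemma frft_integral_chirp_shift:
  "frft_integral \<alpha> (chirp_shift \<alpha> f n) u = frft_mod \<alpha> n u * frft_integral \<alpha> f u"
proof -
  let ?K = "\<lambda>t. exp (\<i> / 2 * of_real ((t\<^sup>2 + u\<^sup>2) * cot \<alpha>) - \<i> * of_real (t * u * (1 / sin \<alpha>)))"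
  have "frft_integral \<alpha> (chirp_shift \<alpha> f n) u =
      (LINT t|lborel. frft_const \<alpha> * ?K (t + of_int n) * chirp_shift \<alpha> f n (t + of_int n))"
    unfolding frft_integral_def by (rule integral_shift[symmetric])
  also have "\<dots> = (LINT t|lborel. frft_mod \<alpha> n u * (frft_const \<alpha> * ?K t * f t))"
  proof (rule Bochner_Integration.integral_cong[OF refl])
    fix t
    have "?K (t + of_int n) * shift_phase \<alpha> n (t + of_int n) = frft_mod \<alpha> n u * ?K t"
      unfolding shift_phase_def frft_mod_def exp_add[symmetric]
      by (rule arg_cong[where f=exp])
        (simp add: power2_eq_square algebra_simps add_divide_distrib diff_divide_distrib)
    then show "frft_const \<alpha> * ?K (t + of_int n) * chirp_shift \<alpha> f n (t + of_int n) =
        frft_mod \<alpha> n u * (frft_const \<alpha> * ?K t * f t)"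
      unfolding chirp_shift_eq by (simp add: mult_ac)
  qed
  finally show ?thesis by (simp only: integral_mult_right_zero frft_integral_def)
qed

text \<open>The integral formula is available only on L^1 and L^2 together, so f is approximated
  there. For the approximants the transform of the sum is pointwise \<open>?P\<close> times the
  transform; since \<open>?P\<close> is bounded, norms on both sides pass to the limit.\<close>

lemma L2_norm_sum_chirp_shift:
  assumes s: "sin \<alpha> > 0" and f: "f \<in> L2R" and S: "finite S"
  shows "L2_norm (\<lambda>t. \<Sum>n\<in>S. c n * chirp_shift \<alpha> f n t) =
    L2_norm (\<lambda>u. (\<Sum>n\<in>S. c n * frft_mod \<alpha> n u) * frft \<alpha> f u)"
proof -
  obtain F where F: "\<And>N. F N \<in> L1R \<inter> L2R" "L2_tendsto F f"
    using L2_truncation[OF f] by blast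
  let ?P = "\<lambda>u. \<Sum>n\<in>S. c n * frft_mod \<alpha> n u"
  let ?G = "\<lambda>N t. \<Sum>n\<in>S. c n * chirp_shift \<alpha> (F N) n t"
  have G: "?G N \<in> L1R \<inter> L2R" for N
    using F(1)[of N] chirp_shift_L1R[of "F N"] S
    by (auto simp: L1R_def intro!: L2R_sum L2R_cmult chirp_shift_L2R)
  have "L2_tendsto ?G (\<lambda>t. \<Sum>n\<in>S. c n * chirp_shift \<alpha> f n t)"
    by (intro L2_tendsto_sum L2_tendsto_cmult chirp_shift_tendsto F)
  then have 1: "(\<lambda>N. L2_norm (?G N)) \<longlonglongrightarrow> L2_norm (\<lambda>t. \<Sum>n\<in>S. c n * chirp_shift \<alpha> f n t)"
    by (rule L2_tendsto_norm)
  have "frft_integral \<alpha> (?G N) = (\<lambda>u. ?P u * frft_integral \<alpha> (F N) u)" for N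
  proof
    fix u
    have "frft_integral \<alpha> (?G N) u = (\<Sum>n\<in>S. c n * frft_integral \<alpha> (chirp_shift \<alpha> (F N) n) u)"
      by (rule frft_integral_sum) (use F(1)[of N] chirp_shift_L1R in \<open>auto simp: L1R_def\<close>)
    then show "frft_integral \<alpha> (?G N) u = ?P u * frft_integral \<alpha> (F N) u"
      by (simp add: frft_integral_chirp_shift sum_distrib_right mult.assoc)
  qed
  then have 2: "L2_norm (\<lambda>u. ?P u * frft_integral \<alpha> (F N) u) = L2_norm (?G N)" for N
    using frft_isometry(2)[OF s G, of N] by simp
  have "L2_tendsto (\<lambda>N. frft_integral \<alpha> (F N)) (frft \<alpha> f)"
    using has_frft_frft[OF s f] F by (simp add: has_frft_def)
  then have "L2_tendsto (\<lambda>N u. ?P u * frft_integral \<alpha> (F N) u) (\<lambda>u. ?P u * frft \<alpha> f u)"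
  proof (rule L2_tendsto_mult_bounded)
    show "cmod (?P u) \<le> (\<Sum>n\<in>S. cmod (c n))" for u
      by (rule order_trans[OF norm_sum]) (simp add: norm_mult)
  qed measurable
  from L2_tendsto_norm[OF this] have "(\<lambda>N. L2_norm (?G N)) \<longlonglongrightarrow> L2_norm (\<lambda>u. ?P u * frft \<alpha> f u)"
    unfolding 2 .
  with 1 show ?thesis by (rule LIMSEQ_unique)
qed

subsection \<open>Periodization\<close>

text \<open>Half-open intervals of length T tile the line. The values are extended nonnegative, so
  sum and integral interchange freely, and \<open>int_decode\<close> turns the sum over integers
  into a series.\<close>

lemma nn_integral_periodize:
  fixes h :: "real \<Rightarrow> ennreal"
  assumes [measurable]: "h \<in> borel_measurable borel" and T: "0 < T"
  shows "(\<integral>\<^sup>+x. h x \<partial>lborel) =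
    (\<integral>\<^sup>+u. (\<Sum>n. h (u + of_int (int_decode n) * T)) * indicator {0..<T} u \<partial>lborel)"
proof -
  define B where "B = (\<lambda>n. {of_int (int_decode n) * T ..< (of_int (int_decode n) + 1) * T})"
  \<comment> \<open>The tile containing x is the one numbered by the floor of x / T; disjointness
    and covering both follow.\<close>
  have mem: "x \<in> B n \<longleftrightarrow> int_decode n = \<lfloor>x / T\<rfloor>" for x n
    using T unfolding eq_commute[of "int_decode n"] floor_eq_iff
    by (simp add: B_def pos_le_divide_eq pos_divide_less_eq)
  have disj: "disjoint_family B"
    by (auto simp: disjoint_family_on_def mem) (metis int_decode_eq)
  have un: "(\<Union>n. B n) = UNIV"
  proof -
    have "x \<in> B (int_encode \<lfloor>x / T\<rfloor>)" for x by (simp add: mem)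
    then show ?thesis by blast
  qed
  have [measurable, simp]: "B n \<in> sets borel" for n by (simp add: B_def)
  have "(\<integral>\<^sup>+x. h x \<partial>lborel) = (\<Sum>n. \<integral>\<^sup>+x\<in>B n. h x \<partial>lborel)"
    using nn_integral_disjoint_family[of h lborel B] disj un by simp
  also have "\<dots> = (\<Sum>n. \<integral>\<^sup>+u. h (u + of_int (int_decode n) * T) * indicator {0..<T} u \<partial>lborel)"
  proof (intro suminf_cong)
    fix n
    have "(\<integral>\<^sup>+x\<in>B n. h x \<partial>lborel) = (\<integral>\<^sup>+u. h (of_int (int_decode n) * T + 1 * u) * indicator (B n) (of_int (int_decode n) * T + 1 * u) \<partial>lborel)"
      by (subst nn_integral_real_affine[where c=1 and t="of_int (int_decode n) * T"]) simp_all
    also have "\<dots> = (\<integral>\<^sup>+u. h (u + of_int (int_decode n) * T) * indicator {0..<T} u \<partial>lborel)"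
      by (intro nn_integral_cong) (auto simp: B_def indicator_def algebra_simps)
    finally show "(\<integral>\<^sup>+x\<in>B n. h x \<partial>lborel) = (\<integral>\<^sup>+u. h (u + of_int (int_decode n) * T) * indicator {0..<T} u \<partial>lborel)" .
  qed
  also have "\<dots> = (\<integral>\<^sup>+u. (\<Sum>n. h (u + of_int (int_decode n) * T) * indicator {0..<T} u) \<partial>lborel)"
    by (rule nn_integral_suminf[symmetric]) measurable
  finally show ?thesis by simp
qed

text \<open>The closed interval of the theorem. It represents the circle only up to a null set,
  since both endpoints are kept.\<close>

abbreviation circ :: "real \<Rightarrow> real measure" where
  "circ T \<equiv> restrict_space lborel {0..T}"

lemma borel_measurable_circ [measurable (raw)]:
  "f \<in> borel_measurable borel \<Longrightarrow> f \<in> borel_measurable (circ T)"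
  by (rule measurable_restrict_space1) simp

lemma nn_integral_circ:
  assumes [measurable]: "f \<in> borel_measurable borel"
  shows "(\<integral>\<^sup>+u. f u * indicator {0..<T} u \<partial>lborel) = (\<integral>\<^sup>+u. f u \<partial>circ T)"
proof -
  have "AE u in lborel. u \<noteq> T" by (rule AE_lborel_singleton)
  then have "(\<integral>\<^sup>+u. f u * indicator {0..<T} u \<partial>lborel) = (\<integral>\<^sup>+u. f u * indicator {0..T} u \<partial>lborel)"
    by (intro nn_integral_cong_AE, eventually_elim) (auto simp: indicator_def)
  then show ?thesis by (simp add: nn_integral_restrict_space)
qed

text \<open>With extended nonnegative values divergence shows as \<open>top\<close>, and the sum can
  be integrated before it is known to be finite.\<close>

definition period_sum :: "real \<Rightarrow> (real \<Rightarrow> complex) \<Rightarrow> real \<Rightarrow> ennreal" where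
  "period_sum T \<Theta> u = (\<Sum>n. ennreal ((cmod (\<Theta> (u + of_int (int_decode n) * T)))\<^sup>2))"

lemma period_sum_measurable [measurable]:
  assumes [measurable]: "\<Theta> \<in> borel_measurable borel"
  shows "period_sum T \<Theta> \<in> borel_measurable borel"
  unfolding period_sum_def by measurable

lemma nn_integral_period_sum:
  assumes \<Theta>: "\<Theta> \<in> L2R" and T: "0 < T"
    and [measurable]: "q \<in> borel_measurable borel" and per: "\<And>u k. q (u + of_int k * T) = q u"
  shows "(\<integral>\<^sup>+u. q u * ennreal ((cmod (\<Theta> u))\<^sup>2) \<partial>lborel) = (\<integral>\<^sup>+u. q u * period_sum T \<Theta> u \<partial>circ T)"
proof -
  note [measurable] = L2R_measurable[OF \<Theta>]
  have "(\<integral>\<^sup>+u. q u * ennreal ((cmod (\<Theta> u))\<^sup>2) \<partial>lborel) =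
      (\<integral>\<^sup>+u. (q u * period_sum T \<Theta> u) * indicator {0..<T} u \<partial>lborel)"
    by (subst nn_integral_periodize[OF _ T]) (simp_all add: per period_sum_def)
  also have "\<dots> = (\<integral>\<^sup>+u. q u * period_sum T \<Theta> u \<partial>circ T)"
    by (rule nn_integral_circ) measurable
  finally show ?thesis .
qed

text \<open>The integral of the periodization over one period is the squared norm of
  \<open>\<Theta>\<close>, hence finite.\<close>

lemma AE_period_sum_finite:
  assumes \<Theta>: "\<Theta> \<in> L2R" and T: "0 < T"
  shows "AE u in circ T. period_sum T \<Theta> u \<noteq> top"
proof -
  note [measurable] = L2R_measurable[OF \<Theta>]
  have "(\<integral>\<^sup>+u. period_sum T \<Theta> u \<partial>circ T) = (\<integral>\<^sup>+u. ennreal ((cmod (\<Theta> u))\<^sup>2) \<partial>lborel)"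
    using nn_integral_period_sum[OF \<Theta> T, of "\<lambda>_. 1"] by simp
  also have "\<dots> = ennreal ((L2_norm \<Theta>)\<^sup>2)"
    using L2R_integrable_sq[OF \<Theta>] by (simp add: nn_integral_eq_integral L2_norm_sq)
  finally have "(\<integral>\<^sup>+u. period_sum T \<Theta> u \<partial>circ T) \<noteq> \<infinity>" by simp
  from nn_integral_PInf_AE[OF _ this] show ?thesis by simp
qed

text \<open>A Borel version of the squared Grammian; the two agree only where the series converges,
  that is, almost everywhere.\<close>

definition frft_weight :: "real \<Rightarrow> (real \<Rightarrow> complex) \<Rightarrow> real \<Rightarrow> real" where
  "frft_weight \<alpha> f u = 2 * pi * sin \<alpha> * enn2real (period_sum (2 * pi * sin \<alpha>) (frft \<alpha> f) u)"

lemma frft_weight_nonneg: "sin \<alpha> > 0 \<Longrightarrow> 0 \<le> frft_weight \<alpha> f u"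
  by (simp add: frft_weight_def)

lemma frft_weight_measurable:
  assumes "sin \<alpha> > 0" "f \<in> L2R"
  shows "frft_weight \<alpha> f \<in> borel_measurable borel"
proof -
  note [measurable] = L2R_measurable[OF frft_L2R[OF assms]]
  show ?thesis unfolding frft_weight_def by measurable
qed

lemma infsum_period_sum:
  assumes "period_sum T \<Theta> u \<noteq> top"
  shows "(\<Sum>\<^sub>\<infinity>k::int. (cmod (\<Theta> (u + of_int k * T)))\<^sup>2) = enn2real (period_sum T \<Theta> u)"
proof -
  let ?f = "\<lambda>k::int. (cmod (\<Theta> (u + of_int k * T)))\<^sup>2"
  have fin: "(\<Sum>n. ennreal (?f (int_decode n))) \<noteq> top" using assms by (simp add: period_sum_def)
  have s: "summable (\<lambda>n. ?f (int_decode n))"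
    by (rule summable_suminf_not_top[OF _ fin]) simp
  have "((\<lambda>n. ?f (int_decode n)) has_sum (\<Sum>n. ?f (int_decode n))) UNIV"
    by (rule norm_summable_imp_has_sum) (use s in \<open>auto simp: summable_sums\<close>)
  then have "infsum (\<lambda>n. ?f (int_decode n)) UNIV = (\<Sum>n. ?f (int_decode n))"
    by (rule infsumI)
  also have "infsum (\<lambda>n. ?f (int_decode n)) UNIV = infsum ?f UNIV"
    by (rule infsum_reindex_bij_betw[OF bij_int_decode])
  also have "(\<Sum>n. ?f (int_decode n)) = enn2real (period_sum T \<Theta> u)"
    unfolding period_sum_def using fin s by (subst suminf_ennreal) (auto simp: suminf_nonneg)
  finally show ?thesis .
qed

lemma AE_grammian_eq_weight:
  assumes s: "sin \<alpha> > 0" and f: "f \<in> L2R"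
  shows "AE u in circ (2 * pi * sin \<alpha>). (grammian \<alpha> f u)\<^sup>2 = frft_weight \<alpha> f u"
proof -
  have "AE u in circ (2 * pi * sin \<alpha>). period_sum (2 * pi * sin \<alpha>) (frft \<alpha> f) u \<noteq> top"
    using s by (intro AE_period_sum_finite frft_L2R f) auto
  then show ?thesis
  proof eventually_elim
    case (elim u)
    have "(\<Sum>\<^sub>\<infinity>k::int. (cmod (frft \<alpha> f (u + 2 * of_int k * pi * sin \<alpha>)))\<^sup>2) =
        enn2real (period_sum (2 * pi * sin \<alpha>) (frft \<alpha> f) u)"
      using infsum_period_sum[OF elim] by (simp add: mult_ac)
    then show ?case using s by (simp add: grammian_def frft_weight_def)
  qed
qed

lemma frft_mod_periodic:
  assumes "sin \<alpha> > 0"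
  shows "frft_mod \<alpha> n (u + of_int k * (2 * pi * sin \<alpha>)) = frft_mod \<alpha> n u"
proof -
  have "frft_mod \<alpha> n (u + of_int k * (2 * pi * sin \<alpha>)) =
      exp (\<i> * of_real ((of_int n)\<^sup>2 * cot \<alpha> / 2 - of_int n * u / sin \<alpha>) + of_int (2 * (- n * k)) * (of_real pi * \<i>))"
    unfolding frft_mod_def using assms
    by (intro arg_cong[where f=exp]) (simp add: field_simps)
  also have "\<dots> = frft_mod \<alpha> n u"
  proof -
    have "exp (of_int (2 * (- n * k)) * (of_real pi * \<i>)) = 1"
      unfolding exp_eq_1 by (auto intro!: exI[of _ "- n * k"])
    then show ?thesis unfolding exp_add frft_mod_def by simp
  qed
  finally show ?thesis .
qed

lemma integral_frft_weight:
  assumes s: "sin \<alpha> > 0" and f: "f \<in> L2R"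
    and q [measurable]: "q \<in> borel_measurable borel" and q0: "\<And>u. 0 \<le> q u" and qC: "\<And>u. q u \<le> C"
    and per: "\<And>u k. q (u + of_int k * (2 * pi * sin \<alpha>)) = q u"
  shows "integrable (circ (2 * pi * sin \<alpha>)) (\<lambda>u. q u * frft_weight \<alpha> f u)" (is ?I)
    and "(LINT u|circ (2 * pi * sin \<alpha>). q u * frft_weight \<alpha> f u) =
      2 * pi * sin \<alpha> * (LINT u|lborel. q u * (cmod (frft \<alpha> f u))\<^sup>2)"
proof -
  define T where "T = 2 * pi * sin \<alpha>"
  have T: "T > 0" using s by (simp add: T_def)
  define \<Theta> where "\<Theta> = frft \<alpha> f"
  have \<Theta>: "\<Theta> \<in> L2R" unfolding \<Theta>_def by (rule frft_L2R[OF s f])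
  note [measurable] = L2R_measurable[OF \<Theta>] frft_weight_measurable[OF s f]
  have "integrable lborel (\<lambda>u. C * (cmod (\<Theta> u))\<^sup>2)" using L2R_integrable_sq[OF \<Theta>] by simp
  then have int: "integrable lborel (\<lambda>u. q u * (cmod (\<Theta> u))\<^sup>2)"
    by (rule Bochner_Integration.integrable_bound)
      (auto intro!: AE_I2 mult_right_mono simp: abs_mult q0 order_trans[OF qC abs_ge_self])
  have "(\<integral>\<^sup>+u. ennreal (q u * frft_weight \<alpha> f u) \<partial>circ T) = (\<integral>\<^sup>+u. ennreal T * (ennreal (q u) * period_sum T \<Theta> u) \<partial>circ T)"
  proof (rule nn_integral_cong_AE, use AE_period_sum_finite[OF \<Theta> T] in eventually_elim)
    fix u assume "period_sum T \<Theta> u \<noteq> top"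
    then obtain r where r: "0 \<le> r" "period_sum T \<Theta> u = ennreal r" by (cases "period_sum T \<Theta> u") auto
    have "frft_weight \<alpha> f u = T * enn2real (period_sum T \<Theta> u)"
      by (simp add: frft_weight_def T_def \<Theta>_def)
    then show "ennreal (q u * frft_weight \<alpha> f u) = ennreal T * (ennreal (q u) * period_sum T \<Theta> u)"
      using T q0[of u] r by (simp add: mult_ac flip: ennreal_mult)
  qed
  also have "\<dots> = ennreal T * (\<integral>\<^sup>+u. ennreal (q u) * period_sum T \<Theta> u \<partial>circ T)"
    by (rule nn_integral_cmult) measurable
  also have "(\<integral>\<^sup>+u. ennreal (q u) * period_sum T \<Theta> u \<partial>circ T) = (\<integral>\<^sup>+u. ennreal (q u) * ennreal ((cmod (\<Theta> u))\<^sup>2) \<partial>lborel)"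
    by (rule nn_integral_period_sum[OF \<Theta> T, symmetric]) (use per in \<open>auto simp: T_def\<close>)
  also have "\<dots> = ennreal (LINT u|lborel. q u * (cmod (\<Theta> u))\<^sup>2)"
    using int by (simp add: q0 nn_integral_eq_integral flip: ennreal_mult)
  finally have eq: "(\<integral>\<^sup>+u. ennreal (q u * frft_weight \<alpha> f u) \<partial>circ T) = ennreal (T * (LINT u|lborel. q u * (cmod (\<Theta> u))\<^sup>2))"
    using T q0 by (simp add: ennreal_mult integral_nonneg_AE)
  show ?I unfolding T_def[symmetric]
  proof (rule integrableI_nonneg)
    show "AE u in circ T. 0 \<le> q u * frft_weight \<alpha> f u" using q0 frft_weight_nonneg[OF s] by simp
  qed (use eq in auto)
  show "(LINT u|circ (2 * pi * sin \<alpha>). q u * frft_weight \<alpha> f u) =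
      2 * pi * sin \<alpha> * (LINT u|lborel. q u * (cmod (frft \<alpha> f u))\<^sup>2)"
    unfolding T_def[symmetric] \<Theta>_def[symmetric]
    by (subst integral_eq_nn_integral) (use eq q0 frft_weight_nonneg[OF s] T in \<open>auto simp: integral_nonneg_AE\<close>)
qed

lemma frft_weight_integrable:
  assumes "sin \<alpha> > 0" "f \<in> L2R"
  shows "integrable (circ (2 * pi * sin \<alpha>)) (frft_weight \<alpha> f)"
  using integral_frft_weight(1)[OF assms, of "\<lambda>_. 1" 1] by simp

text \<open>Periodization with the periodic factor |P|^2. The period on the left comes from the
  factor that \<open>frft_weight\<close> shares with the squared Grammian.\<close>

lemma L2_norm_sum_weight:
  assumes s: "sin \<alpha> > 0" and f: "f \<in> L2R" and S: "finite S"
  shows "2 * pi * sin \<alpha> * (L2_norm (\<lambda>t. \<Sum>n\<in>S. c n * chirp_shift \<alpha> f n t))\<^sup>2 =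
    (LINT u|circ (2 * pi * sin \<alpha>). (cmod (\<Sum>n\<in>S. c n * frft_mod \<alpha> n u))\<^sup>2 * frft_weight \<alpha> f u)"
proof -
  have "(LINT u|circ (2 * pi * sin \<alpha>). (cmod (\<Sum>n\<in>S. c n * frft_mod \<alpha> n u))\<^sup>2 * frft_weight \<alpha> f u) =
      2 * pi * sin \<alpha> * (LINT u|lborel. (cmod (\<Sum>n\<in>S. c n * frft_mod \<alpha> n u))\<^sup>2 * (cmod (frft \<alpha> f u))\<^sup>2)"
  proof (rule integral_frft_weight(2)[OF s f])
    show "(cmod (\<Sum>n\<in>S. c n * frft_mod \<alpha> n u))\<^sup>2 \<le> (\<Sum>n\<in>S. cmod (c n))\<^sup>2" for u
      by (intro power_mono order_trans[OF norm_sum]) (simp_all add: norm_mult)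
  qed (simp_all add: frft_mod_periodic[OF s])
  then show ?thesis
    by (simp add: L2_norm_sum_chirp_shift[OF s f S] L2_norm_sq norm_mult power_mult_distrib)
qed

subsection \<open>Trigonometric sums\<close>

lemma finite_measure_circ: "finite_measure (circ T)"
proof
  have "emeasure (circ T) (space (circ T)) = emeasure lborel {0..T}"
    by (subst emeasure_restrict_space) (auto simp: space_restrict_space)
  also have "\<dots> < \<infinity>" using emeasure_lborel_Icc_eq[of 0 T] by (simp add: ennreal_less_top)
  finally show "emeasure (circ T) (space (circ T)) \<noteq> \<infinity>" by simp
qed

lemma circ_integrable_bounded:
  fixes f :: "real \<Rightarrow> 'a :: {banach, second_countable_topology}"
  assumes "f \<in> borel_measurable borel" "AE u in circ T. norm (f u) \<le> C"
  shows "integrable (circ T) f"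
proof -
  interpret finite_measure "circ T" by (rule finite_measure_circ)
  show ?thesis using integrable_const_bound[OF assms(2)] borel_measurable_circ[OF assms(1)] by blast
qed

lemma AE_circ_iff: "(AE u in circ T. P u) \<longleftrightarrow> (AE u in lborel. u \<in> {0..T} \<longrightarrow> P u)"
  by (rule AE_restrict_space_iff) simp

lemma AE_circ_interior:
  fixes T :: real
  shows "AE u in circ T. u \<in> {0<..<T}"
proof -
  have "AE u in lborel. u \<noteq> 0 \<and> u \<noteq> (T :: real)"
    using AE_lborel_singleton[of 0] AE_lborel_singleton[of T] by (auto elim: AE_mp)
  then show ?thesis unfolding AE_circ_iff by eventually_elim auto
qed

text \<open>Inner regularity gives a closed subset, which is compact because A is bounded.
  Compactness is what \<open>trig_approx_indicator\<close> asks for.\<close>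

lemma circ_inner_compact:
  fixes T :: real
  assumes A: "A \<in> sets borel" "A \<subseteq> {0..T}" and pos: "emeasure lborel A \<noteq> 0"
  obtains K where "compact K" "K \<subseteq> A" "measure lborel K > 0"
proof -
  have fin: "emeasure lborel A < \<infinity>"
    using emeasure_mono[OF A(2), of lborel] emeasure_lborel_Icc_eq[of 0 T]
    by (auto simp: less_top[symmetric] top_unique)
  have mpos: "measure lborel B > 0" if "emeasure lborel B \<noteq> 0" "emeasure lborel B < \<infinity>" for B :: "real set"
    using that emeasure_eq_ennreal_measure[of lborel B] measure_nonneg[of lborel B]
    by (metis ennreal_0 infinity_ennreal_def less_irrefl order_le_less)
  have m: "measure lborel A > 0" "emeasure lborel A = ennreal (measure lborel A)"
    using mpos[OF pos fin] emeasure_eq_ennreal_measure[of lborel A] fin by simp_all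
  \<comment> \<open>Losing less than the whole measure of A is enough for K to keep positive
    measure.\<close>
  obtain K where K: "closed K" "K \<subseteq> A" "emeasure lebesgue (A - K) < ennreal (measure lborel A)"
  proof (rule sets_lebesgue_inner_closed)
    show "A \<in> sets lebesgue" using A(1) by simp
  qed (use m(1) in blast)+
  have [measurable]: "K \<in> sets borel" using K(1) by simp
  have less: "emeasure lborel (A - K) < emeasure lborel A"
    using K(3) A(1) m(2) by simp
  have bK: "bounded K" using K(2) A(2) bounded_subset[OF bounded_closed_interval] by blast
  have "emeasure lborel K \<noteq> 0"
  proof
    assume "emeasure lborel K = 0"
    moreover have "emeasure lborel A \<le> emeasure lborel K + emeasure lborel (A - K)"
      using emeasure_subadditive[of K lborel "A - K"] A(1) K(2) by (simp add: Un_absorb1)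
    ultimately show False using less by (simp add: not_less[symmetric])
  qed
  moreover have "emeasure lborel K < \<infinity>"
    using emeasure_mono[OF K(2), of lborel] fin A(1) by (auto intro: le_less_trans)
  ultimately have "measure lborel K > 0" by (rule mpos)
  with K(1,2) bK show ?thesis by (intro that[of K]) (auto simp: compact_eq_bounded_closed)
qed

section \<open>Orthogonality, Parseval and Bessel on one period\<close>

context
  fixes \<alpha> :: real
  assumes sin_pos: "sin \<alpha> > 0"
begin

abbreviation period :: real where "period \<equiv> 2 * pi * sin \<alpha>"

lemma period_pos: "period > 0" using sin_pos by simp

lemma integral_circ_iexp:
  assumes k: "k \<noteq> 0"
  shows "(LINT u|circ period. iexp (of_int k * u / sin \<alpha>)) = 0"
proof -
  let ?a = "of_int k / sin \<alpha>"
  have a: "?a \<noteq> 0" using k sin_pos by simp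
  let ?F = "\<lambda>u. iexp (?a * u) / (\<i> * of_real ?a)"
  have "(LINT u|circ period. iexp (of_int k * u / sin \<alpha>)) = (LINT u|lborel. indicator {0..period} u *\<^sub>R iexp (?a * u))"
    by (subst integral_restrict_space) simp_all
  also have "\<dots> = ?F period - ?F 0"
  proof (rule integral_FTC_Icc)
    show "(?F has_vector_derivative iexp (?a * x)) (at x within {0..period})" for x
    proof -
      have "((\<lambda>z. exp (\<i> * of_real ?a * z) / (\<i> * of_real ?a)) has_field_derivative exp (\<i> * of_real ?a * of_real x)) (at (of_real x))"
        using a by (auto intro!: derivative_eq_intros)
      from has_vector_derivative_real_field[OF this]
      have "(?F has_vector_derivative iexp (?a * x)) (at x)"
        by (simp add: mult.assoc)
      then show ?thesis by (rule has_vector_derivative_at_within)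
    qed
    show "continuous_on {0..period} (\<lambda>u. iexp (?a * u))" by (intro continuous_intros)
  qed (use period_pos in simp)
  also have "iexp (?a * period) = 1"
    unfolding exp_eq_1 using sin_pos by (auto intro!: exI[of _ k])
  finally show ?thesis by simp
qed

lemma frft_mod_orthogonal:
  "(LINT u|circ period. frft_mod \<alpha> n u * cnj (frft_mod \<alpha> m u)) = (if n = m then of_real period else 0)"
proof (cases "n = m")
  case True
  have "frft_mod \<alpha> n u * cnj (frft_mod \<alpha> n u) = 1" for u
    using complex_norm_square[of "frft_mod \<alpha> n u"] by simp
  moreover have "(LINT u|circ period. (1 :: complex)) = of_real period"
    using period_pos by (subst lebesgue_integral_const)
      (simp add: measure_restrict_space space_restrict_space scaleR_conv_of_real)
  ultimately show ?thesis using True by simp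
next
  case False
  have "frft_mod \<alpha> n u * cnj (frft_mod \<alpha> m u) =
     iexp (((of_int n)\<^sup>2 - (of_int m)\<^sup>2) * cot \<alpha> / 2) * iexp (of_int (m - n) * u / sin \<alpha>)" for u
    unfolding frft_mod_def exp_cnj exp_add[symmetric]
    by (rule arg_cong[where f=exp]) (simp add: algebra_simps add_divide_distrib diff_divide_distrib)
  then show ?thesis
    using integral_circ_iexp[of "m - n"] False by simp
qed

abbreviation trig_sum :: "int set \<Rightarrow> (int \<Rightarrow> complex) \<Rightarrow> real \<Rightarrow> complex" where
  "trig_sum S c u \<equiv> (\<Sum>n\<in>S. c n * frft_mod \<alpha> n u)"

text \<open>Divided by the period because the functions \<open>frft_mod\<close> have squared norm
  \<open>period\<close> here; in this way \<open>fcoeff\<close> recovers the coefficients of a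
  \<open>trig_sum\<close>.\<close>

definition fcoeff :: "(real \<Rightarrow> complex) \<Rightarrow> int \<Rightarrow> complex" where
  "fcoeff h n = (LINT u|circ period. h u * cnj (frft_mod \<alpha> n u)) / of_real period"

lemma trig_sum_bound: "cmod (trig_sum S c u) \<le> (\<Sum>n\<in>S. cmod (c n))"
  by (rule order_trans[OF norm_sum]) (simp add: norm_mult)

lemma integral_mult_cnj_trig_sum:
  assumes [measurable]: "h \<in> borel_measurable borel" and h: "AE u in circ period. cmod (h u) \<le> C"
  shows "(LINT u|circ period. h u * cnj (trig_sum S c u)) = of_real period * (\<Sum>n\<in>S. cnj (c n) * fcoeff h n)"
proof -
  have int: "integrable (circ period) (\<lambda>u. cnj (c n) * (h u * cnj (frft_mod \<alpha> n u)))" for n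
    by (intro integrable_mult_right circ_integrable_bounded[where C=C])
      (measurable, use h in \<open>simp add: norm_mult\<close>)
  have "(LINT u|circ period. h u * cnj (trig_sum S c u)) =
      (LINT u|circ period. (\<Sum>n\<in>S. cnj (c n) * (h u * cnj (frft_mod \<alpha> n u))))"
    by (simp add: sum_distrib_left mult_ac)
  also have "\<dots> = (\<Sum>n\<in>S. cnj (c n) * (LINT u|circ period. h u * cnj (frft_mod \<alpha> n u)))"
    using int by (simp add: Bochner_Integration.integral_sum)
  finally show ?thesis
    using sin_pos by (simp add: fcoeff_def sum_distrib_left)
qed

lemma fcoeff_trig_sum:
  assumes "finite S"
  shows "fcoeff (trig_sum S c) n = (if n \<in> S then c n else 0)"
proof -
  have int: "integrable (circ period) (\<lambda>u. c m * (frft_mod \<alpha> m u * cnj (frft_mod \<alpha> n u)))" for m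
    by (intro integrable_mult_right circ_integrable_bounded[where C=1])
      (measurable, simp add: norm_mult)
  have "(LINT u|circ period. trig_sum S c u * cnj (frft_mod \<alpha> n u)) =
      (LINT u|circ period. (\<Sum>m\<in>S. c m * (frft_mod \<alpha> m u * cnj (frft_mod \<alpha> n u))))"
    by (simp add: sum_distrib_right mult.assoc)
  also have "\<dots> = (\<Sum>m\<in>S. c m * (LINT u|circ period. frft_mod \<alpha> m u * cnj (frft_mod \<alpha> n u)))"
    using int by (simp add: Bochner_Integration.integral_sum)
  also have "\<dots> = of_real period * (if n \<in> S then c n else 0)"
    unfolding frft_mod_orthogonal using assms by (simp add: if_distrib sum.delta cong: if_cong)
  finally show ?thesis using sin_pos by (simp add: fcoeff_def)
qed

lemma trig_sum_Parseval:
  assumes S: "finite S"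
  shows "(LINT u|circ period. (cmod (trig_sum S c u))\<^sup>2) = period * (\<Sum>n\<in>S. (cmod (c n))\<^sup>2)"
proof -
  have "complex_of_real (LINT u|circ period. (cmod (trig_sum S c u))\<^sup>2) =
      (LINT u|circ period. trig_sum S c u * cnj (trig_sum S c u))"
    unfolding complex_norm_square[symmetric] by (rule integral_complex_of_real[symmetric])
  also have "\<dots> = of_real period * (\<Sum>n\<in>S. cnj (c n) * fcoeff (trig_sum S c) n)"
    by (rule integral_mult_cnj_trig_sum[where C="\<Sum>n\<in>S. cmod (c n)"])
      (measurable, use trig_sum_bound in simp)
  also have "\<dots> = of_real period * (\<Sum>n\<in>S. of_real ((cmod (c n))\<^sup>2))"
    unfolding complex_norm_square fcoeff_trig_sum[OF S]
    by (rule arg_cong[where f="\<lambda>x. of_real period * x"], rule sum.cong) (simp_all add: mult.commute)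
  also have "\<dots> = complex_of_real (period * (\<Sum>n\<in>S. (cmod (c n))\<^sup>2))" by simp
  finally show ?thesis by (simp only: of_real_eq_iff)
qed

text \<open>Expand the square and complete it in each coefficient. The last term vanishes exactly
  for the Fourier coefficients, which gives Bessel's inequality and the optimality of Fourier
  partial sums.\<close>

lemma trig_sum_distance:
  assumes [measurable]: "h \<in> borel_measurable borel" and h: "AE u in circ period. cmod (h u) \<le> C"
    and S: "finite S"
  shows "(LINT u|circ period. (cmod (h u - trig_sum S c u))\<^sup>2) =
    (LINT u|circ period. (cmod (h u))\<^sup>2) - period * (\<Sum>n\<in>S. (cmod (fcoeff h n))\<^sup>2)
      + period * (\<Sum>n\<in>S. (cmod (c n - fcoeff h n))\<^sup>2)"
proof -
  let ?P = "trig_sum S c"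
  have sq: "(cmod (a - b))\<^sup>2 = (cmod a)\<^sup>2 - 2 * Re (a * cnj b) + (cmod b)\<^sup>2" for a b
    by (simp add: cmod_power2) (simp add: power2_eq_square algebra_simps)
  have lin: "(LINT u|circ period. a u - 2 * b u + d u) =
      (LINT u|circ period. a u) - 2 * (LINT u|circ period. b u) + (LINT u|circ period. d u)"
    if "integrable (circ period) a" "integrable (circ period) b" "integrable (circ period) d"
    for a b d :: "real \<Rightarrow> real"
    using that by simp
  have i1: "integrable (circ period) (\<lambda>u. (cmod (h u))\<^sup>2)"
    by (rule circ_integrable_bounded[where C="C\<^sup>2"]) (measurable, use h in eventually_elim, simp add: power_mono)
  have i2: "integrable (circ period) (\<lambda>u. (cmod (?P u))\<^sup>2)"
    by (rule circ_integrable_bounded[where C="(\<Sum>n\<in>S. cmod (c n))\<^sup>2"])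
      (measurable, use trig_sum_bound in \<open>simp add: power_mono\<close>)
  have i3: "integrable (circ period) (\<lambda>u. h u * cnj (?P u))"
  proof (rule circ_integrable_bounded[where C="C * (\<Sum>n\<in>S. cmod (c n))"])
    show "AE u in circ period. norm (h u * cnj (?P u)) \<le> C * (\<Sum>n\<in>S. cmod (c n))"
      using h
    proof eventually_elim
      case (elim u)
      then show ?case
        using mult_mono[OF elim trig_sum_bound] order_trans[OF norm_ge_zero elim]
        by (simp only: norm_mult complex_mod_cnj norm_ge_zero)
    qed
  qed measurable
  have "(LINT u|circ period. (cmod (h u - ?P u))\<^sup>2) =
     (LINT u|circ period. (cmod (h u))\<^sup>2) - 2 * Re (LINT u|circ period. h u * cnj (?P u))
      + (LINT u|circ period. (cmod (?P u))\<^sup>2)"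
    unfolding sq integral_Re[OF i3, symmetric] by (rule lin[OF i1 integrable_Re[OF i3] i2])
  also have "\<dots> = (LINT u|circ period. (cmod (h u))\<^sup>2) +
      period * ((\<Sum>n\<in>S. (cmod (c n))\<^sup>2) - 2 * Re (\<Sum>n\<in>S. cnj (c n) * fcoeff h n))"
    unfolding trig_sum_Parseval[OF S] integral_mult_cnj_trig_sum[OF assms(1) h]
    by (simp add: algebra_simps del: Re_sum)
  also have "(\<Sum>n\<in>S. (cmod (c n))\<^sup>2) - 2 * Re (\<Sum>n\<in>S. cnj (c n) * fcoeff h n) =
      (\<Sum>n\<in>S. (cmod (c n - fcoeff h n))\<^sup>2) - (\<Sum>n\<in>S. (cmod (fcoeff h n))\<^sup>2)"
  proof -
    have "(cmod (c n))\<^sup>2 - 2 * Re (cnj (c n) * fcoeff h n) = (cmod (c n - fcoeff h n))\<^sup>2 - (cmod (fcoeff h n))\<^sup>2" for n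
      unfolding sq by (simp add: mult.commute)
    then show ?thesis
      unfolding Re_sum sum_distrib_left sum_subtractf[symmetric] by (intro sum.cong) auto
  qed
  finally show ?thesis by (simp add: algebra_simps)
qed

lemma Bessel:
  assumes "h \<in> borel_measurable borel" "AE u in circ period. cmod (h u) \<le> C" "finite S"
  shows "period * (\<Sum>n\<in>S. (cmod (fcoeff h n))\<^sup>2) \<le> (LINT u|circ period. (cmod (h u))\<^sup>2)"
proof -
  have "0 \<le> (LINT u|circ period. (cmod (h u - trig_sum S (fcoeff h) u))\<^sup>2)"
    by (rule integral_nonneg_AE) simp
  then show ?thesis unfolding trig_sum_distance[OF assms] by simp
qed

section \<open>Trigonometric polynomials and the approximation of indicators\<close>

inductive trig_poly :: "(real \<Rightarrow> complex) \<Rightarrow> bool" where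
  mono: "trig_poly (\<lambda>u. a * iexp (of_int n * u / sin \<alpha>))"
| add: "trig_poly f \<Longrightarrow> trig_poly g \<Longrightarrow> trig_poly (\<lambda>u. f u + g u)"

text \<open>Products enter through the polynomials of Stone-Weierstrass. Plain characters are closed
  under multiplication up to scalars with frequencies adding; the quadratic phases of
  \<open>frft_mod\<close> would not combine so simply. The phases return in
  \<open>trig_poly_sum\<close>.\<close>

lemma trig_poly_mult:
  assumes "trig_poly f" "trig_poly g"
  shows "trig_poly (\<lambda>u. f u * g u)"
  using assms(1)
proof induction
  case (mono a n)
  from assms(2) show ?case
  proof induction
    case (mono b m)
    have "(\<lambda>u. a * iexp (of_int n * u / sin \<alpha>) * (b * iexp (of_int m * u / sin \<alpha>))) =
        (\<lambda>u. (a * b) * iexp (of_int (n + m) * u / sin \<alpha>))"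
    proof
      fix u
      have "iexp (of_int n * u / sin \<alpha>) * iexp (of_int m * u / sin \<alpha>) = iexp (of_int (n + m) * u / sin \<alpha>)"
        unfolding exp_add[symmetric] by (rule arg_cong[where f=exp]) (simp add: add_divide_distrib algebra_simps)
      then show "a * iexp (of_int n * u / sin \<alpha>) * (b * iexp (of_int m * u / sin \<alpha>)) =
          (a * b) * iexp (of_int (n + m) * u / sin \<alpha>)"
        by (metis (no_types, opaque_lifting) mult.assoc mult.left_commute)
    qed
    then show ?case by (simp only: trig_poly.mono)
  next
    case (add f g)
    then show ?case by (simp only: distrib_left trig_poly.add)
  qed
next
  case (add f g)
  then show ?case by (simp only: distrib_right trig_poly.add)
qed

lemma trig_poly_sum:
  assumes "trig_poly f"
  obtains S c where "finite S" "f = trig_sum S c"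
proof -
  from assms have "\<exists>S c. finite S \<and> f = trig_sum S c"
  proof induction
    case (mono a n)
    let ?g = "iexp ((of_int n)\<^sup>2 * cot \<alpha> / 2)"
    \<comment> \<open>The index is \<open>- n\<close> because \<open>frft_mod\<close> carries the
      frequency with a minus sign; dividing by \<open>?g\<close> removes its constant phase.\<close>
    have "(\<lambda>u. a * iexp (of_int n * u / sin \<alpha>)) = trig_sum {- n} (\<lambda>_. a / ?g)"
    proof
      fix u
      have "frft_mod \<alpha> (- n) u = ?g * iexp (of_int n * u / sin \<alpha>)"
        unfolding frft_mod_def exp_add[symmetric]
        by (rule arg_cong[where f=exp]) (simp add: algebra_simps)
      then show "a * iexp (of_int n * u / sin \<alpha>) = trig_sum {- n} (\<lambda>_. a / ?g) u" by simp
    qed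
    then show ?case by (intro exI[of _ "{- n}"] exI[of _ "\<lambda>_. a / ?g"] conjI finite.intros)
  next
    case (add f g)
    then obtain S c S' c' where S: "finite S" "f = trig_sum S c" and S': "finite S'" "g = trig_sum S' c'"
      by blast
    have "(\<lambda>u. f u + g u) = trig_sum (S \<union> S') (\<lambda>n. (if n \<in> S then c n else 0) + (if n \<in> S' then c' n else 0))"
    proof
      fix u
      have ext: "trig_sum A d u = (\<Sum>n\<in>S \<union> S'. (if n \<in> A then d n else 0) * frft_mod \<alpha> n u)"
        if "A \<subseteq> S \<union> S'" for A d
        by (rule sum.mono_neutral_cong_left) (use that S(1) S'(1) in auto)
      show "f u + g u = trig_sum (S \<union> S') (\<lambda>n. (if n \<in> S then c n else 0) + (if n \<in> S' then c' n else 0)) u"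
        unfolding S(2) S'(2) ext[OF Un_upper1] ext[OF Un_upper2] distrib_right sum.distrib ..
    qed
    with S(1) S'(1) show ?case
      by (intro exI[of _ "S \<union> S'"] exI[of _ "\<lambda>n. (if n \<in> S then c n else 0) + (if n \<in> S' then c' n else 0)"]
        conjI finite_UnI)
  qed
  then show ?thesis using that by blast
qed

text \<open>A real linear form on the complex plane is a combination of w and its conjugate, and on
  the unit circle these are the characters of frequency 1 and -1. Sums and products then follow by
  induction.\<close>

lemma trig_poly_real_polynomial:
  assumes "real_polynomial_function q"
  shows "trig_poly (\<lambda>u. of_real (q (iexp (u / sin \<alpha>))))"
  using assms
proof induction
  case (linear f)
  interpret f: bounded_linear f by fact
  have *: "of_real (f w) = (of_real (f 1) / 2 - \<i> * of_real (f \<i>) / 2) * w +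
     (of_real (f 1) / 2 + \<i> * of_real (f \<i>) / 2) * cnj w" for w
  proof -
    have "f w = f (Re w *\<^sub>R 1 + Im w *\<^sub>R \<i>)" by (rule arg_cong[where f=f]) (simp add: complex_eq_iff)
    also have "\<dots> = Re w * f 1 + Im w * f \<i>" by (simp only: f.add f.scaleR real_scaleR_def)
    finally show ?thesis by (simp add: complex_eq_iff field_simps)
  qed
  have c: "cnj (iexp (u / sin \<alpha>)) = iexp (of_int (- 1) * u / sin \<alpha>)" for u
    by (simp add: exp_cnj)
  have "(\<lambda>u. of_real (f (iexp (u / sin \<alpha>)))) = (\<lambda>u. (of_real (f 1) / 2 - \<i> * of_real (f \<i>) / 2) * iexp (of_int 1 * u / sin \<alpha>) +
     (of_real (f 1) / 2 + \<i> * of_real (f \<i>) / 2) * iexp (of_int (- 1) * u / sin \<alpha>))"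
    by (rule ext) (simp only: *[of "iexp _"] c, simp)
  then show ?case by (simp only: trig_poly.intros)
next
  case (const c)
  show ?case using trig_poly.mono[of "of_real c" 0] by simp
next
  case (add f g)
  then show ?case using trig_poly.add by simp
next
  case (mult f g)
  then show ?case using trig_poly_mult by simp
qed

text \<open>One of the points must be interior: 0 and the period map to the same point of the
  circle.\<close>

lemma iexp_inj_period:
  assumes "iexp (u / sin \<alpha>) = iexp (v / sin \<alpha>)" "u \<in> {0<..<period}" "v \<in> {0..period}"
  shows "u = v"
proof -
  obtain k :: int where "\<i> * of_real (u / sin \<alpha>) = \<i> * of_real (v / sin \<alpha>) + (of_int (2 * k) * pi) * \<i>"
    using assms(1) unfolding exp_eq by blast
  then have "\<i> * complex_of_real (u / sin \<alpha>) = \<i> * of_real (v / sin \<alpha> + 2 * k * pi)"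
    by (simp add: algebra_simps)
  then have "complex_of_real (u / sin \<alpha>) = of_real (v / sin \<alpha> + 2 * k * pi)"
    by (simp only: mult_cancel_left complex_i_not_zero simp_thms)
  then have "u / sin \<alpha> = v / sin \<alpha> + 2 * k * pi" by (simp only: of_real_eq_iff)
  then have uv: "u = v + k * period" using sin_pos by (simp add: field_simps)
  have "k = 0"
  proof (rule ccontr)
    assume "k \<noteq> 0"
    then have "k \<ge> 1 \<or> k \<le> -1" by linarith
    then show False
    proof
      assume "k \<ge> 1"
      then have "1 * period \<le> k * period" using period_pos by (intro mult_right_mono) auto
      then show False using uv assms(2,3) unfolding greaterThanLessThan_iff atLeastAtMost_iff by linarith
    next
      assume "k \<le> -1"
      then have "k * period \<le> (-1) * period" using period_pos by (intro mult_right_mono) auto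
      then show False using uv assms(2,3) unfolding greaterThanLessThan_iff atLeastAtMost_iff by linarith
    qed
  qed
  with uv show ?thesis by simp
qed

text \<open>K is moved to the unit circle, where its image K' is compact. Continuous functions
  supported ever closer to K' decrease to its indicator, and Stone-Weierstrass replaces them by
  polynomials. The uniform bound serves dominated convergence; the endpoints are left out because
  they are identified on the circle.\<close>

lemma trig_approx_indicator:
  assumes K: "compact K" "K \<subseteq> {0..period}" "K \<noteq> {}"
  obtains S c where "\<And>m. finite (S m)" "\<And>m u. cmod (trig_sum (S m) (c m) u) \<le> 2"
    "\<And>u. u \<in> {0<..<period} \<Longrightarrow> (\<lambda>m::nat. trig_sum (S m) (c m) u) \<longlonglongrightarrow> indicator K u"
proof -
  let ?z = "\<lambda>u::real. iexp (u / sin \<alpha>)"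
  define K' where "K' = ?z ` K"
  have "compact K'" unfolding K'_def
    by (intro compact_continuous_image K continuous_intros) (use sin_pos in auto)
  then have cl: "closed K'" and ne: "K' \<noteq> {}" using K(3) by (auto simp: K'_def compact_imp_closed)
  \<comment> \<open>Equal to 1 on K' and to 0 as soon as m times the distance to K' reaches 1. The
    approximation error 1 / (m + 1) adds at most 1 to the bound, hence the 2.\<close>
  define q where "q = (\<lambda>(m::nat) w. max 0 (1 - real m * infdist w K'))"
  have q01: "0 \<le> q m w" "q m w \<le> 1" for m w by (auto simp: q_def infdist_nonneg)
  have "\<exists>g. real_polynomial_function g \<and> (\<forall>w\<in>sphere 0 1. \<bar>q m w - g w\<bar> < 1 / (real m + 1))" for m
  proof -
    have "continuous_on (sphere 0 1) (q m)" unfolding q_def by (intro continuous_intros)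
    from Stone_Weierstrass_real_polynomial_function[OF compact_sphere this, of "1 / (real m + 1)"]
    show ?thesis by (metis divide_pos_pos zero_less_one of_nat_0_le_iff add_nonneg_pos)
  qed
  then obtain g where g: "\<And>m. real_polynomial_function (g m)"
    "\<And>m w. w \<in> sphere 0 1 \<Longrightarrow> \<bar>q m w - g m w\<bar> < 1 / (real m + 1)" by metis
  have "\<exists>S c. finite S \<and> (\<lambda>u. of_real (g m (?z u))) = trig_sum S c" for m
    using trig_poly_sum[OF trig_poly_real_polynomial[OF g(1)]] by metis
  then obtain S c where S: "\<And>m. finite (S m)" "\<And>m. (\<lambda>u. of_real (g m (?z u))) = trig_sum (S m) (c m)"
    by metis
  have eq: "trig_sum (S m) (c m) u = of_real (g m (?z u))" for m u
    using fun_cong[OF S(2)] by simp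
  have close: "\<bar>q m (?z u) - g m (?z u)\<bar> < 1 / (real m + 1)" for m u
    by (rule g(2)) simp
  have bound: "\<bar>g m (?z u)\<bar> \<le> 2" for m u
  proof -
    have "1 / (real m + 1) \<le> 1" by simp
    then show ?thesis using close[of m u] q01[of m "?z u"] by linarith
  qed
  have lim: "(\<lambda>m. trig_sum (S m) (c m) u) \<longlonglongrightarrow> indicator K u" if u: "u \<in> {0<..<period}" for u
  proof -
    have memb: "?z u \<in> K' \<longleftrightarrow> u \<in> K"
      using iexp_inj_period[OF _ u] K(2) by (auto simp: K'_def)
    have "(\<lambda>m. q m (?z u)) \<longlonglongrightarrow> indicator K u"
    proof (cases "u \<in> K")
      case True
      then have "infdist (?z u) K' = 0" using memb by simp
      then show ?thesis using True by (simp add: q_def)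
    next
      case False
      then have d: "0 < infdist (?z u) K'"
        using memb in_closed_iff_infdist_zero[OF cl ne] infdist_nonneg[of "?z u" K'] by fastforce
      obtain M :: nat where M: "1 / infdist (?z u) K' \<le> real M" using real_arch_simple by blast
      have "q m (?z u) = 0" if "m \<ge> M" for m
      proof -
        have "1 / infdist (?z u) K' \<le> real m" using M that by linarith
        then show ?thesis using d by (simp add: q_def pos_divide_le_eq)
      qed
      then have "\<forall>\<^sub>F m in sequentially. q m (?z u) = indicator K u"
        using False by (auto simp: eventually_sequentially)
      then show ?thesis by (rule tendsto_eventually)
    qed
    moreover have "(\<lambda>m. g m (?z u) - q m (?z u)) \<longlonglongrightarrow> 0"
    proof (rule Lim_null_comparison)
      show "(\<lambda>m. 1 / (real m + 1)) \<longlonglongrightarrow> 0"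
        using LIMSEQ_inverse_real_of_nat by (simp add: inverse_eq_divide add.commute)
      show "\<forall>\<^sub>F m in sequentially. norm (g m (?z u) - q m (?z u)) \<le> 1 / (real m + 1)"
        using close[of _ u] by (intro always_eventually allI) (simp add: abs_minus_commute less_imp_le)
    qed
    ultimately have "(\<lambda>m. q m (?z u) + (g m (?z u) - q m (?z u))) \<longlonglongrightarrow> indicator K u + 0"
      by (rule tendsto_add)
    then have "(\<lambda>m. g m (?z u)) \<longlonglongrightarrow> indicator K u" by simp
    then have "(\<lambda>m. complex_of_real (g m (?z u))) \<longlonglongrightarrow> of_real (indicator K u)" by (rule tendsto_of_real)
    then show ?thesis unfolding eq by (cases "u \<in> K") simp_all
  qed
  show ?thesis
    by (rule that[OF S(1) _ lim]) (use bound in \<open>simp add: eq\<close>)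
qed

text \<open>If v were negative on a set of positive measure, it would be uniformly negative on a
  compact K of positive measure. Trigonometric sums tending to the indicator of K then force the
  integral of v over K to be nonnegative, a contradiction.\<close>

lemma AE_nonneg_of_trig_sums:
  assumes v [measurable]: "v \<in> borel_measurable borel" and int: "integrable (circ period) v"
    and nonneg: "\<And>S c. finite S \<Longrightarrow> 0 \<le> (LINT u|circ period. (cmod (trig_sum S c u))\<^sup>2 * v u)"
  shows "AE u in circ period. 0 \<le> v u"
proof (rule ccontr)
  assume neg: "\<not> (AE u in circ period. 0 \<le> v u)"
  \<comment> \<open>Countably many level sets exhaust the set where v < 0, so one of them is not
    null.\<close>
  define A where "A = (\<lambda>k::nat. {u \<in> {0..period}. v u \<le> - 1 / (real k + 1)})"
  have A [measurable]: "A k \<in> sets borel" for k unfolding A_def by measurable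
  have "\<exists>k. emeasure lborel (A k) \<noteq> 0"
  proof (rule ccontr)
    assume "\<nexists>k. emeasure lborel (A k) \<noteq> 0"
    then have "AE u in lborel. u \<notin> A k" for k by (intro AE_not_in) (auto simp: null_sets_def)
    then have "AE u in lborel. \<forall>k. u \<notin> A k" by (simp add: AE_all_countable)
    then have "AE u in circ period. 0 \<le> v u" unfolding AE_circ_iff
    proof eventually_elim
      case (elim u)
      show ?case
      proof (intro impI, rule ccontr)
        assume "u \<in> {0..period}" "\<not> 0 \<le> v u"
        moreover obtain k :: nat where "inverse (real (Suc k)) < - v u"
          using reals_Archimedean[of "- v u"] \<open>\<not> 0 \<le> v u\<close> by auto
        ultimately have "u \<in> A k" by (simp add: A_def inverse_eq_divide add.commute)
        then show False using elim by blast
      qed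
    qed
    with neg show False by simp
  qed
  then obtain k where k: "emeasure lborel (A k) \<noteq> 0" by blast
  obtain K where K: "compact K" "K \<subseteq> A k" "measure lborel K > 0"
  proof (rule circ_inner_compact[OF A _ k])
    show "A k \<subseteq> {0..period}" by (auto simp: A_def)
  qed blast
  have K0: "K \<subseteq> {0..period}" "K \<noteq> {}" using K by (auto simp: A_def)
  have [measurable]: "K \<in> sets borel" using K(1) by (simp add: borel_compact)
  obtain S c where S: "\<And>m. finite (S m)" "\<And>m u. cmod (trig_sum (S m) (c m) u) \<le> 2"
    "\<And>u. u \<in> {0<..<period} \<Longrightarrow> (\<lambda>m::nat. trig_sum (S m) (c m) u) \<longlonglongrightarrow> indicator K u"
    using trig_approx_indicator[OF K(1) K0] by blast
  \<comment> \<open>The majorant 4|v| comes from the bound 2 on the trigonometric sums.\<close>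
  have "(\<lambda>m. LINT u|circ period. (cmod (trig_sum (S m) (c m) u))\<^sup>2 * v u) \<longlonglongrightarrow> (LINT u|circ period. indicator K u * v u)"
  proof (rule integral_dominated_convergence[where w="\<lambda>u. 4 * \<bar>v u\<bar>"])
    show "integrable (circ period) (\<lambda>u. 4 * \<bar>v u\<bar>)" using int by simp
    show "AE u in circ period. (\<lambda>m. (cmod (trig_sum (S m) (c m) u))\<^sup>2 * v u) \<longlonglongrightarrow> indicator K u * v u"
      using AE_circ_interior
    proof eventually_elim
      case (elim u)
      have "(\<lambda>m. (cmod (trig_sum (S m) (c m) u))\<^sup>2 * v u) \<longlonglongrightarrow> (cmod (indicator K u))\<^sup>2 * v u"
        by (intro tendsto_intros S(3) elim)
      then show ?case by (cases "u \<in> K") simp_all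
    qed
    show "AE u in circ period. norm ((cmod (trig_sum (S m) (c m) u))\<^sup>2 * v u) \<le> 4 * \<bar>v u\<bar>" for m
    proof (rule AE_I2)
      fix u
      have "(cmod (trig_sum (S m) (c m) u))\<^sup>2 \<le> 2\<^sup>2" by (rule power_mono[OF S(2)]) simp
      then show "norm ((cmod (trig_sum (S m) (c m) u))\<^sup>2 * v u) \<le> 4 * \<bar>v u\<bar>"
        by (simp add: abs_mult mult_right_mono)
    qed
  qed measurable
  then have "0 \<le> (LINT u|circ period. indicator K u * v u)"
    by (rule LIMSEQ_le_const) (use nonneg S(1) in auto)
  also have "\<dots> \<le> (LINT u|circ period. (- 1 / (real k + 1)) * indicator K u)"
  proof (rule integral_mono)
    show "integrable (circ period) (\<lambda>u. indicator K u * v u)"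
      by (rule Bochner_Integration.integrable_bound[OF int]) (measurable, simp add: indicator_def)
    show "integrable (circ period) (\<lambda>u. (- 1 / (real k + 1)) * indicator K u)"
      by (rule circ_integrable_bounded[where C=1]) (auto simp: indicator_def divide_le_eq)
    show "indicator K u * v u \<le> (- 1 / (real k + 1)) * indicator K u" for u
      using K(2) by (auto simp: indicator_def A_def)
  qed
  also have "\<dots> = (- 1 / (real k + 1)) * measure lborel K"
    using K0(1) by (subst integral_mult_right_zero)
      (simp add: measure_restrict_space space_restrict_space Int_absorb2)
  also have "\<dots> < 0" using K(3) by (simp add: mult_pos_pos)
  finally show False by simp
qed

end

subsection \<open>Riesz sequences\<close>

lemma cmod_sum_Cauchy_Schwarz:
  "(cmod (\<Sum>n\<in>S. cnj (c n) * x n))\<^sup>2 \<le> (\<Sum>n\<in>S. (cmod (c n))\<^sup>2) * (\<Sum>n\<in>S. (cmod (x n))\<^sup>2)"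
proof -
  have "cmod (\<Sum>n\<in>S. cnj (c n) * x n) \<le> (\<Sum>n\<in>S. cmod (c n) * cmod (x n))"
    by (rule order_trans[OF norm_sum]) (simp add: norm_mult)
  then have "(cmod (\<Sum>n\<in>S. cnj (c n) * x n))\<^sup>2 \<le> (\<Sum>n\<in>S. cmod (c n) * cmod (x n))\<^sup>2"
    by (rule power_mono) simp
  also have "\<dots> \<le> (\<Sum>n\<in>S. (cmod (c n))\<^sup>2) * (\<Sum>n\<in>S. (cmod (x n))\<^sup>2)"
    by (rule Cauchy_Schwarz_ineq_sum)
  finally show ?thesis .
qed

lemma ell2_I:
  assumes "\<And>S. finite S \<Longrightarrow> (\<Sum>n\<in>S. (cmod (c n))\<^sup>2) \<le> C"
  shows "c \<in> ell2"
  unfolding ell2_def mem_Collect_eq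
  by (rule nonneg_bdd_above_summable_on) (use assms in \<open>auto intro!: bdd_aboveI2\<close>)

lemma ell2_bound:
  assumes "c \<in> ell2" "finite S"
  shows "(\<Sum>n\<in>S. (cmod (c n))\<^sup>2) \<le> (\<Sum>\<^sub>\<infinity>n. (cmod (c n))\<^sup>2)"
  using assms by (intro finite_sum_le_infsum) (auto simp: ell2_def)

lemma ell2_add:
  assumes c: "c \<in> ell2" and d: "d \<in> ell2"
  shows "(\<lambda>n. c n + d n) \<in> ell2"
proof (rule ell2_I)
  fix S :: "int set" assume S: "finite S"
  have "(cmod (c n + d n))\<^sup>2 \<le> 2 * (cmod (c n))\<^sup>2 + 2 * (cmod (d n))\<^sup>2" for n
  proof -
    have "(cmod (c n + d n))\<^sup>2 \<le> (cmod (c n) + cmod (d n))\<^sup>2"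
      by (intro power_mono norm_triangle_ineq) auto
    also have "\<dots> \<le> 2 * (cmod (c n))\<^sup>2 + 2 * (cmod (d n))\<^sup>2"
      using zero_le_power2[of "cmod (c n) - cmod (d n)"] by (simp add: power2_eq_square algebra_simps)
    finally show ?thesis .
  qed
  then have "(\<Sum>n\<in>S. (cmod (c n + d n))\<^sup>2) \<le> (\<Sum>n\<in>S. 2 * (cmod (c n))\<^sup>2 + 2 * (cmod (d n))\<^sup>2)"
    by (rule sum_mono)
  also have "\<dots> = 2 * (\<Sum>n\<in>S. (cmod (c n))\<^sup>2) + 2 * (\<Sum>n\<in>S. (cmod (d n))\<^sup>2)"
    by (simp add: sum.distrib sum_distrib_left)
  also have "\<dots> \<le> 2 * (\<Sum>\<^sub>\<infinity>n. (cmod (c n))\<^sup>2) + 2 * (\<Sum>\<^sub>\<infinity>n. (cmod (d n))\<^sup>2)"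
    using ell2_bound[OF c S] ell2_bound[OF d S] by linarith
  finally show "(\<Sum>n\<in>S. (cmod (c n + d n))\<^sup>2) \<le> 2 * (\<Sum>\<^sub>\<infinity>n. (cmod (c n))\<^sup>2) + 2 * (\<Sum>\<^sub>\<infinity>n. (cmod (d n))\<^sup>2)" .
qed

lemma ell2_cmult:
  assumes c: "c \<in> ell2"
  shows "(\<lambda>n. a * c n) \<in> ell2"
proof (rule ell2_I)
  fix S :: "int set" assume "finite S"
  then have "(cmod a)\<^sup>2 * (\<Sum>n\<in>S. (cmod (c n))\<^sup>2) \<le> (cmod a)\<^sup>2 * (\<Sum>\<^sub>\<infinity>n. (cmod (c n))\<^sup>2)"
    by (intro mult_left_mono ell2_bound c) auto
  then show "(\<Sum>n\<in>S. (cmod (a * c n))\<^sup>2) \<le> (cmod a)\<^sup>2 * (\<Sum>\<^sub>\<infinity>n. (cmod (c n))\<^sup>2)"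
    by (simp add: norm_mult power_mult_distrib sum_distrib_left)
qed

lemma L2_series_add:
  assumes "L2_series c g f" "L2_series d g h"
  shows "L2_series (\<lambda>n. c n + d n) g (\<lambda>x. f x + h x)"
  using L2_tendsto_add[OF assms[unfolded L2_series_def]]
  by (simp add: L2_series_def distrib_right sum.distrib)

lemma L2_series_cmult:
  assumes "L2_series c g f"
  shows "L2_series (\<lambda>n. a * c n) g (\<lambda>x. a * f x)"
  using L2_tendsto_cmult[OF assms[unfolded L2_series_def], of a]
  by (simp add: L2_series_def sum_distrib_left mult.assoc)

lemma L2_series_diff:
  assumes "L2_series c g f" "L2_series d g h"
  shows "L2_series (\<lambda>n. c n - d n) g (\<lambda>x. f x - h x)"
  using L2_series_add[OF assms(1) L2_series_cmult[OF assms(2), of "-1"]] by simp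

lemma finite_subset_int_interval:
  fixes S :: "int set"
  assumes "finite S"
  obtains N where "\<And>K. K \<ge> N \<Longrightarrow> S \<subseteq> {- int K..int K}"
proof -
  obtain b where b: "\<And>x. x \<in> S \<Longrightarrow> \<bar>x\<bar> \<le> b"
    using bdd_above_finite[OF finite_imageI[OF assms, of abs]] unfolding bdd_above_def by blast
  have "S \<subseteq> {- int K..int K}" if "K \<ge> nat b" for K
  proof
    fix x assume "x \<in> S"
    then have "\<bar>x\<bar> \<le> int K" using b[of x] that by linarith
    then show "x \<in> {- int K..int K}" by auto
  qed
  then show ?thesis by (rule that)
qed

section \<open>From inequalities for finite sums to a Riesz basis\<close>

context
  fixes g :: "int \<Rightarrow> real \<Rightarrow> complex" and A B :: real
  assumes g: "\<And>n. g n \<in> L2R" and A: "A > 0" and B: "B > 0"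
    and lower: "\<And>S c. finite S \<Longrightarrow> A * (\<Sum>n\<in>S. (cmod (c n))\<^sup>2) \<le> (L2_norm (\<lambda>t. \<Sum>n\<in>S. c n * g n t))\<^sup>2"
    and upper: "\<And>S c. finite S \<Longrightarrow> (L2_norm (\<lambda>t. \<Sum>n\<in>S. c n * g n t))\<^sup>2 \<le> B * (\<Sum>n\<in>S. (cmod (c n))\<^sup>2)"
begin

lemma sum_L2R: "(\<lambda>t. \<Sum>n\<in>S. c n * g n t) \<in> L2R"
  by (intro L2R_sum L2R_cmult g)

text \<open>A finite S is eventually contained in the symmetric partial sums. Applied to f = 0 this
  yields independence, and applied to differences it makes coefficients depend continuously on the
  sum.\<close>

lemma L2_series_lower:
  assumes "L2_series c g f" "finite S"
  shows "A * (\<Sum>n\<in>S. (cmod (c n))\<^sup>2) \<le> (L2_norm f)\<^sup>2"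
proof -
  have lim: "(\<lambda>K. (L2_norm (\<lambda>t. \<Sum>n\<in>{- int K..int K}. c n * g n t))\<^sup>2) \<longlonglongrightarrow> (L2_norm f)\<^sup>2"
    using assms(1) unfolding L2_series_def by (intro tendsto_power L2_tendsto_norm)
  obtain N where N: "\<And>K. K \<ge> N \<Longrightarrow> S \<subseteq> {- int K..int K}"
    using finite_subset_int_interval[OF assms(2)] by blast
  show ?thesis
  proof (rule LIMSEQ_le_const[OF lim], intro exI allI impI)
    fix K assume "N \<le> K"
    then have "A * (\<Sum>n\<in>S. (cmod (c n))\<^sup>2) \<le> A * (\<Sum>n\<in>{- int K..int K}. (cmod (c n))\<^sup>2)"
      using A N by (intro mult_left_mono sum_mono2) auto
    also have "\<dots> \<le> (L2_norm (\<lambda>t. \<Sum>n\<in>{- int K..int K}. c n * g n t))\<^sup>2"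
      by (rule lower) simp
    finally show "A * (\<Sum>n\<in>S. (cmod (c n))\<^sup>2) \<le> (L2_norm (\<lambda>t. \<Sum>n\<in>{- int K..int K}. c n * g n t))\<^sup>2" .
  qed
qed

text \<open>Duality: the inner products d_n of f with the g_n are used as coefficients. Then Q = <f,
  sum d_n g_n>, Cauchy-Schwarz and \<open>upper\<close> give Q^2 <= ||f||^2 B Q, and Q
  cancels.\<close>

lemma analysis_upper:
  assumes f: "f \<in> L2R" and S: "finite S"
  shows "(\<Sum>n\<in>S. (cmod (L2_inner f (g n)))\<^sup>2) \<le> B * (L2_norm f)\<^sup>2"
proof -
  define d where "d = (\<lambda>n. L2_inner f (g n))"
  define Q where "Q = (\<Sum>n\<in>S. (cmod (d n))\<^sup>2)"
  have Q0: "0 \<le> Q" by (simp add: Q_def sum_nonneg)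
  have "complex_of_real Q = L2_inner f (\<lambda>t. \<Sum>n\<in>S. d n * g n t)"
    unfolding L2_inner_sum_right[OF S f g] Q_def of_real_sum complex_norm_square
    by (simp add: d_def mult.commute)
  then have "Q = cmod (L2_inner f (\<lambda>t. \<Sum>n\<in>S. d n * g n t))"
    using Q0 by (metis norm_of_real abs_of_nonneg)
  also have "\<dots> \<le> L2_norm f * L2_norm (\<lambda>t. \<Sum>n\<in>S. d n * g n t)"
    by (rule L2_inner_le[OF f sum_L2R])
  finally have "Q\<^sup>2 \<le> (L2_norm f)\<^sup>2 * (L2_norm (\<lambda>t. \<Sum>n\<in>S. d n * g n t))\<^sup>2"
    unfolding power_mult_distrib[symmetric] by (rule power_mono) (rule Q0)
  also have "\<dots> \<le> (L2_norm f)\<^sup>2 * (B * Q)"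
    unfolding Q_def by (intro mult_left_mono upper S) auto
  finally have "Q * Q \<le> (B * (L2_norm f)\<^sup>2) * Q" by (simp add: power2_eq_square mult_ac)
  then have "Q \<le> B * (L2_norm f)\<^sup>2"
    using Q0 B by (cases "Q = 0") (auto simp: mult_le_cancel_right)
  then show ?thesis by (simp add: Q_def d_def)
qed

text \<open>Pair f with its own partial sums. Cauchy-Schwarz bounds |<f, P_K>|^2 by sum |c_n|^2
  times the sum of the squared inner products, and \<open>lower\<close> bounds sum |c_n|^2 by
  ||P_K||^2 / A. In the limit ||f||^4 <= (||f||^2 / A) \<open>?Q\<close>, and a factor ||f||^2
  cancels.\<close>

lemma analysis_lower:
  assumes c: "L2_series c g f"
  shows "A * (L2_norm f)\<^sup>2 \<le> (\<Sum>\<^sub>\<infinity>n. (cmod (L2_inner f (g n)))\<^sup>2)" (is "_ \<le> ?Q")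
proof -
  have f: "f \<in> L2R" using c by (auto simp: L2_series_def dest: L2_tendstoD)
  have summ: "(\<lambda>n. (cmod (L2_inner f (g n)))\<^sup>2) summable_on UNIV"
    using ell2_I[of "\<lambda>n. L2_inner f (g n)"] analysis_upper[OF f] by (auto simp: ell2_def)
  have Q0: "0 \<le> ?Q" by (intro infsum_nonneg) simp
  let ?P = "\<lambda>K t. \<Sum>n\<in>{- int K..int K}. c n * g n t"
  have P: "L2_tendsto ?P f" using c by (simp add: L2_series_def)
  have "(\<lambda>K. (cmod (L2_inner f (?P K)))\<^sup>2) \<longlonglongrightarrow> (cmod (L2_inner f f))\<^sup>2"
    by (intro tendsto_power tendsto_norm L2_inner_tendsto[OF f P])
  then have lim1: "(\<lambda>K. (cmod (L2_inner f (?P K)))\<^sup>2) \<longlonglongrightarrow> ((L2_norm f)\<^sup>2)\<^sup>2"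
    unfolding L2_inner_self[OF f] norm_of_real by simp
  have lim2: "(\<lambda>K. (L2_norm (?P K))\<^sup>2 / A * ?Q) \<longlonglongrightarrow> (L2_norm f)\<^sup>2 / A * ?Q"
    by (intro tendsto_intros L2_tendsto_norm[OF P]) (use A in simp)
  have "(cmod (L2_inner f (?P K)))\<^sup>2 \<le> (L2_norm (?P K))\<^sup>2 / A * ?Q" for K
  proof -
    have "(cmod (L2_inner f (?P K)))\<^sup>2 \<le>
        (\<Sum>n\<in>{- int K..int K}. (cmod (c n))\<^sup>2) * (\<Sum>n\<in>{- int K..int K}. (cmod (L2_inner f (g n)))\<^sup>2)"
      unfolding L2_inner_sum_right[OF finite_atLeastAtMost_int f g] by (rule cmod_sum_Cauchy_Schwarz)
    also have "\<dots> \<le> (L2_norm (?P K))\<^sup>2 / A * ?Q"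
      using lower[of "{- int K..int K}" c] A
      by (intro mult_mono finite_sum_le_infsum summ) (auto simp: field_simps sum_nonneg)
    finally show ?thesis .
  qed
  then have "((L2_norm f)\<^sup>2)\<^sup>2 \<le> (L2_norm f)\<^sup>2 / A * ?Q"
    by (intro LIMSEQ_le[OF lim1 lim2]) auto
  then have "(L2_norm f)\<^sup>2 * (A * (L2_norm f)\<^sup>2) \<le> (L2_norm f)\<^sup>2 * ?Q"
    using A by (simp add: power2_eq_square field_simps)
  then show ?thesis
    using Q0 by (cases "L2_norm f = 0") (auto simp: mult_le_cancel_left)
qed

text \<open>This is the closedness of the span. The lower inequality makes the coefficient sequences
  Cauchy in ell^2, so they have a limit d; the upper inequality transports closeness of coefficients
  back to closeness of partial sums.\<close>

lemma L2_series_limit: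
  assumes F: "\<And>N. c N \<in> ell2" "\<And>N. L2_series (c N) g (F N)" and lim: "L2_tendsto F f"
  obtains d where "d \<in> ell2" "L2_series d g f"
proof -
  note D = L2_tendstoD[OF lim]
  have diff: "A * (\<Sum>n\<in>S. (cmod (c N n - c M n))\<^sup>2) \<le> (L2_norm (\<lambda>x. F N x - F M x))\<^sup>2" if "finite S" for S N M
    by (rule L2_series_lower[OF L2_series_diff[OF F(2) F(2)] that])
  have cauchy: "\<exists>N0. \<forall>N\<ge>N0. \<forall>M\<ge>N0. L2_norm (\<lambda>x. F N x - F M x) < e" if "e > 0" for e
  proof -
    have "\<forall>\<^sub>F N in sequentially. L2_norm (\<lambda>x. F N x - f x) < e / 2"
      using order_tendstoD(2)[OF D(3), of "e / 2"] that by simp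
    then obtain N0 where N0: "\<And>i. i \<ge> N0 \<Longrightarrow> L2_norm (\<lambda>x. F i x - f x) < e / 2"
      by (auto simp: eventually_sequentially)
    have "L2_norm (\<lambda>x. F i x - F j x) < e" if "i \<ge> N0" "j \<ge> N0" for i j
      using L2_norm_triangle_sub[OF D(1) D(2) D(1), of i j] N0[OF that(1)] N0[OF that(2)]
      by (simp add: L2_norm_minus_commute[of f])
    then show ?thesis by blast
  qed
  have "Cauchy (\<lambda>N. c N n)" for n
  proof (rule metric_CauchyI)
    fix e :: real assume e: "e > 0"
    obtain N0 where N0: "\<forall>N\<ge>N0. \<forall>M\<ge>N0. L2_norm (\<lambda>x. F N x - F M x) < sqrt A * e"
      using cauchy[of "sqrt A * e"] e A by auto
    have "dist (c N n) (c M n) < e" if "N \<ge> N0" "M \<ge> N0" for N M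
    proof -
      have "(sqrt A * cmod (c N n - c M n))\<^sup>2 \<le> (L2_norm (\<lambda>x. F N x - F M x))\<^sup>2"
        using diff[of "{n}" N M] A by (simp add: power_mult_distrib)
      then have "sqrt A * cmod (c N n - c M n) \<le> L2_norm (\<lambda>x. F N x - F M x)"
        by (rule power2_le_imp_le) simp
      also have "\<dots> < sqrt A * e" using N0 that by blast
      finally show ?thesis using A by (simp add: dist_norm)
    qed
    then show "\<exists>M. \<forall>m\<ge>M. \<forall>n'\<ge>M. dist (c m n) (c n' n) < e" by blast
  qed
  then have "\<forall>n. \<exists>l. (\<lambda>N. c N n) \<longlonglongrightarrow> l" by (simp add: Cauchy_convergent_iff convergent_def)
  then obtain d where d: "\<And>n. (\<lambda>N. c N n) \<longlonglongrightarrow> d n" by metis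
  \<comment> \<open>Let M tend to infinity in \<open>diff\<close> for fixed finite S; as N0 is
    independent of S, the estimate is uniform over finite index sets.\<close>
  have tail: "\<exists>N0. \<forall>N\<ge>N0. \<forall>S. finite S \<longrightarrow> A * (\<Sum>n\<in>S. (cmod (c N n - d n))\<^sup>2) \<le> e\<^sup>2" if e: "e > 0" for e
  proof -
    obtain N0 where N0: "\<forall>N\<ge>N0. \<forall>M\<ge>N0. L2_norm (\<lambda>x. F N x - F M x) < e"
      using cauchy[OF e] by blast
    have "A * (\<Sum>n\<in>S. (cmod (c N n - d n))\<^sup>2) \<le> e\<^sup>2" if "N \<ge> N0" "finite S" for N S
    proof (rule LIMSEQ_le_const2)
      show "(\<lambda>M. A * (\<Sum>n\<in>S. (cmod (c N n - c M n))\<^sup>2)) \<longlonglongrightarrow> A * (\<Sum>n\<in>S. (cmod (c N n - d n))\<^sup>2)"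
        by (intro tendsto_intros d)
      show "\<exists>N1. \<forall>M\<ge>N1. A * (\<Sum>n\<in>S. (cmod (c N n - c M n))\<^sup>2) \<le> e\<^sup>2"
      proof (intro exI allI impI)
        fix M assume "N0 \<le> M"
        then have "(L2_norm (\<lambda>x. F N x - F M x))\<^sup>2 \<le> e\<^sup>2"
          using N0 that by (intro power_mono) (auto intro: less_imp_le)
        then show "A * (\<Sum>n\<in>S. (cmod (c N n - c M n))\<^sup>2) \<le> e\<^sup>2"
          using diff[OF that(2), of N M] by linarith
      qed
    qed
    then show ?thesis by blast
  qed
  have d2: "d \<in> ell2"
  proof -
    obtain N0 where N0: "\<And>S. finite S \<Longrightarrow> A * (\<Sum>n\<in>S. (cmod (c N0 n - d n))\<^sup>2) \<le> 1\<^sup>2"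
      using tail[of 1] by auto
    \<comment> \<open>One ell^2 distance to a known ell^2 sequence suffices for d itself.\<close>
    have "(\<lambda>n. c N0 n - d n) \<in> ell2"
      by (rule ell2_I[where C="1 / A"]) (use N0 A in \<open>simp add: field_simps\<close>)
    from ell2_add[OF F(1)[of N0] ell2_cmult[OF this, of "-1"]] show ?thesis by simp
  qed
  let ?P = "\<lambda>a K t. \<Sum>n\<in>{- int K..int K}. a n * g n t"
  have "(\<lambda>K. L2_norm (\<lambda>x. ?P d K x - f x)) \<longlonglongrightarrow> 0"
  proof (rule LIMSEQ_I)
    fix r :: real assume r: "r > 0"
    \<comment> \<open>Chosen so that the factor B / A, lost in passing from coefficients back to
      functions, leaves r / 3.\<close>
    define e where "e = r / 3 / sqrt (B / A)"
    have e: "e > 0" "B / A * e\<^sup>2 = (r / 3)\<^sup>2"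
      using r A B by (simp_all add: e_def power_divide real_sqrt_pow2)
    obtain N0 where N0: "\<forall>N\<ge>N0. \<forall>S. finite S \<longrightarrow> A * (\<Sum>n\<in>S. (cmod (c N n - d n))\<^sup>2) \<le> e\<^sup>2"
      using tail[OF e(1)] by blast
    obtain N1 where N1: "\<And>N. N \<ge> N1 \<Longrightarrow> L2_norm (\<lambda>x. F N x - f x) < r / 3"
      using order_tendstoD(2)[OF D(3), of "r / 3"] r by (auto simp: eventually_sequentially)
    define N where "N = max N0 N1"
    have "L2_tendsto (?P (c N)) (F N)" using F(2) by (simp add: L2_series_def)
    from order_tendstoD(2)[OF L2_tendstoD(3)[OF this], of "r / 3"] r
    obtain K0 where K0: "\<And>K. K \<ge> K0 \<Longrightarrow> L2_norm (\<lambda>x. ?P (c N) K x - F N x) < r / 3"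
      by (auto simp: eventually_sequentially)
    have "L2_norm (\<lambda>x. ?P d K x - f x) < r" if "K \<ge> K0" for K
    proof -
      have "(L2_norm (\<lambda>x. ?P d K x - ?P (c N) K x))\<^sup>2 = (L2_norm (\<lambda>x. ?P (\<lambda>n. d n - c N n) K x))\<^sup>2"
        by (simp add: sum_subtractf left_diff_distrib)
      also have "\<dots> \<le> B * (\<Sum>n\<in>{- int K..int K}. (cmod (d n - c N n))\<^sup>2)" by (rule upper) simp
      also have "\<dots> = B / A * (A * (\<Sum>n\<in>{- int K..int K}. (cmod (c N n - d n))\<^sup>2))"
        using A by (simp add: norm_minus_commute)
      also have "\<dots> \<le> B / A * e\<^sup>2"
        using N0 A B by (intro mult_left_mono) (auto simp: N_def)
      finally have "(L2_norm (\<lambda>x. ?P d K x - ?P (c N) K x))\<^sup>2 \<le> (r / 3)\<^sup>2" unfolding e(2) .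
      then have "L2_norm (\<lambda>x. ?P d K x - ?P (c N) K x) \<le> r / 3"
        by (rule power2_le_imp_le) (use r in simp)
      moreover have "L2_norm (\<lambda>x. ?P d K x - f x) \<le> L2_norm (\<lambda>x. ?P d K x - ?P (c N) K x) + L2_norm (\<lambda>x. ?P (c N) K x - f x)"
        by (rule L2_norm_triangle_sub[OF sum_L2R sum_L2R D(2)])
      moreover have "L2_norm (\<lambda>x. ?P (c N) K x - f x) \<le> L2_norm (\<lambda>x. ?P (c N) K x - F N x) + L2_norm (\<lambda>x. F N x - f x)"
        by (rule L2_norm_triangle_sub[OF sum_L2R D(1) D(2)])
      moreover have "L2_norm (\<lambda>x. F N x - f x) < r / 3" by (rule N1) (simp add: N_def)
      ultimately show ?thesis using K0[OF that] by linarith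
    qed
    then show "\<exists>no. \<forall>K\<ge>no. norm (L2_norm (\<lambda>x. ?P d K x - f x) - 0) < r" by auto
  qed
  then have "L2_series d g f" using sum_L2R D(2) by (simp add: L2_series_def L2_tendsto_def)
  with d2 show ?thesis by (rule that)
qed

text \<open>The constants A and B of the finite sums reappear as frame bounds on the whole
  span.\<close>

lemma riesz_basis_of_bounds: "riesz_basis g {f. \<exists>c\<in>ell2. L2_series c g f}" (is "riesz_basis g ?H")
  unfolding riesz_basis_def
proof (intro conjI)
  have H2: "f \<in> L2R" if "f \<in> ?H" for f
    using that by (auto simp: L2_series_def dest: L2_tendstoD)
  have zero: "(\<lambda>_. 0) \<in> ell2" by (simp add: ell2_def)
  show "L2_closed_subspace ?H"
    unfolding L2_closed_subspace_def
  proof (intro conjI ballI allI impI)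
    show "?H \<subseteq> L2R" using H2 by blast
    have "L2_series (\<lambda>_. 0) g (\<lambda>_. 0)" by (simp add: L2_series_def L2_tendsto_const)
    then show "(\<lambda>_. 0) \<in> ?H" using zero by blast
    show "(\<lambda>x. f x + h x) \<in> ?H" if "f \<in> ?H" "h \<in> ?H" for f h
      using that ell2_add L2_series_add by blast
    show "(\<lambda>x. a * f x) \<in> ?H" if "f \<in> ?H" for a f
      using that ell2_cmult L2_series_cmult by blast
    show "f \<in> ?H" if F: "(\<forall>N. F N \<in> ?H) \<and> L2_tendsto F f" for F f
    proof -
      from F have "\<forall>N. \<exists>c. c \<in> ell2 \<and> L2_series c g (F N)" by blast
      then obtain c where "\<And>N. c N \<in> ell2" "\<And>N. L2_series (c N) g (F N)" by metis
      then obtain d where "d \<in> ell2" "L2_series d g f"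
        using L2_series_limit[where c=c and F=F and f=f] F by blast
      then show ?thesis by blast
    qed
  qed
  show "\<forall>n. g n \<in> ?H"
  proof
    fix m
    let ?c = "\<lambda>n::int. if n = m then 1 else 0 :: complex"
    have c: "?c \<in> ell2"
    proof (rule ell2_I[where C=1])
      fix S :: "int set" assume "finite S"
      then have "(\<Sum>n\<in>S. if n = m then 1 else 0 :: real) \<le> 1" by simp
      also have "(\<Sum>n\<in>S. if n = m then 1 else 0 :: real) = (\<Sum>n\<in>S. (cmod (?c n))\<^sup>2)"
        by (rule sum.cong) auto
      finally show "(\<Sum>n\<in>S. (cmod (?c n))\<^sup>2) \<le> 1" .
    qed
    have eq: "(\<lambda>t. \<Sum>n\<in>{- int K..int K}. ?c n * g n t) = (if m \<in> {- int K..int K} then g m else (\<lambda>_. 0))" for K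
      by (auto simp: if_distrib[of "\<lambda>x. x * _"] sum.delta' cong: if_cong)
    obtain N where N: "\<And>K. K \<ge> N \<Longrightarrow> {m} \<subseteq> {- int K..int K}"
      using finite_subset_int_interval[of "{m}"] by blast
    have "L2_tendsto (\<lambda>K t. \<Sum>n\<in>{- int K..int K}. ?c n * g n t) (g m)"
      unfolding L2_tendsto_def
    proof (intro conjI allI sum_L2R g)
      have "\<forall>\<^sub>F K in sequentially. L2_norm (\<lambda>x. (\<Sum>n\<in>{- int K..int K}. ?c n * g n x) - g m x) = 0"
        unfolding eventually_sequentially
      proof (intro exI allI impI)
        fix K assume "N \<le> K"
        then have "m \<in> {- int K..int K}" using N by blast
        then have "(\<Sum>n\<in>{- int K..int K}. ?c n * g n x) = g m x" for x
          using fun_cong[OF eq[of K], of x] by simp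
        then show "L2_norm (\<lambda>x. (\<Sum>n\<in>{- int K..int K}. ?c n * g n x) - g m x) = 0" by simp
      qed
      then show "(\<lambda>K. L2_norm (\<lambda>x. (\<Sum>n\<in>{- int K..int K}. ?c n * g n x) - g m x)) \<longlonglongrightarrow> 0"
        by (rule tendsto_eventually)
    qed
    then show "g m \<in> ?H" using c by (auto simp: L2_series_def)
  qed
  show "L2_independent g"
    unfolding L2_independent_def
  proof (intro ballI impI allI)
    fix a n assume "L2_series a g (\<lambda>_. 0)"
    from L2_series_lower[OF this, of "{n}"] show "a n = 0"
      using A by (simp add: mult_le_0_iff)
  qed
  show "\<exists>A B. 0 < A \<and> 0 < B \<and>
        (\<forall>f\<in>?H. (\<lambda>n. (cmod (L2_inner f (g n)))\<^sup>2) summable_on UNIV \<and>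
               A * (L2_norm f)\<^sup>2 \<le> (\<Sum>\<^sub>\<infinity>n. (cmod (L2_inner f (g n)))\<^sup>2) \<and>
               (\<Sum>\<^sub>\<infinity>n. (cmod (L2_inner f (g n)))\<^sup>2) \<le> B * (L2_norm f)\<^sup>2)"
  proof (intro exI conjI ballI)
    fix f assume f: "f \<in> ?H"
    then show "A * (L2_norm f)\<^sup>2 \<le> (\<Sum>\<^sub>\<infinity>n. (cmod (L2_inner f (g n)))\<^sup>2)"
      using analysis_lower by blast
    show s: "(\<lambda>n. (cmod (L2_inner f (g n)))\<^sup>2) summable_on UNIV"
      using ell2_I[of "\<lambda>n. L2_inner f (g n)"] analysis_upper[OF H2[OF f]] by (auto simp: ell2_def)
    show "(\<Sum>\<^sub>\<infinity>n. (cmod (L2_inner f (g n)))\<^sup>2) \<le> B * (L2_norm f)\<^sup>2"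
      by (rule infsum_le_finite_sums[OF s]) (rule analysis_upper[OF H2[OF f]])
  qed (fact A B)+
qed

end

subsection \<open>The weight of the shifts and the Riesz property\<close>

text \<open>Norm identities turn into identities of inner products. The weight w lets one lemma
  serve both the line, with w = 1, and the period with the Grammian weight.\<close>

lemma integral_polarization:
  fixes F G :: "'a \<Rightarrow> complex" and w :: "'a \<Rightarrow> real"
  assumes int: "\<And>z. integrable M (\<lambda>x. (cmod (F x + z * G x))\<^sup>2 * w x)"
  defines "I \<equiv> \<lambda>z. complex_of_real (LINT x|M. (cmod (F x + z * G x))\<^sup>2 * w x)"
  shows "4 * (LINT x|M. F x * cnj (G x) * of_real (w x)) = I 1 - I (- 1) + \<i> * (I \<i> - I (- \<i>))"
proof -
  let ?J = "\<lambda>z x. complex_of_real ((cmod (F x + z * G x))\<^sup>2 * w x)"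
  have J: "integrable M (?J z)" for z by (rule integrable_of_real[OF int])
  have "4 * (F x * cnj (G x) * of_real (w x)) = ?J 1 x - ?J (- 1) x + \<i> * (?J \<i> x - ?J (- \<i>) x)" for x
  proof -
    have "4 * (F x * cnj (G x) * of_real (w x)) = 4 * (F x * cnj (G x)) * of_real (w x)" by simp
    also have "\<dots> = ?J 1 x - ?J (- 1) x + \<i> * (?J \<i> x - ?J (- \<i>) x)"
      unfolding complex_polarization by (simp add: algebra_simps)
    finally show ?thesis .
  qed
  then have "4 * (LINT x|M. F x * cnj (G x) * of_real (w x)) =
      (LINT x|M. ?J 1 x - ?J (- 1) x + \<i> * (?J \<i> x - ?J (- \<i>) x))"
    by (simp only: integral_mult_right_zero[symmetric])
  also have "\<dots> = (LINT x|M. ?J 1 x) - (LINT x|M. ?J (- 1) x) + \<i> * ((LINT x|M. ?J \<i> x) - (LINT x|M. ?J (- \<i>) x))"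
    using J[of 1] J[of "- 1"] J[of \<i>] J[of "- \<i>"]
    by (simp del: of_real_mult of_real_power add: Bochner_Integration.integral_add Bochner_Integration.integral_diff)
  finally show ?thesis unfolding I_def by (simp only: integral_complex_of_real)
qed

lemma L2_closed_subspace_sum:
  assumes H: "L2_closed_subspace H" and g: "\<And>n. g n \<in> H"
  shows "(\<lambda>x. \<Sum>n\<in>S. c n * g n x) \<in> H"
proof (induction S rule: infinite_finite_induct)
  case (insert m S)
  have "(\<lambda>x. c m * g m x) \<in> H" using H g by (simp add: L2_closed_subspace_def)
  with insert.IH have "(\<lambda>x. c m * g m x + (\<Sum>n\<in>S. c n * g n x)) \<in> H"
    using H by (simp add: L2_closed_subspace_def)
  then show ?case using insert.hyps by simp
qed (use H in \<open>simp_all add: L2_closed_subspace_def\<close>)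

context
  fixes \<alpha> :: real and \<phi> :: "real \<Rightarrow> complex"
  assumes sin_pos: "sin \<alpha> > 0" and phi: "\<phi> \<in> L2R"
begin

abbreviation shifts :: "int \<Rightarrow> real \<Rightarrow> complex" where "shifts \<equiv> chirp_shift \<alpha> \<phi>"
abbreviation weight :: "real \<Rightarrow> real" where "weight \<equiv> frft_weight \<alpha> \<phi>"
abbreviation shift_sum :: "int set \<Rightarrow> (int \<Rightarrow> complex) \<Rightarrow> real \<Rightarrow> complex" where
  "shift_sum S c t \<equiv> (\<Sum>n\<in>S. c n * shifts n t)"

lemma weight_measurable [measurable]: "weight \<in> borel_measurable borel"
  by (rule frft_weight_measurable[OF sin_pos phi])

lemma weight_nonneg: "0 \<le> weight u"
  by (rule frft_weight_nonneg[OF sin_pos])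

lemma weight_integrable: "integrable (circ (period \<alpha>)) weight"
  by (rule frft_weight_integrable[OF sin_pos phi])

lemma bounded_weight_integrable:
  fixes q :: "real \<Rightarrow> 'a :: {real_normed_field, banach, second_countable_topology}"
  assumes [measurable]: "q \<in> borel_measurable borel" and q: "\<And>u. norm (q u) \<le> C"
  shows "integrable (circ (period \<alpha>)) (\<lambda>u. q u * of_real (weight u))"
proof (rule Bochner_Integration.integrable_bound)
  show "integrable (circ (period \<alpha>)) (\<lambda>u. C * weight u)" using weight_integrable by simp
  show "AE u in circ (period \<alpha>). norm (q u * of_real (weight u)) \<le> norm (C * weight u)"
  proof (rule AE_I2)
    fix u
    have "norm (q u * of_real (weight u)) \<le> C * weight u"
      unfolding norm_mult using weight_nonneg[of u] by (simp add: mult_right_mono q)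
    then show "norm (q u * of_real (weight u)) \<le> norm (C * weight u)" by simp
  qed
  show "(\<lambda>u. q u * of_real (weight u)) \<in> borel_measurable (circ (period \<alpha>))" by measurable
qed

lemma trig_sum_sq_weight_integrable: "integrable (circ (period \<alpha>)) (\<lambda>u. (cmod (trig_sum \<alpha> S c u))\<^sup>2 * weight u)"
  using bounded_weight_integrable[of "\<lambda>u. (cmod (trig_sum \<alpha> S c u))\<^sup>2" "(\<Sum>n\<in>S. cmod (c n))\<^sup>2"]
    trig_sum_bound[OF sin_pos, of c _ S]
  by (simp add: power_mono)

lemma shift_sum_L2R: "shift_sum S c \<in> L2R"
  by (intro L2R_sum L2R_cmult chirp_shift_L2R phi)

lemma L2_norm_shift_sum:
  "finite S \<Longrightarrow> period \<alpha> * (L2_norm (shift_sum S c))\<^sup>2 = (LINT u|circ (period \<alpha>). (cmod (trig_sum \<alpha> S c u))\<^sup>2 * weight u)"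
  by (rule L2_norm_sum_weight[OF sin_pos phi])

text \<open>P + z E_n is again a trigonometric sum, so the norm identity holds for it, and
  polarization in z extracts the inner product with the n-th shift. The frequency side is then the
  n-th Fourier coefficient of P times the weight.\<close>

lemma L2_inner_shift_sum:
  assumes S: "finite S"
  shows "L2_inner (shift_sum S c) (shifts n) = fcoeff \<alpha> (\<lambda>u. trig_sum \<alpha> S c u * of_real (weight u)) n"
proof -
  \<comment> \<open>The index n may already belong to S, so z is added to its coefficient and does
    not replace it.\<close>
  define d where "d = (\<lambda>z m. (if m \<in> S then c m else 0) + (if m = n then z else 0 :: complex))"
  have ext: "(\<Sum>m\<in>insert n S. d z m * x m) = (\<Sum>m\<in>S. c m * x m) + z * x n" for z and x :: "int \<Rightarrow> complex"
  proof -
    have "(\<Sum>m\<in>insert n S. (if m \<in> S then c m else 0) * x m) = (\<Sum>m\<in>S. c m * x m)"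
      by (rule sum.mono_neutral_cong_right) (use S in auto)
    moreover have "(\<Sum>m\<in>insert n S. (if m = n then z else 0) * x m) = z * x n"
      using S by (simp add: if_distrib[of "\<lambda>y. y * _"] sum.delta' cong: if_cong)
    ultimately show ?thesis by (simp add: d_def distrib_right sum.distrib)
  qed
  have fin: "finite (insert n S)" using S by simp
  have i1: "integrable lborel (\<lambda>x. (cmod (shift_sum S c x + z * shifts n x))\<^sup>2 * 1)" for z
    using L2R_integrable_sq[OF shift_sum_L2R[of "d z" "insert n S"]] unfolding ext by simp
  have i2: "integrable (circ (period \<alpha>)) (\<lambda>u. (cmod (trig_sum \<alpha> S c u + z * frft_mod \<alpha> n u))\<^sup>2 * weight u)" for z
    using trig_sum_sq_weight_integrable[of "d z" "insert n S"] unfolding ext .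
  have eq: "(LINT u|circ (period \<alpha>). (cmod (trig_sum \<alpha> S c u + z * frft_mod \<alpha> n u))\<^sup>2 * weight u) =
      period \<alpha> * (LINT x|lborel. (cmod (shift_sum S c x + z * shifts n x))\<^sup>2 * 1)" for z
    using L2_norm_shift_sum[OF fin, of "d z"] unfolding ext by (simp add: L2_norm_sq)
  have "4 * (LINT u|circ (period \<alpha>). trig_sum \<alpha> S c u * cnj (frft_mod \<alpha> n u) * of_real (weight u)) =
      of_real (period \<alpha>) * (4 * (LINT x|lborel. shift_sum S c x * cnj (shifts n x) * of_real 1))"
    unfolding integral_polarization[OF i2] integral_polarization[OF i1] eq
    by (simp only: of_real_mult ring_distribs right_diff_distrib mult.left_commute[of \<i>] mult_minus_right)
  then have "(LINT u|circ (period \<alpha>). trig_sum \<alpha> S c u * of_real (weight u) * cnj (frft_mod \<alpha> n u)) =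
      of_real (period \<alpha>) * L2_inner (shift_sum S c) (shifts n)"
    by (simp add: L2_inner_def mult_ac)
  then show ?thesis using sin_pos by (simp add: fcoeff_def[OF sin_pos])
qed

text \<open>Integrate A |P|^2 <= |P|^2 W <= B |P|^2. Parseval and the norm identity carry the same
  factor \<open>period\<close>, so A and B survive unchanged.\<close>

lemma riesz_basis_of_weight_bounds:
  assumes A: "A > 0" and B: "B > 0" and AB: "AE u in circ (period \<alpha>). A \<le> weight u \<and> weight u \<le> B"
  shows "riesz_basis shifts (V0 \<alpha> \<phi>)"
  unfolding V0_def
proof (rule riesz_basis_of_bounds[OF _ A B])
  have int: "integrable (circ (period \<alpha>)) (\<lambda>u. (cmod (trig_sum \<alpha> S c u))\<^sup>2)" for S c
    by (rule circ_integrable_bounded[where C="(\<Sum>n\<in>S. cmod (c n))\<^sup>2"])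
      (measurable, use trig_sum_bound[OF sin_pos] in \<open>simp add: power_mono\<close>)
  show "shifts n \<in> L2R" for n by (rule chirp_shift_L2R[OF phi])
  fix S :: "int set" and c :: "int \<Rightarrow> complex" assume S: "finite S"
  have "A * (LINT u|circ (period \<alpha>). (cmod (trig_sum \<alpha> S c u))\<^sup>2) = (LINT u|circ (period \<alpha>). A * (cmod (trig_sum \<alpha> S c u))\<^sup>2)" by simp
  also have "\<dots> \<le> (LINT u|circ (period \<alpha>). (cmod (trig_sum \<alpha> S c u))\<^sup>2 * weight u)"
  proof (rule integral_mono_AE[OF _ trig_sum_sq_weight_integrable])
    show "AE u in circ (period \<alpha>). A * (cmod (trig_sum \<alpha> S c u))\<^sup>2 \<le> (cmod (trig_sum \<alpha> S c u))\<^sup>2 * weight u"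
      using AB by eventually_elim (simp add: mult.commute mult_right_mono)
  qed (use int in simp)
  finally have "period \<alpha> * (A * (\<Sum>n\<in>S. (cmod (c n))\<^sup>2)) \<le> period \<alpha> * (L2_norm (shift_sum S c))\<^sup>2"
    unfolding trig_sum_Parseval[OF sin_pos S] L2_norm_shift_sum[OF S] by (simp add: mult_ac)
  then show "A * (\<Sum>n\<in>S. (cmod (c n))\<^sup>2) \<le> (L2_norm (shift_sum S c))\<^sup>2"
    using period_pos[OF sin_pos] by (simp only: mult_le_cancel_left_pos)
  have "(LINT u|circ (period \<alpha>). (cmod (trig_sum \<alpha> S c u))\<^sup>2 * weight u) \<le> (LINT u|circ (period \<alpha>). B * (cmod (trig_sum \<alpha> S c u))\<^sup>2)"
  proof (rule integral_mono_AE[OF trig_sum_sq_weight_integrable])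
    show "AE u in circ (period \<alpha>). (cmod (trig_sum \<alpha> S c u))\<^sup>2 * weight u \<le> B * (cmod (trig_sum \<alpha> S c u))\<^sup>2"
      using AB by eventually_elim (simp add: mult.commute mult_right_mono)
  qed (use int in simp)
  also have "\<dots> = B * (LINT u|circ (period \<alpha>). (cmod (trig_sum \<alpha> S c u))\<^sup>2)" by simp
  finally have "period \<alpha> * (L2_norm (shift_sum S c))\<^sup>2 \<le> period \<alpha> * (B * (\<Sum>n\<in>S. (cmod (c n))\<^sup>2))"
    unfolding trig_sum_Parseval[OF sin_pos S] L2_norm_shift_sum[OF S] by (simp add: mult_ac)
  then show "(L2_norm (shift_sum S c))\<^sup>2 \<le> B * (\<Sum>n\<in>S. (cmod (c n))\<^sup>2)"
    using period_pos[OF sin_pos] by (simp only: mult_le_cancel_left_pos)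
qed

text \<open>If the weight vanishes on a compact set of positive measure, then the Fourier coefficients of
  the indicator of that set give a nontrivial relation between the shifts.\<close>

lemma weight_pos_of_independent:
  assumes B: "B > 0" and WB: "AE u in circ (period \<alpha>). weight u \<le> B" and ind: "L2_independent shifts"
  shows "AE u in circ (period \<alpha>). weight u > 0"
proof (rule ccontr)
  assume neg: "\<not> (AE u in circ (period \<alpha>). weight u > 0)"
  define Z where "Z = {u \<in> {0..period \<alpha>}. weight u = 0}"
  have Z [measurable]: "Z \<in> sets borel" unfolding Z_def by measurable
  have "emeasure lborel Z \<noteq> 0"
  proof
    assume "emeasure lborel Z = 0"
    then have "AE u in lborel. u \<notin> Z" by (intro AE_not_in) (auto simp: null_sets_def)
    then have "AE u in circ (period \<alpha>). weight u > 0" unfolding AE_circ_iff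
    proof eventually_elim
      case (elim u)
      then show ?case using weight_nonneg[of u] by (auto simp: Z_def less_le)
    qed
    with neg show False by simp
  qed
  then obtain K where K: "compact K" "K \<subseteq> Z" "measure lborel K > 0"
  proof (rule circ_inner_compact[OF Z, rotated])
    show "Z \<subseteq> {0..period \<alpha>}" by (auto simp: Z_def)
  qed blast
  have K0: "K \<subseteq> {0..period \<alpha>}" "K \<noteq> {}" using K by (auto simp: Z_def)
  have [measurable]: "K \<in> sets borel" using K(1) by (simp add: borel_compact)
  define h where "h = (indicator K :: real \<Rightarrow> complex)"
  have [measurable]: "h \<in> borel_measurable borel" unfolding h_def by measurable
  have hle: "cmod (h u) \<le> 1" for u by (simp add: h_def indicator_def)
  then have hAE: "AE u in circ (period \<alpha>). cmod (h u) \<le> 1" by simp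
  define c where "c = fcoeff \<alpha> h"
  have c2: "c \<in> ell2"
  proof (rule ell2_I)
    fix S :: "int set" assume "finite S"
    from Bessel[OF sin_pos _ hAE this]
    show "(\<Sum>n\<in>S. (cmod (c n))\<^sup>2) \<le> (LINT u|circ (period \<alpha>). (cmod (h u))\<^sup>2) / period \<alpha>"
      using period_pos[OF sin_pos] by (simp add: c_def pos_le_divide_eq mult.commute)
  qed
  obtain S a where S: "\<And>m. finite (S m)" "\<And>m u. cmod (trig_sum \<alpha> (S m) (a m) u) \<le> 2"
    "\<And>u. u \<in> {0<..<period \<alpha>} \<Longrightarrow> (\<lambda>m::nat. trig_sum \<alpha> (S m) (a m) u) \<longlonglongrightarrow> indicator K u"
    using trig_approx_indicator[OF sin_pos K(1) K0] by blast
  have lim: "(\<lambda>m. LINT u|circ (period \<alpha>). (cmod (h u - trig_sum \<alpha> (S m) (a m) u))\<^sup>2) \<longlonglongrightarrow> (LINT u|circ (period \<alpha>). 0)"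
  \<comment> \<open>The constant is (1 + 2)^2, from |h| <= 1 and the bound 2 on the
    approximants.\<close>
  proof (rule integral_dominated_convergence[where w="\<lambda>u. 9"])
    show "integrable (circ (period \<alpha>)) (\<lambda>u. 9 :: real)"
      by (rule circ_integrable_bounded[where C=9]) auto
    show "AE u in circ (period \<alpha>). (\<lambda>m. (cmod (h u - trig_sum \<alpha> (S m) (a m) u))\<^sup>2) \<longlonglongrightarrow> 0"
      using AE_circ_interior
    proof eventually_elim
      case (elim u)
      have "(\<lambda>m. (cmod (h u - trig_sum \<alpha> (S m) (a m) u))\<^sup>2) \<longlonglongrightarrow> (cmod (h u - indicator K u))\<^sup>2"
        by (intro tendsto_intros S(3) elim)
      then show ?case by (simp add: h_def)
    qed
    show "AE u in circ (period \<alpha>). norm ((cmod (h u - trig_sum \<alpha> (S m) (a m) u))\<^sup>2) \<le> 9" for m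
    proof (rule AE_I2)
      fix u
      have "cmod (h u - trig_sum \<alpha> (S m) (a m) u) \<le> 3"
        using norm_triangle_ineq4[of "h u" "trig_sum \<alpha> (S m) (a m) u"] hle[of u] S(2)[of m u] by linarith
      then have "(cmod (h u - trig_sum \<alpha> (S m) (a m) u))\<^sup>2 \<le> 3\<^sup>2" by (rule power_mono) simp
      then show "norm ((cmod (h u - trig_sum \<alpha> (S m) (a m) u))\<^sup>2) \<le> 9" by simp
    qed
  qed measurable
  \<comment> \<open>On K the weight vanishes and off K the function h does, so |P|^2 W <= B |h -
    P|^2 almost everywhere. The Fourier sum of h over any R containing \<open>S m\<close> is at
    least as close to h as the approximant with indices in \<open>S m\<close>, by
    \<open>trig_sum_distance\<close>.\<close>
  have key: "period \<alpha> * (L2_norm (shift_sum R c))\<^sup>2 \<le> B * (LINT u|circ (period \<alpha>). (cmod (h u - trig_sum \<alpha> (S m) (a m) u))\<^sup>2)"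
    if R: "finite R" "S m \<subseteq> R" for R m
  proof -
    have "(LINT u|circ (period \<alpha>). (cmod (trig_sum \<alpha> R c u))\<^sup>2 * weight u) \<le> (LINT u|circ (period \<alpha>). B * (cmod (h u - trig_sum \<alpha> R c u))\<^sup>2)"
    proof (rule integral_mono_AE[OF trig_sum_sq_weight_integrable])
      show "integrable (circ (period \<alpha>)) (\<lambda>u. B * (cmod (h u - trig_sum \<alpha> R c u))\<^sup>2)"
      proof (intro integrable_mult_right, rule circ_integrable_bounded[where C="(1 + (\<Sum>n\<in>R. cmod (c n)))\<^sup>2"])
        show "AE u in circ (period \<alpha>). norm ((cmod (h u - trig_sum \<alpha> R c u))\<^sup>2) \<le> (1 + (\<Sum>n\<in>R. cmod (c n)))\<^sup>2"
        proof (rule AE_I2)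
          fix u
          have "cmod (h u - trig_sum \<alpha> R c u) \<le> 1 + (\<Sum>n\<in>R. cmod (c n))"
            using norm_triangle_ineq4[of "h u" "trig_sum \<alpha> R c u"] hle[of u] trig_sum_bound[OF sin_pos, of c u R] by linarith
          then show "norm ((cmod (h u - trig_sum \<alpha> R c u))\<^sup>2) \<le> (1 + (\<Sum>n\<in>R. cmod (c n)))\<^sup>2"
            by (simp add: power_mono)
        qed
      qed measurable
      show "AE u in circ (period \<alpha>). (cmod (trig_sum \<alpha> R c u))\<^sup>2 * weight u \<le> B * (cmod (h u - trig_sum \<alpha> R c u))\<^sup>2"
        using WB
      proof eventually_elim
        case (elim u)
        show ?case
        proof (cases "u \<in> K")
          case True
          then have "weight u = 0" using K(2) by (auto simp: Z_def)
          then show ?thesis using B by simp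
        next
          case False
          then have "h u = 0" by (simp add: h_def)
          then show ?thesis using elim by (simp add: mult.commute mult_right_mono)
        qed
      qed
    qed
    also have "\<dots> = B * (LINT u|circ (period \<alpha>). (cmod (h u - trig_sum \<alpha> R c u))\<^sup>2)" by simp
    also have "(LINT u|circ (period \<alpha>). (cmod (h u - trig_sum \<alpha> R c u))\<^sup>2) \<le> (LINT u|circ (period \<alpha>). (cmod (h u - trig_sum \<alpha> (S m) (a m) u))\<^sup>2)"
    proof -
      have "(\<Sum>n\<in>S m. (cmod (fcoeff \<alpha> h n))\<^sup>2) \<le> (\<Sum>n\<in>R. (cmod (fcoeff \<alpha> h n))\<^sup>2)"
        by (rule sum_mono2) (use R in auto)
      moreover have "0 \<le> (\<Sum>n\<in>S m. (cmod (a m n - fcoeff \<alpha> h n))\<^sup>2)" by (rule sum_nonneg) simp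
      ultimately have "period \<alpha> * (\<Sum>n\<in>S m. (cmod (fcoeff \<alpha> h n))\<^sup>2) \<le> period \<alpha> * (\<Sum>n\<in>R. (cmod (fcoeff \<alpha> h n))\<^sup>2)"
        "0 \<le> period \<alpha> * (\<Sum>n\<in>S m. (cmod (a m n - fcoeff \<alpha> h n))\<^sup>2)"
        using sin_pos by (auto intro!: mult_left_mono mult_nonneg_nonneg)
      from add_mono[OF this] show ?thesis
        unfolding trig_sum_distance[OF sin_pos \<open>h \<in> borel_measurable borel\<close> hAE R(1)]
          trig_sum_distance[OF sin_pos \<open>h \<in> borel_measurable borel\<close> hAE S(1)]
        unfolding c_def by simp
    qed
    finally show ?thesis unfolding L2_norm_shift_sum[OF R(1)] using B by (simp add: mult_left_mono)
  qed
  have "(\<lambda>N. L2_norm (shift_sum {- int N..int N} c)) \<longlonglongrightarrow> 0"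
  proof (rule LIMSEQ_I)
    fix r :: real assume r: "r > 0"
    have "\<forall>\<^sub>F m in sequentially. (LINT u|circ (period \<alpha>). (cmod (h u - trig_sum \<alpha> (S m) (a m) u))\<^sup>2) < period \<alpha> * r\<^sup>2 / B"
      by (rule order_tendstoD(2)[OF lim]) (use r B period_pos[OF sin_pos] in simp)
    then obtain m where m: "(LINT u|circ (period \<alpha>). (cmod (h u - trig_sum \<alpha> (S m) (a m) u))\<^sup>2) < period \<alpha> * r\<^sup>2 / B"
      by (auto simp: eventually_sequentially)
    obtain N0 where N0: "\<And>N. N \<ge> N0 \<Longrightarrow> S m \<subseteq> {- int N..int N}"
      using finite_subset_int_interval[OF S(1)] by blast
    have "L2_norm (shift_sum {- int N..int N} c) < r" if "N \<ge> N0" for N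
    proof -
      have "period \<alpha> * (L2_norm (shift_sum {- int N..int N} c))\<^sup>2 \<le> B * (LINT u|circ (period \<alpha>). (cmod (h u - trig_sum \<alpha> (S m) (a m) u))\<^sup>2)"
        by (rule key) (use N0[OF that] in auto)
      also have "\<dots> < period \<alpha> * r\<^sup>2" using m B by (simp add: pos_less_divide_eq mult.commute)
      finally have "(L2_norm (shift_sum {- int N..int N} c))\<^sup>2 < r\<^sup>2"
        using period_pos[OF sin_pos] by (simp only: mult_less_cancel_left_pos)
      then show ?thesis by (rule power_less_imp_less_base) (use r in simp)
    qed
    then show "\<exists>no. \<forall>N\<ge>no. norm (L2_norm (shift_sum {- int N..int N} c) - 0) < r" by auto
  qed
  then have "L2_series c shifts (\<lambda>_. 0)"
    by (simp add: L2_series_def L2_tendsto_def shift_sum_L2R)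
  with ind c2 have "c 0 = 0" by (auto simp: L2_independent_def)
  \<comment> \<open>As \<open>frft_mod\<close> with index 0 is identically 1, the coefficient
    \<open>c 0\<close> is the measure of K divided by the period, hence not 0.\<close>
  moreover have "(LINT u|circ (period \<alpha>). h u * cnj (frft_mod \<alpha> 0 u)) = of_real (measure lborel K)"
  proof -
    have "(LINT u|circ (period \<alpha>). h u * cnj (frft_mod \<alpha> 0 u)) = (LINT u|circ (period \<alpha>). complex_of_real (indicator K u))"
      by (intro Bochner_Integration.integral_cong) (auto simp: h_def frft_mod_def indicator_def)
    also have "\<dots> = of_real (LINT u|circ (period \<alpha>). indicator K u)" by (rule integral_complex_of_real)
    also have "(LINT u|circ (period \<alpha>). indicator K u) = measure lborel K"
      using K0(1) by (simp add: measure_restrict_space space_restrict_space Int_absorb2)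
    finally show ?thesis .
  qed
  ultimately show False using K(3) sin_pos by (simp add: c_def fcoeff_def[OF sin_pos])
qed

lemma weight_bounds_of_riesz_basis:
  assumes "riesz_basis shifts (V0 \<alpha> \<phi>)"
  obtains A B where "A > 0" "B > 0" "AE u in circ (period \<alpha>). A \<le> weight u \<and> weight u \<le> B"
proof -
  have H: "L2_closed_subspace (V0 \<alpha> \<phi>)" and gH: "\<And>n. shifts n \<in> V0 \<alpha> \<phi>" and ind: "L2_independent shifts"
    using assms by (auto simp: riesz_basis_def)
  obtain A B where A: "A > 0" and B: "B > 0"
    and summ: "\<And>f. f \<in> V0 \<alpha> \<phi> \<Longrightarrow> (\<lambda>n. (cmod (L2_inner f (shifts n)))\<^sup>2) summable_on UNIV"
    and lower: "\<And>f. f \<in> V0 \<alpha> \<phi> \<Longrightarrow> A * (L2_norm f)\<^sup>2 \<le> (\<Sum>\<^sub>\<infinity>n. (cmod (L2_inner f (shifts n)))\<^sup>2)"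
    and upper: "\<And>f. f \<in> V0 \<alpha> \<phi> \<Longrightarrow> (\<Sum>\<^sub>\<infinity>n. (cmod (L2_inner f (shifts n)))\<^sup>2) \<le> B * (L2_norm f)\<^sup>2"
    using assms unfolding riesz_basis_def by blast
  have mem: "shift_sum S c \<in> V0 \<alpha> \<phi>" for S c by (rule L2_closed_subspace_sum[OF H gH])
  have int: "integrable (circ (period \<alpha>)) (\<lambda>u. (cmod (trig_sum \<alpha> S c u))\<^sup>2)" for S c
    by (rule circ_integrable_bounded[where C="(\<Sum>n\<in>S. cmod (c n))\<^sup>2"])
      (measurable, use trig_sum_bound[OF sin_pos] in \<open>simp add: power_mono\<close>)
  \<comment> \<open>Since ||f||^2 = sum of cnj c_n <f, g_n>, Cauchy-Schwarz and the upper frame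
    bound give N^2 <= (sum |c_n|^2) B N, and N cancels.\<close>
  have bessel: "(L2_norm (shift_sum S c))\<^sup>2 \<le> B * (\<Sum>n\<in>S. (cmod (c n))\<^sup>2)" if S: "finite S" for S c
  proof -
    let ?f = "shift_sum S c"
    define N where "N = (L2_norm ?f)\<^sup>2"
    have "complex_of_real N = (\<Sum>n\<in>S. cnj (c n) * L2_inner ?f (shifts n))"
      using L2_inner_self[OF shift_sum_L2R, of c S] L2_inner_sum_right[OF S shift_sum_L2R chirp_shift_L2R[OF phi]]
      by (simp add: N_def)
    then have "N\<^sup>2 = (cmod (\<Sum>n\<in>S. cnj (c n) * L2_inner ?f (shifts n)))\<^sup>2"
      by (metis norm_of_real power2_abs)
    also have "\<dots> \<le> (\<Sum>n\<in>S. (cmod (c n))\<^sup>2) * (\<Sum>n\<in>S. (cmod (L2_inner ?f (shifts n)))\<^sup>2)"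
      by (rule cmod_sum_Cauchy_Schwarz)
    also have "\<dots> \<le> (\<Sum>n\<in>S. (cmod (c n))\<^sup>2) * (B * N)"
      unfolding N_def
      by (intro mult_left_mono order_trans[OF finite_sum_le_infsum upper[OF mem]] summ mem S)
        (auto intro: sum_nonneg)
    finally have "N * N \<le> (B * (\<Sum>n\<in>S. (cmod (c n))\<^sup>2)) * N" by (simp add: power2_eq_square mult_ac)
    moreover have "0 \<le> B * (\<Sum>n\<in>S. (cmod (c n))\<^sup>2)" using B by (simp add: sum_nonneg)
    moreover have "0 \<le> N" by (simp add: N_def)
    ultimately have "N \<le> B * (\<Sum>n\<in>S. (cmod (c n))\<^sup>2)"
      by (cases "N = 0") (auto simp: mult_le_cancel_right)
    then show ?thesis by (simp add: N_def)
  qed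
  have "AE u in circ (period \<alpha>). 0 \<le> B - weight u"
  proof (rule AE_nonneg_of_trig_sums[OF sin_pos])
    show "integrable (circ (period \<alpha>)) (\<lambda>u. B - weight u)"
      using B by (intro Bochner_Integration.integrable_diff weight_integrable circ_integrable_bounded[where C=B]) auto
    fix S :: "int set" and c :: "int \<Rightarrow> complex" assume S: "finite S"
    have "(LINT u|circ (period \<alpha>). (cmod (trig_sum \<alpha> S c u))\<^sup>2 * (B - weight u)) =
        B * (LINT u|circ (period \<alpha>). (cmod (trig_sum \<alpha> S c u))\<^sup>2) - (LINT u|circ (period \<alpha>). (cmod (trig_sum \<alpha> S c u))\<^sup>2 * weight u)"
      using int[of c S] trig_sum_sq_weight_integrable[of c S] by (simp add: right_diff_distrib)
    also have "\<dots> = period \<alpha> * (B * (\<Sum>n\<in>S. (cmod (c n))\<^sup>2) - (L2_norm (shift_sum S c))\<^sup>2)"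
      unfolding trig_sum_Parseval[OF sin_pos S] L2_norm_shift_sum[OF S, symmetric] by (simp add: algebra_simps)
    finally show "0 \<le> (LINT u|circ (period \<alpha>). (cmod (trig_sum \<alpha> S c u))\<^sup>2 * (B - weight u))"
      using bessel[OF S, of c] period_pos[OF sin_pos] by simp
  qed measurable
  then have WB: "AE u in circ (period \<alpha>). weight u \<le> B" by simp
  have intW2: "integrable (circ (period \<alpha>)) (\<lambda>u. (cmod (trig_sum \<alpha> S c u))\<^sup>2 * (weight u)\<^sup>2)" for S c
  proof (rule circ_integrable_bounded[where C="(\<Sum>n\<in>S. cmod (c n))\<^sup>2 * B\<^sup>2"])
    show "AE u in circ (period \<alpha>). norm ((cmod (trig_sum \<alpha> S c u))\<^sup>2 * (weight u)\<^sup>2) \<le> (\<Sum>n\<in>S. cmod (c n))\<^sup>2 * B\<^sup>2"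
      using WB
    proof eventually_elim
      case (elim u)
      have "(cmod (trig_sum \<alpha> S c u))\<^sup>2 * (weight u)\<^sup>2 \<le> (\<Sum>n\<in>S. cmod (c n))\<^sup>2 * B\<^sup>2"
        by (intro mult_mono power_mono elim trig_sum_bound[OF sin_pos] weight_nonneg) auto
      then show ?case by simp
    qed
  qed measurable
  have "AE u in circ (period \<alpha>). 0 \<le> (weight u)\<^sup>2 - A * weight u"
  proof (rule AE_nonneg_of_trig_sums[OF sin_pos])
    show "integrable (circ (period \<alpha>)) (\<lambda>u. (weight u)\<^sup>2 - A * weight u)"
      \<comment> \<open>With the single coefficient 1 at index 0 the trigonometric sum has modulus
        1, so this is integrability of the squared weight.\<close>
      using intW2[of "\<lambda>_. 1" "{0}"] weight_integrable by simp
    fix S :: "int set" and c :: "int \<Rightarrow> complex" assume S: "finite S"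
    let ?f = "shift_sum S c" and ?h = "\<lambda>u. trig_sum \<alpha> S c u * of_real (weight u)"
    have h: "AE u in circ (period \<alpha>). cmod (?h u) \<le> (\<Sum>n\<in>S. cmod (c n)) * B"
      using WB
    proof eventually_elim
      case (elim u)
      then show ?case
        unfolding norm_mult norm_of_real abs_of_nonneg[OF weight_nonneg]
        by (intro mult_mono trig_sum_bound[OF sin_pos] weight_nonneg sum_nonneg) auto
    qed
    have "period \<alpha> * (\<Sum>\<^sub>\<infinity>n. (cmod (L2_inner ?f (shifts n)))\<^sup>2) \<le> (LINT u|circ (period \<alpha>). (cmod (?h u))\<^sup>2)"
    proof -
      \<comment> \<open>The inner products are Fourier coefficients of \<open>?h\<close>, so Bessel
        bounds every finite partial sum and hence the infinite one.\<close>
      have "(\<Sum>\<^sub>\<infinity>n. (cmod (L2_inner ?f (shifts n)))\<^sup>2) \<le> (LINT u|circ (period \<alpha>). (cmod (?h u))\<^sup>2) / period \<alpha>"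
      proof (rule infsum_le_finite_sums[OF summ[OF mem]])
        fix R :: "int set" assume "finite R"
        from Bessel[OF sin_pos _ h this]
        show "(\<Sum>n\<in>R. (cmod (L2_inner ?f (shifts n)))\<^sup>2) \<le> (LINT u|circ (period \<alpha>). (cmod (?h u))\<^sup>2) / period \<alpha>"
          unfolding L2_inner_shift_sum[OF S] pos_le_divide_eq[OF period_pos[OF sin_pos]] by (simp add: mult.commute)
      qed
      then show ?thesis unfolding pos_le_divide_eq[OF period_pos[OF sin_pos]] by (simp add: mult.commute)
    qed
    moreover have "period \<alpha> * (A * (L2_norm ?f)\<^sup>2) \<le> period \<alpha> * (\<Sum>\<^sub>\<infinity>n. (cmod (L2_inner ?f (shifts n)))\<^sup>2)"
      using lower[OF mem] period_pos[OF sin_pos] by (intro mult_left_mono) auto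
    moreover have "period \<alpha> * (A * (L2_norm ?f)\<^sup>2) = A * (LINT u|circ (period \<alpha>). (cmod (trig_sum \<alpha> S c u))\<^sup>2 * weight u)"
      unfolding L2_norm_shift_sum[OF S, symmetric] by simp
    moreover have "(LINT u|circ (period \<alpha>). (cmod (?h u))\<^sup>2) = (LINT u|circ (period \<alpha>). (cmod (trig_sum \<alpha> S c u))\<^sup>2 * (weight u)\<^sup>2)"
      by (simp add: norm_mult power_mult_distrib)
    moreover have "(LINT u|circ (period \<alpha>). (cmod (trig_sum \<alpha> S c u))\<^sup>2 * ((weight u)\<^sup>2 - A * weight u)) =
        (LINT u|circ (period \<alpha>). (cmod (trig_sum \<alpha> S c u))\<^sup>2 * (weight u)\<^sup>2) - A * (LINT u|circ (period \<alpha>). (cmod (trig_sum \<alpha> S c u))\<^sup>2 * weight u)"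
      using intW2[of c S] trig_sum_sq_weight_integrable[of c S]
      by (simp add: right_diff_distrib mult.left_commute[of _ A])
    ultimately show "0 \<le> (LINT u|circ (period \<alpha>). (cmod (trig_sum \<alpha> S c u))\<^sup>2 * ((weight u)\<^sup>2 - A * weight u))" by linarith
  qed measurable
  then have "AE u in circ (period \<alpha>). A \<le> weight u \<and> weight u \<le> B"
    using WB weight_pos_of_independent[OF B WB ind]
  proof eventually_elim
    case (elim u)
    \<comment> \<open>Positivity of the weight, supplied by independence, permits cancelling one
      factor.\<close>
    then have "A * weight u \<le> weight u * weight u" by (simp add: power2_eq_square)
    with elim show ?case by simp
  qed
  with A B show ?thesis by (rule that)
qed

end

theorem theorem4p2:
  fixes \<alpha> :: real and \<phi> :: "real \<Rightarrow> complex"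
  assumes "sin \<alpha> > 0" and "\<phi> \<in> L2R"
  shows "riesz_basis (chirp_shift \<alpha> \<phi>) (V0 \<alpha> \<phi>) \<longleftrightarrow>
    (\<exists>A B :: real. A > 0 \<and> B > 0 \<and>
      (AE u in lborel. u \<in> {0..2 * pi * sin \<alpha>} \<longrightarrow>
         A \<le> (grammian \<alpha> \<phi> u)\<^sup>2 \<and> (grammian \<alpha> \<phi> u)\<^sup>2 \<le> B))"
proof -
  have eq: "AE u in circ (2 * pi * sin \<alpha>). (grammian \<alpha> \<phi> u)\<^sup>2 = frft_weight \<alpha> \<phi> u"
    by (rule AE_grammian_eq_weight[OF assms])
  have iff: "(AE u in lborel. u \<in> {0..2 * pi * sin \<alpha>} \<longrightarrow>
         A \<le> (grammian \<alpha> \<phi> u)\<^sup>2 \<and> (grammian \<alpha> \<phi> u)\<^sup>2 \<le> B) \<longleftrightarrow>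
      (AE u in circ (2 * pi * sin \<alpha>). A \<le> frft_weight \<alpha> \<phi> u \<and> frft_weight \<alpha> \<phi> u \<le> B)" for A B
    unfolding AE_circ_iff[symmetric] by (rule eventually_subst) (use eq in eventually_elim, simp)
  show ?thesis
    unfolding iff
  proof
    assume "riesz_basis (chirp_shift \<alpha> \<phi>) (V0 \<alpha> \<phi>)"
    then obtain A B where "A > 0" "B > 0"
      "AE u in circ (2 * pi * sin \<alpha>). A \<le> frft_weight \<alpha> \<phi> u \<and> frft_weight \<alpha> \<phi> u \<le> B"
      by (rule weight_bounds_of_riesz_basis[OF assms])
    then show "\<exists>A B. A > 0 \<and> B > 0 \<and>
      (AE u in circ (2 * pi * sin \<alpha>). A \<le> frft_weight \<alpha> \<phi> u \<and> frft_weight \<alpha> \<phi> u \<le> B)"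
      by (intro exI conjI)
  next
    assume "\<exists>A B. A > 0 \<and> B > 0 \<and>
      (AE u in circ (2 * pi * sin \<alpha>). A \<le> frft_weight \<alpha> \<phi> u \<and> frft_weight \<alpha> \<phi> u \<le> B)"
    then obtain A B where "A > 0" "B > 0"
      "AE u in circ (2 * pi * sin \<alpha>). A \<le> frft_weight \<alpha> \<phi> u \<and> frft_weight \<alpha> \<phi> u \<le> B"
      by (elim exE conjE)
    then show "riesz_basis (chirp_shift \<alpha> \<phi>) (V0 \<alpha> \<phi>)"
      by (rule riesz_basis_of_weight_bounds[OF assms])
  qed
qed

end
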